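(* Let $\lambda>0$ be fixed and, for each $\mu>0$, let $H^\mu_\lambda$ be the radial hedgehog in the unit ball $B_1\subset\mathbb{R}^3$. There exists a radial function $\xi\in C^\infty_c(B_1\setminus\{0\})$ such that the following holds. Given $\bar v\in\mathbb{S}^4$, if $\Phi_T:=\Phi-\bar H(\bar H:\Phi)$ denotes the tangential part along $\bar H$ of the vector field $\Phi=\xi\bar v\in C^\infty_c(B_1\setminus\{0\};\mathcal{S}_0)$, then $\Phi_T\in C^\infty_c(B_1\setminus\{0\};\mathcal{S}_0)$ and $\mathcal{F}_{\lambda,\mu}''(\Phi_T;H^\mu_\lambda)<0$ for all $\mu$ large enough. As a consequence, the radial hedgehog $H^\mu_\lambda$ is an unstable critical point of $\mathcal{F}_{\lambda,\mu}$ for all $\mu$ sufficiently large.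
   Context: $\mathcal{S}_0$ is the 5-dimensional space of real symmetric traceless $3\times 3$ matrices with inner product $P:Q=\mathrm{tr}(PQ)$ and norm $|Q|^2=\mathrm{tr}(Q^2)$; $\mathbb{S}^4=\{Q\in\mathcal{S}_0:|Q|=1\}$. The potential is $W(Q)=\frac{1}{4\sqrt6}|Q|^4-\frac13\mathrm{tr}(Q^3)+\frac{1}{12\sqrt6}$, and $$\mathcal{F}_{\lambda,\mu}(Q)=\int_{B_1}\tfrac12|\nabla Q|^2+\lambda W(Q)+\tfrac{\mu}{4}(1-|Q|^2)^2\,dx,\qquad Q\in W^{1,2}(B_1;\mathcal{S}_0).$$ The constant norm hedgehog is $\bar H(x)=\sqrt{\frac32}\left(\frac{x}{|x|}\otimes\frac{x}{|x|}-\frac13 I\right)$. The radial hedgehog is $$H^\mu_\lambda(x)=s^\mu_\lambda(|x|)\left(\frac{x}{|x|}\otimes\frac{x}{|x|}-\frac13 I\right),\quad 0<|x|<1,$$ with $s^\mu_\lambda$ increasing from $0$ at $|x|=0$ to $\sqrt{3/2}$ at $|x|=1$; it is a critical point of $\mathcal{F}_{\lambda,\mu}$ and it is the unique minimizer of $\mathcal{F}_{\lambda,\mu}$ among $O(3)$-equivariant maps $Q\in W^{1,2}(B_1;\mathcal{S}_0)$ (i.e. $Q(Rx)=RQ(x)R^{\mathsf t}$ for all $R\in O(3)$) which agree with $\bar H$ on $\partial B_1$. For $\Psi\in C^\infty_c(B_1;\mathcal{S}_0)$, $\mathcal{F}_{\lambda,\mu}''(\Psi;H^\mu_\lambda)=\left[\frac{d^2}{dt^2}\mathcal{F}_{\lambda,\mu}(H^\mu_\lambda+t\Psi)\right]_{t=0}$.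 Unstable means that this second variation is negative along some such $\Psi$. *)

theory Defs
  imports "HOL-Analysis.Analysis"
begin

section \<open>Symmetric traceless matrices\<close>

definition S0 :: "(real^3^3) set" where
  "S0 = {Q. transpose Q = Q \<and> trace Q = 0}"

text \<open>The inner product and norm that the library puts on the type of real 3 by 3 matrices
  are the entrywise (Frobenius) ones. On symmetric matrices they are \<open>tr (P Q)\<close>
  and \<open>sqrt (tr (Q Q))\<close>, so they serve as the inner product and norm of \<open>S0\<close>.\<close>

lemma inner_eq_trace:
  fixes P Q :: "real^3^3"
  assumes "P \<in> S0"
  shows "P \<bullet> Q = trace (P ** Q)"
proof -
  have "P $ j $ i = P $ i $ j" for i j
    using assms unfolding S0_def transpose_def by (metis (mono_tags, lifting) mem_Collect_eq vec_lambda_beta)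
  then have "trace (P ** Q) = (\<Sum>i\<in>UNIV. \<Sum>k\<in>UNIV. P $ k $ i * Q $ k $ i)"
    by (simp add: trace_def matrix_matrix_mult_def)
  also have "\<dots> = P \<bullet> Q"
    by (subst sum.swap) (simp add: inner_vec_def)
  finally show ?thesis by simp
qed

lemma norm_sq_eq_trace:
  fixes Q :: "real^3^3"
  assumes "Q \<in> S0"
  shows "(norm Q)\<^sup>2 = trace (Q ** Q)"
  using inner_eq_trace[OF assms, of Q] by (simp add: power2_norm_eq_inner)

definition S4 :: "(real^3^3) set" where
  "S4 = {Q \<in> S0. norm Q = 1}"

definition outer_product :: "real^3 \<Rightarrow> real^3 \<Rightarrow> real^3^3" where
  "outer_product u v = (\<chi> i j. u $ i * v $ j)"


section \<open>Smooth compactly supported functions\<close>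

abbreviation B1 :: "(real^3) set" where
  "B1 \<equiv> ball 0 1"

definition partial :: "3 \<Rightarrow> (real^3 \<Rightarrow> 'b::real_normed_vector) \<Rightarrow> real^3 \<Rightarrow> 'b" where
  "partial i f x = frechet_derivative f (at x) (axis i 1)"

fun times_cont_diff :: "nat \<Rightarrow> (real^3 \<Rightarrow> 'b::real_normed_vector) \<Rightarrow> bool" where
  "times_cont_diff 0 f \<longleftrightarrow> continuous_on UNIV f"
| "times_cont_diff (Suc n) f \<longleftrightarrow>
     (\<forall>x. f differentiable (at x)) \<and> (\<forall>i. times_cont_diff n (partial i f))"

definition smooth :: "(real^3 \<Rightarrow> 'b::real_normed_vector) \<Rightarrow> bool" where
  "smooth f \<longleftrightarrow> (\<forall>n. times_cont_diff n f)"

text \<open>Smooth functions with compact support in the open set \<open>U\<close> and values in \<open>V\<close>;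
  they are represented by their extension by zero to the whole space.\<close>

definition Cc_infty :: "(real^3) set \<Rightarrow> 'b set \<Rightarrow> (real^3 \<Rightarrow> 'b::real_normed_vector) set" where
  "Cc_infty U V = {f. smooth f \<and> range f \<subseteq> V \<and>
     compact (closure {x. f x \<noteq> 0}) \<and> closure {x. f x \<noteq> 0} \<subseteq> U}"


section \<open>Sobolev maps on the unit ball\<close>

definition locally_integrable :: "(real^3 \<Rightarrow> real^3^3) \<Rightarrow> bool" where
  "locally_integrable f \<longleftrightarrow> (\<forall>K. compact K \<and> K \<subseteq> B1 \<longrightarrow> set_integrable lebesgue K f)"

definition has_weak_partial :: "3 \<Rightarrow> (real^3 \<Rightarrow> real^3^3) \<Rightarrow> (real^3 \<Rightarrow> real^3^3) \<Rightarrow> bool" where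
  "has_weak_partial i Q g \<longleftrightarrow> locally_integrable Q \<and> locally_integrable g \<and>
     (\<forall>\<phi> \<in> Cc_infty B1 (UNIV :: real set).
        (LINT x|lebesgue_on B1. partial i \<phi> x *\<^sub>R Q x) = - (LINT x|lebesgue_on B1. \<phi> x *\<^sub>R g x))"

text \<open>Weak derivatives are unique up to null sets; any representative will do, as
  \<open>weak_partial\<close> is only used under integrals.\<close>

definition weak_partial :: "3 \<Rightarrow> (real^3 \<Rightarrow> real^3^3) \<Rightarrow> real^3 \<Rightarrow> real^3^3" where
  "weak_partial i Q = (SOME g. has_weak_partial i Q g)"

definition L2 :: "(real^3 \<Rightarrow> real^3^3) set" where
  "L2 = {f. f \<in> borel_measurable (lebesgue_on B1) \<and> integrable (lebesgue_on B1) (\<lambda>x. (norm (f x))\<^sup>2)}"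

definition W12 :: "(real^3 \<Rightarrow> real^3^3) set" where
  "W12 = {Q \<in> L2. (AE x in lebesgue_on B1. Q x \<in> S0) \<and> (\<forall>i. \<exists>g \<in> L2. has_weak_partial i Q g)}"

definition W12_dist_sq :: "(real^3 \<Rightarrow> real^3^3) \<Rightarrow> (real^3 \<Rightarrow> real^3^3) \<Rightarrow> real" where
  "W12_dist_sq P Q = (LINT x|lebesgue_on B1.
     (norm (P x - Q x))\<^sup>2 + (\<Sum>i\<in>UNIV. (norm (weak_partial i P x - weak_partial i Q x))\<^sup>2))"

definition W12_0 :: "(real^3 \<Rightarrow> real^3^3) set" where
  "W12_0 = {Q \<in> W12. \<exists>\<phi>. (\<forall>n. \<phi> n \<in> Cc_infty B1 S0) \<and> (\<lambda>n. W12_dist_sq Q (\<phi> n)) \<longlonglongrightarrow> 0}"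

text \<open>Equality on the unit sphere in the sense of Sobolev traces.\<close>

definition agree_on_boundary :: "(real^3 \<Rightarrow> real^3^3) \<Rightarrow> (real^3 \<Rightarrow> real^3^3) \<Rightarrow> bool" where
  "agree_on_boundary P Q \<longleftrightarrow> (\<lambda>x. P x - Q x) \<in> W12_0"


section \<open>The energy\<close>

definition W :: "real^3^3 \<Rightarrow> real" where
  "W Q = 1 / (4 * sqrt 6) * norm Q ^ 4 - 1 / 3 * trace (Q ** Q ** Q) + 1 / (12 * sqrt 6)"

definition energy :: "real \<Rightarrow> real \<Rightarrow> (real^3 \<Rightarrow> real^3^3) \<Rightarrow> real" where
  "energy lam \<mu> Q = (LINT x|lebesgue_on B1.
     1 / 2 * (\<Sum>i\<in>UNIV. (norm (weak_partial i Q x))\<^sup>2) + lam * W (Q x)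
       + \<mu> / 4 * (1 - (norm (Q x))\<^sup>2)\<^sup>2)"

definition critical_point :: "real \<Rightarrow> real \<Rightarrow> (real^3 \<Rightarrow> real^3^3) \<Rightarrow> bool" where
  "critical_point lam \<mu> Q \<longleftrightarrow> Q \<in> W12 \<and> (\<forall>\<Psi> \<in> Cc_infty B1 S0.
     ((\<lambda>t. energy lam \<mu> (\<lambda>x. Q x + t *\<^sub>R \<Psi> x)) has_real_derivative 0) (at 0))"

definition second_variation ::
  "real \<Rightarrow> real \<Rightarrow> (real^3 \<Rightarrow> real^3^3) \<Rightarrow> (real^3 \<Rightarrow> real^3^3) \<Rightarrow> real" where
  "second_variation lam \<mu> \<Psi> Q = (deriv ^^ 2) (\<lambda>t. energy lam \<mu> (\<lambda>x. Q x + t *\<^sub>R \<Psi> x)) 0"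

definition unstable_critical_point :: "real \<Rightarrow> real \<Rightarrow> (real^3 \<Rightarrow> real^3^3) \<Rightarrow> bool" where
  "unstable_critical_point lam \<mu> Q \<longleftrightarrow> critical_point lam \<mu> Q \<and>
     (\<exists>\<Psi> \<in> Cc_infty B1 S0. second_variation lam \<mu> \<Psi> Q < 0)"


section \<open>Hedgehogs\<close>

definition Hbar :: "real^3 \<Rightarrow> real^3^3" where
  "Hbar x = sqrt (3 / 2) *\<^sub>R
     (outer_product (x /\<^sub>R norm x) (x /\<^sub>R norm x) - (1 / 3) *\<^sub>R mat 1)"

definition equivariant :: "(real^3 \<Rightarrow> real^3^3) \<Rightarrow> bool" where
  "equivariant Q \<longleftrightarrow> (\<forall>R :: real^3^3. orthogonal_matrix R \<longrightarrow>
     (AE x in lebesgue_on B1. Q (R *v x) = R ** Q x ** transpose R))"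

definition admissible :: "(real^3 \<Rightarrow> real^3^3) set" where
  "admissible = {Q \<in> W12. equivariant Q \<and> agree_on_boundary Q Hbar}"

text \<open>The value of \<open>H\<close> at the origin and outside the open ball is irrelevant and left
  unconstrained. Uniqueness of the minimizer is up to null sets.\<close>

definition radial_hedgehog :: "real \<Rightarrow> real \<Rightarrow> (real^3 \<Rightarrow> real^3^3) \<Rightarrow> bool" where
  "radial_hedgehog lam \<mu> H \<longleftrightarrow>
     (\<exists>s :: real \<Rightarrow> real. continuous_on {0..1} s \<and> mono_on {0..1} s \<and> s 0 = 0 \<and> s 1 = sqrt (3 / 2) \<and>
        (\<forall>x. 0 < norm x \<and> norm x < 1 \<longrightarrow>
           H x = s (norm x) *\<^sub>R
             (outer_product (x /\<^sub>R norm x) (x /\<^sub>R norm x) - (1 / 3) *\<^sub>R mat 1))) \<and>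
     critical_point lam \<mu> H \<and>
     H \<in> admissible \<and>
     (\<forall>Q \<in> admissible. energy lam \<mu> H \<le> energy lam \<mu> Q \<and>
        (energy lam \<mu> Q = energy lam \<mu> H \<longrightarrow> (AE x in lebesgue_on B1. Q x = H x)))"

definition tangential_part :: "(real^3 \<Rightarrow> real^3^3) \<Rightarrow> real^3 \<Rightarrow> real^3^3" where
  "tangential_part \<Phi> x = \<Phi> x - (Hbar x \<bullet> \<Phi> x) *\<^sub>R Hbar x"

definition radial :: "(real^3 \<Rightarrow> real) \<Rightarrow> bool" where
  "radial \<xi> \<longleftrightarrow> (\<forall>x y. norm x = norm y \<longrightarrow> \<xi> x = \<xi> y)"

end

theory Submission
  imports Defs
begin

text \<open>
  Write \<open>H = u(|x|) Hbar\<close> with \<open>0 \<le> u \<le> 1\<close> increasing, \<open>\<Psi>\<close> for the tangential part of \<open>\<xi> v\<close> and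
  \<open>\<eta> = |\<Psi>|\<^sup>2\<close>. Because \<open>\<Psi>\<close> is orthogonal to \<open>H\<close>, the second variation is
  \<open>\<integral> |\<nabla>\<Psi>|\<^sup>2 + lam W''(H)[\<Psi>,\<Psi>] - \<mu> (1 - u\<^sup>2) \<eta>\<close>. The last term is a Lagrange multiplier for the constraint
  \<open>|Q| = 1\<close>, and the point is to identify its limit.

  Hbar is admissible and carries no penalty, so minimality of \<open>H\<close> bounds \<open>\<mu> \<integral> (1 - u\<^sup>2)\<^sup>2\<close> independently of
  \<open>\<mu>\<close>. As \<open>u\<close> is increasing, it tends to 1 uniformly away from the origin (\<open>hedgehog_norm_defect\<close>,
  \<open>hedgehog_profile_defect\<close>). Testing criticality with \<open>\<eta> Hbar\<close>, and moving both derivatives to the test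
  field, expresses \<open>\<mu> \<integral> (1 - u\<^sup>2) u \<eta>\<close> by an integral of \<open>u\<close> against a fixed function. Since
  \<open>|\<nabla>Hbar|\<^sup>2 = 6 / |x|\<^sup>2\<close>, its limit is \<open>6 \<integral> \<eta> / |x|\<^sup>2\<close>, up to a multiple of \<open>lam \<integral> \<eta>\<close>
  (\<open>second_variation_upper_bound\<close>).

  It remains to make \<open>\<integral> |\<nabla>\<Psi>|\<^sup>2 - 6 \<eta> / |x|\<^sup>2 + 4 lam \<eta>\<close> negative. Everything that depends on the direction \<open>v\<close>
  enters through means over spheres of \<open>|v x|\<^sup>2\<close> and \<open>(x \<bullet> v x)\<^sup>2\<close>, which are the same for all unit \<open>v\<close>
  (\<open>sphere_moment_2\<close>, \<open>sphere_moment_4\<close>). The result is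
  \<open>4/5 \<integral> |\<nabla>\<xi>|\<^sup>2 - 3 \<xi>\<^sup>2 / |x|\<^sup>2 + 4 lam \<xi>\<^sup>2\<close>. The constant 3 exceeds the Hardy constant 1/4, so the first two
  terms can be made negative; an explicit bump in \<open>ln |x|\<^sup>2\<close> with \<open>- \<Delta>\<xi> \<le> 2 \<xi> / |x|\<^sup>2\<close> does it
  (\<open>cutoff_hardy\<close>). Dilating it towards the origin makes the last term negligible
  (\<open>limit_density_negative\<close>).

  Two preparations make these computations legitimate. Weak derivatives are unique almost everywhere
  (\<open>has_weak_partial_unique\<close>), so the energy of \<open>H + t \<Psi>\<close> is a polynomial in \<open>t\<close>
  (\<open>energy_add_scaleR\<close>). And a calculus of smooth functions on open sets gives access to test fields built
  from the singular map \<open>Hbar\<close>.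
\<close>

section \<open>Calculus of smooth functions\<close>

text \<open>The recursion of \<open>times_cont_diff\<close>, relativised to a set. Working on open sets gives access to
  the functions that are singular at the origin, such as the hedgehog and \<open>ln\<close>; \<open>Ck_on_glue\<close> leads
  back to the whole space once they have been multiplied by a cut-off.\<close>

fun Ck_on :: "nat \<Rightarrow> (real^3) set \<Rightarrow> (real^3 \<Rightarrow> 'b::real_normed_vector) \<Rightarrow> bool" where
  "Ck_on 0 U f \<longleftrightarrow> continuous_on U f"
| "Ck_on (Suc n) U f \<longleftrightarrow> (\<forall>x\<in>U. f differentiable (at x)) \<and> (\<forall>i. Ck_on n U (partial i f))"

definition smooth_on :: "(real^3) set \<Rightarrow> (real^3 \<Rightarrow> 'b::real_normed_vector) \<Rightarrow> bool" where
  "smooth_on U f \<longleftrightarrow> (\<forall>n. Ck_on n U f)"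

lemma Ck_on_UNIV_iff: "Ck_on n UNIV f \<longleftrightarrow> times_cont_diff n f"
  by (induction n arbitrary: f) auto

lemma smooth_iff_smooth_on: "smooth f \<longleftrightarrow> smooth_on UNIV f"
  by (simp add: smooth_def smooth_on_def Ck_on_UNIV_iff)

lemma partial_eqI:
  assumes "(f has_derivative D) (at x)" "D (axis i 1) = c"
  shows "partial i f x = c"
  using frechet_derivative_at[OF assms(1)] assms(2) by (simp add: partial_def)

lemma partial_cong:
  assumes "open U" "x \<in> U" "\<And>y. y \<in> U \<Longrightarrow> f y = g y" "g differentiable at x"
  shows "partial i f x = partial i g x"
proof -
  have "(g has_derivative frechet_derivative g (at x)) (at x)"
    using assms(4) frechet_derivative_works by blast
  then have "(f has_derivative frechet_derivative g (at x)) (at x)"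
    using assms has_derivative_transform_within_open[of g _ x UNIV U f] by auto
  from partial_eqI[OF this refl] show ?thesis by (simp add: partial_def)
qed

lemma differentiable_cong_open:
  assumes "open U" "x \<in> U" "\<And>y. y \<in> U \<Longrightarrow> f y = g y" "g differentiable at x"
  shows "f differentiable at x"
  using assms has_derivative_transform_within_open[of g _ x UNIV U f]
  unfolding differentiable_def by metis

lemma Ck_on_cong:
  assumes "open U" "\<And>x. x \<in> U \<Longrightarrow> f x = g x" "Ck_on n U g"
  shows "Ck_on n U f"
  using assms(2,3)
proof (induction n arbitrary: f g)
  case 0
  then show ?case using continuous_on_cong[of U U f g] by simp
next
  case (Suc n)
  have d: "\<forall>x\<in>U. f differentiable (at x)"
    using Suc.prems differentiable_cong_open[OF assms(1), of _ f g] by simp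
  have "Ck_on n U (partial i f)" for i
  proof (rule Suc.IH[of _ "partial i g"])
    show "partial i f x = partial i g x" if "x \<in> U" for x
      using Suc.prems that partial_cong[OF assms(1) that, of f g] by simp
    show "Ck_on n U (partial i g)" using Suc.prems by simp
  qed
  with d show ?case by simp
qed

lemma Ck_on_SucD: "Ck_on (Suc n) U f \<Longrightarrow> Ck_on n U f"
proof (induction n arbitrary: f)
  case 0
  then show ?case
    by (auto intro!: continuous_at_imp_continuous_on differentiable_imp_continuous_within)
next
  case (Suc n)
  have "Ck_on n U (partial i f)" for i
    using Suc.IH[of "partial i f"] Suc.prems Ck_on.simps(2) by blast
  then show ?case using Suc.prems by (simp only: Ck_on.simps(2)) simp
qed

lemma Ck_on_subset: "Ck_on n U f \<Longrightarrow> V \<subseteq> U \<Longrightarrow> Ck_on n V f"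
  by (induction n arbitrary: f) (auto intro: continuous_on_subset)

lemma Ck_on_const: "Ck_on n U (\<lambda>x. c)"
proof (induction n arbitrary: c)
  case (Suc n)
  have "partial i (\<lambda>x. c) = (\<lambda>x. 0)" for i
    by (rule ext, rule partial_eqI[OF has_derivative_const]) simp
  then show ?case using Suc by simp
qed simp

abbreviation laplacian :: "(real^3 \<Rightarrow> 'b::real_normed_vector) \<Rightarrow> real^3 \<Rightarrow> 'b" where
  "laplacian f x \<equiv> \<Sum>i\<in>UNIV. partial i (partial i f) x"

lemma partial_eq_0_open:
  assumes "open U" "x \<in> U" "\<And>y. y \<in> U \<Longrightarrow> f y = 0"
  shows "partial i f x = 0"
  by (rule partial_eqI[OF has_derivative_transform_within_open[OF has_derivative_const[of 0] assms(1,2)]])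
     (use assms(3) in auto)

lemma partial_bounded_linear_ident:
  assumes "bounded_linear A"
  shows "partial i A x = A (axis i 1)"
  by (rule partial_eqI[OF bounded_linear_imp_has_derivative[OF assms]]) simp

lemma Ck_on_bounded_linear_ident:
  assumes "bounded_linear A"
  shows "Ck_on n U A"
proof (cases n)
  case 0
  then show ?thesis using linear_continuous_on[OF assms] by simp
next
  case (Suc m)
  have "partial i A = (\<lambda>x. A (axis i 1))" for i
    by (rule ext, rule partial_bounded_linear_ident[OF assms])
  then show ?thesis
    using Suc bounded_linear_imp_differentiable[OF assms] by (simp add: Ck_on_const)
qed

lemma Ck_on_add:
  assumes "open U" "Ck_on n U f" "Ck_on n U g"
  shows "Ck_on n U (\<lambda>x. f x + g x)"
  using assms(2,3)
proof (induction n arbitrary: f g)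
  case 0 then show ?case by (simp add: continuous_on_add)
next
  case (Suc n)
  have "Ck_on n U (partial i (\<lambda>x. f x + g x))" for i
  proof (rule Ck_on_cong[OF assms(1)])
    fix x assume x: "x \<in> U"
    then have "(f has_derivative frechet_derivative f (at x)) (at x)"
      "(g has_derivative frechet_derivative g (at x)) (at x)"
      using Suc.prems by (auto simp: frechet_derivative_works)
    from has_derivative_add[OF this]
    show "partial i (\<lambda>x. f x + g x) x = partial i f x + partial i g x"
      by (rule partial_eqI) (simp add: partial_def)
  next
    show "Ck_on n U (\<lambda>x. partial i f x + partial i g x)" using Suc by simp
  qed
  then show ?case using Suc.prems by simp
qed

text \<open>Leibniz' rule produces two terms that contain one undifferentiated factor each, so the induction
  needs that being differentiable one more time is the stronger property.\<close>

lemma Ck_on_bilinear: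
  assumes "open U" "bounded_bilinear pr" "Ck_on n U f" "Ck_on n U g"
  shows "Ck_on n U (\<lambda>x. pr (f x) (g x))"
  using assms(3,4)
proof (induction n arbitrary: f g)
  case 0 then show ?case using bounded_bilinear.continuous_on[OF assms(2)] by simp
next
  case (Suc n)
  have d: "((\<lambda>x. pr (f x) (g x)) has_derivative
     (\<lambda>h. pr (f x) (frechet_derivative g (at x) h) + pr (frechet_derivative f (at x) h) (g x))) (at x)"
     if x: "x \<in> U" for x
  proof -
    have "(f has_derivative frechet_derivative f (at x)) (at x)"
      "(g has_derivative frechet_derivative g (at x)) (at x)"
      using Suc.prems x by (auto simp: frechet_derivative_works)
    from bounded_bilinear.FDERIV[OF assms(2) this] show ?thesis .
  qed
  have "Ck_on n U (partial i (\<lambda>x. pr (f x) (g x)))" for i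
  proof (rule Ck_on_cong[OF assms(1)])
    fix x assume x: "x \<in> U"
    from d[OF this]
    show "partial i (\<lambda>x. pr (f x) (g x)) x = pr (f x) (partial i g x) + pr (partial i f x) (g x)"
      by (rule partial_eqI) (simp add: partial_def)
  next
    show "Ck_on n U (\<lambda>x. pr (f x) (partial i g x) + pr (partial i f x) (g x))"
      using Suc.prems Ck_on_SucD[OF Suc.prems(1)] Ck_on_SucD[OF Suc.prems(2)]
      by (intro Ck_on_add assms(1) Suc.IH) auto
  qed
  then show ?case using d by (auto simp: differentiable_def)
qed

lemma Ck_on_inverse:
  fixes f :: "real^3 \<Rightarrow> real"
  assumes "open U" "\<And>x. x \<in> U \<Longrightarrow> f x \<noteq> 0" "Ck_on n U f"
  shows "Ck_on n U (\<lambda>x. inverse (f x))"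
  using assms(3)
proof (induction n)
  case 0 then show ?case using assms(2) by (auto intro: continuous_on_inverse)
next
  case (Suc n)
  have d: "((\<lambda>x. inverse (f x)) has_derivative
     (\<lambda>h. - (inverse (f x) * frechet_derivative f (at x) h * inverse (f x)))) (at x)"
     if x: "x \<in> U" for x
    using Suc.prems x assms(2)
    by (intro Deriv.has_derivative_inverse) (auto simp: frechet_derivative_works)
  have "Ck_on n U (partial i (\<lambda>x. inverse (f x)))" for i
  proof (rule Ck_on_cong[OF assms(1)])
    fix x assume x: "x \<in> U"
    from d[OF this]
    show "partial i (\<lambda>x. inverse (f x)) x = - 1 * (inverse (f x) * partial i f x * inverse (f x))"
      by (rule partial_eqI) (simp add: partial_def)
  next
    have *: "Ck_on n U (\<lambda>x. inverse (f x))" using Suc.IH Suc.prems Ck_on_SucD by blast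
    show "Ck_on n U (\<lambda>x. - 1 * (inverse (f x) * partial i f x * inverse (f x)))"
      using Suc.prems
      by (intro Ck_on_bilinear[OF assms(1) bounded_bilinear_mult] Ck_on_const *) auto
  qed
  then show ?case using d by (auto simp: differentiable_def)
qed

lemma Ck_on_ln:
  fixes f :: "real^3 \<Rightarrow> real"
  assumes "open U" "\<And>x. x \<in> U \<Longrightarrow> f x > 0" "Ck_on n U f"
  shows "Ck_on n U (\<lambda>x. ln (f x))"
proof (cases n)
  case 0
  have "\<forall>x\<in>U. f x \<noteq> 0" using assms(2) by fastforce
  then show ?thesis using assms(3) 0 by (simp add: continuous_on_ln)
next
  case (Suc m)
  have d: "((\<lambda>x. ln (f x)) has_derivative (\<lambda>h. frechet_derivative f (at x) h * inverse (f x))) (at x)"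
     if x: "x \<in> U" for x
    using assms Suc x by (intro has_derivative_ln) (auto simp: frechet_derivative_works)
  have "Ck_on m U (partial i (\<lambda>x. ln (f x)))" for i
  proof (rule Ck_on_cong[OF assms(1)])
    fix x assume x: "x \<in> U"
    from d[OF this]
    show "partial i (\<lambda>x. ln (f x)) x = partial i f x * inverse (f x)"
      by (rule partial_eqI) (simp add: partial_def)
  next
    show "Ck_on m U (\<lambda>x. partial i f x * inverse (f x))"
    proof (intro Ck_on_bilinear[OF assms(1) bounded_bilinear_mult] Ck_on_inverse assms(1))
      show "f x \<noteq> 0" if "x \<in> U" for x using assms(2)[OF that] by simp
      show "Ck_on m U f" using assms(3) Ck_on_SucD Suc by blast
      show "Ck_on m U (partial i f)" using assms(3) Suc by simp
    qed
  qed
  then show ?thesis using d Suc by (auto simp: differentiable_def)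
qed

text \<open>Near a point outside \<open>K\<close> the function vanishes identically, near a point of \<open>K\<close> it is as regular as
  it is on \<open>U\<close>; the partial derivatives inherit the hypothesis, which makes the induction work.\<close>

lemma Ck_on_glue:
  assumes "open U" "closed K" "K \<subseteq> U" "\<And>x. x \<notin> K \<Longrightarrow> f x = 0" "Ck_on n U f"
  shows "Ck_on n UNIV f"
  using assms(4,5)
proof (induction n arbitrary: f)
  case 0
  have "continuous_on (U \<union> - K) f"
  proof (rule continuous_on_open_Un)
    have "continuous_on (- K) (\<lambda>x. 0 :: 'a)" by simp
    then show "continuous_on (- K) f" by (rule continuous_on_eq) (simp add: 0)
  qed (use 0 assms in auto)
  moreover have "U \<union> - K = UNIV" using assms by auto
  ultimately show ?case by simp
next
  case (Suc n)
  have z: "(f has_derivative (\<lambda>h. 0)) (at x)" if "x \<notin> K" for x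
    using that Suc.prems(1) assms(2)
    by (intro has_derivative_transform_within_open[OF has_derivative_const[of 0], of "-K"]) (auto simp: open_Compl)
  have "f differentiable at x" for x
    using z Suc.prems assms(3) by (cases "x \<in> K") (auto simp: differentiable_def)
  moreover have "Ck_on n UNIV (partial i f)" for i
    using Suc.prems by (intro Suc.IH partial_eqI[OF z]) auto
  ultimately show ?case by simp
qed

lemma smooth_on_differentiable: "smooth_on U f \<Longrightarrow> x \<in> U \<Longrightarrow> f differentiable at x"
  unfolding smooth_on_def using Ck_on.simps(2)[of 0 U f] by blast

lemma smooth_on_partial: "smooth_on U f \<Longrightarrow> smooth_on U (partial i f)"
  unfolding smooth_on_def using Ck_on.simps(2)[of _ U f] by blast

lemma smooth_on_continuous: "smooth_on U f \<Longrightarrow> continuous_on U f"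
  unfolding smooth_on_def using Ck_on.simps(1)[of U f] by blast

lemma smooth_on_subset: "smooth_on U f \<Longrightarrow> V \<subseteq> U \<Longrightarrow> smooth_on V f"
  unfolding smooth_on_def using Ck_on_subset by blast

named_theorems smooth_intros

lemma smooth_on_const [smooth_intros]: "smooth_on U (\<lambda>x. c)"
  by (simp add: smooth_on_def Ck_on_const)

lemma smooth_on_bounded_linear_ident: "bounded_linear A \<Longrightarrow> smooth_on U A"
  by (simp add: smooth_on_def Ck_on_bounded_linear_ident)

lemma smooth_on_ident [smooth_intros]: "smooth_on U (\<lambda>x. x)"
  by (rule smooth_on_bounded_linear_ident[OF bounded_linear_ident])

lemma smooth_on_add [smooth_intros]:
  "open U \<Longrightarrow> smooth_on U f \<Longrightarrow> smooth_on U g \<Longrightarrow> smooth_on U (\<lambda>x. f x + g x)"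
  by (simp add: smooth_on_def Ck_on_add)

lemma smooth_on_bilinear:
  assumes "open U" "bounded_bilinear pr" "smooth_on U f" "smooth_on U g"
  shows "smooth_on U (\<lambda>x. pr (f x) (g x))"
  using assms Ck_on_bilinear unfolding smooth_on_def by blast

lemmas smooth_on_scaleR [smooth_intros] = smooth_on_bilinear[OF _ bounded_bilinear_scaleR]
lemmas smooth_on_inner [smooth_intros] = smooth_on_bilinear[OF _ bounded_bilinear_inner]
lemmas smooth_on_mult [smooth_intros] =
  smooth_on_bilinear[OF _ bounded_bilinear_mult[where 'a=real]]

lemma smooth_on_bounded_linear:
  assumes "open U" "bounded_linear A" "smooth_on U f"
  shows "smooth_on U (\<lambda>x. A (f x))"
proof -
  have "bounded_bilinear (\<lambda>(c::real) y. c *\<^sub>R A y)"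
    using bounded_bilinear.comp[OF bounded_bilinear_scaleR bounded_linear_ident assms(2)] by simp
  from smooth_on_bilinear[OF assms(1) this smooth_on_const[of U 1] assms(3)] show ?thesis by simp
qed

lemma smooth_on_nth [smooth_intros]:
  "open U \<Longrightarrow> smooth_on U f \<Longrightarrow> smooth_on U (\<lambda>x. f x $ i)"
  using smooth_on_bounded_linear[OF _ bounded_linear_vec_nth] .

lemma smooth_on_minus [smooth_intros]:
  "open U \<Longrightarrow> smooth_on U f \<Longrightarrow> smooth_on U (\<lambda>x. - f x)"
  using smooth_on_bounded_linear[OF _ bounded_linear_minus[OF bounded_linear_ident]] by blast

lemma smooth_on_diff [smooth_intros]:
  "open U \<Longrightarrow> smooth_on U f \<Longrightarrow> smooth_on U g \<Longrightarrow> smooth_on U (\<lambda>x. f x - g x)"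
  using smooth_on_add[OF _ _ smooth_on_minus, of U f g] by simp

lemma smooth_on_inverse [smooth_intros]:
  "open U \<Longrightarrow> (\<And>x. x \<in> U \<Longrightarrow> f x \<noteq> 0) \<Longrightarrow> smooth_on U f \<Longrightarrow> smooth_on U (\<lambda>x. inverse (f x) :: real)"
  by (simp add: smooth_on_def Ck_on_inverse)

lemma smooth_on_divide [smooth_intros]:
  "open U \<Longrightarrow> (\<And>x. x \<in> U \<Longrightarrow> g x \<noteq> 0) \<Longrightarrow> smooth_on U f \<Longrightarrow> smooth_on U g
    \<Longrightarrow> smooth_on U (\<lambda>x. f x / g x :: real)"
  unfolding divide_inverse by (intro smooth_intros)

lemma smooth_on_power [smooth_intros]:
  "open U \<Longrightarrow> smooth_on U f \<Longrightarrow> smooth_on U (\<lambda>x. f x ^ n :: real)"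
  by (induction n) (auto intro: smooth_intros)

lemma smooth_on_ln [smooth_intros]:
  "open U \<Longrightarrow> (\<And>x. x \<in> U \<Longrightarrow> f x > 0) \<Longrightarrow> smooth_on U f \<Longrightarrow> smooth_on U (\<lambda>x. ln (f x :: real))"
  by (simp add: smooth_on_def Ck_on_ln)

lemma smooth_on_sum [smooth_intros]:
  "open U \<Longrightarrow> (\<And>i. i \<in> I \<Longrightarrow> smooth_on U (f i)) \<Longrightarrow> smooth_on U (\<lambda>x. \<Sum>i\<in>I. f i x)"
  by (induction I rule: infinite_finite_induct) (auto intro: smooth_intros)

lemma smooth_on_prod [smooth_intros]:
  "open U \<Longrightarrow> (\<And>i. i \<in> I \<Longrightarrow> smooth_on U (f i)) \<Longrightarrow> smooth_on U (\<lambda>x. \<Prod>i\<in>I. f i x :: real)"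
  by (induction I rule: infinite_finite_induct) (auto intro: smooth_intros)

section \<open>Bump functions\<close>

text \<open>The function \<open>exp (- 1 / y) / y ^ k\<close>, extended by zero. The family is closed under
  differentiation up to linear combinations, so the case \<open>k = 0\<close>, which is the source of all bump
  functions below, is smooth by an induction that treats all \<open>k\<close> at once.\<close>

definition flat_exp :: "nat \<Rightarrow> real \<Rightarrow> real" where
  "flat_exp k y = (if y \<le> 0 then 0 else exp (- inverse y) * inverse y ^ k)"

text \<open>In terms of \<open>1 / y\<close> this is the fact that \<open>exp\<close> beats every power.\<close>

lemma flat_exp_tendsto_0: "(flat_exp k \<longlongrightarrow> 0) (at 0)"
proof -
  have "((\<lambda>z::real. z ^ k / exp z) \<longlongrightarrow> 0) at_top"
    by (rule tendsto_power_div_exp_0)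
  then have "((\<lambda>y::real. inverse y ^ k / exp (inverse y)) \<longlongrightarrow> 0) (at_right 0)"
    using filterlim_compose filterlim_inverse_at_top_right by blast
  then have "(flat_exp k \<longlongrightarrow> 0) (at_right 0)"
    by (rule Lim_transform_eventually)
       (auto simp: flat_exp_def eventually_at_right_field exp_minus field_simps intro!: exI[of _ 1])
  moreover have "(flat_exp k \<longlongrightarrow> 0) (at_left 0)"
    by (rule Lim_transform_eventually[OF tendsto_const])
       (auto simp: flat_exp_def eventually_at_left_field intro!: exI[of _ "-1"])
  ultimately show ?thesis by (simp add: filterlim_split_at)
qed

lemma DERIV_flat_exp:
  "(flat_exp k has_real_derivative flat_exp (k + 2) y - real k * flat_exp (k + 1) y) (at y)"
proof (cases y "0::real" rule: linorder_cases)
  case less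
  have "((\<lambda>_. 0) has_real_derivative 0) (at y)" by simp
  then have "(flat_exp k has_real_derivative 0) (at y)"
    by (rule has_field_derivative_transform_within_open[where S="{..<0}"])
       (use less in \<open>auto simp: flat_exp_def\<close>)
  then show ?thesis using less by (simp add: flat_exp_def)
next
  case equal
  have "((\<lambda>h. flat_exp k h / h) \<longlongrightarrow> 0) (at 0)"
    by (rule Lim_transform_eventually[OF flat_exp_tendsto_0[of "Suc k"]])
       (auto simp: flat_exp_def eventually_at_filter divide_inverse)
  then have "(flat_exp k has_real_derivative 0) (at 0)"
    by (simp add: DERIV_def flat_exp_def[of k 0])
  then show ?thesis using equal by (simp add: flat_exp_def)
next
  case greater
  have "((\<lambda>y. exp (- inverse y) * inverse y ^ k) has_real_derivative
      exp (- inverse y) * inverse y ^ (k + 2) - real k * (exp (- inverse y) * inverse y ^ (k + 1))) (at y)"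
    using greater
    by (auto intro!: derivative_eq_intros simp: algebra_simps power2_eq_square)
       (cases k; simp add: algebra_simps)
  then have "(flat_exp k has_real_derivative
      exp (- inverse y) * inverse y ^ (k + 2) - real k * (exp (- inverse y) * inverse y ^ (k + 1))) (at y)"
    by (rule has_field_derivative_transform_within_open[where S="{0<..}"])
       (use greater in \<open>auto simp: flat_exp_def\<close>)
  then show ?thesis using greater by (simp add: flat_exp_def)
qed

lemma continuous_on_flat_exp: "continuous_on A (flat_exp k)"
  by (meson DERIV_flat_exp DERIV_isCont continuous_at_imp_continuous_on)

lemma Ck_on_flat_exp:
  assumes "open U" "Ck_on n U f"
  shows "Ck_on n U (\<lambda>x. flat_exp k (f x))"
  using assms(2)
proof (induction n arbitrary: k)
  case 0
  then show ?case using continuous_on_compose2[OF continuous_on_flat_exp] by auto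
next
  case (Suc n)
  have d: "((\<lambda>x. flat_exp k (f x)) has_derivative
     (\<lambda>h. frechet_derivative f (at x) h * (flat_exp (k + 2) (f x) - real k * flat_exp (k + 1) (f x)))) (at x)"
     if x: "x \<in> U" for x
    by (rule DERIV_compose_FDERIV[OF DERIV_flat_exp])
       (use Suc.prems x in \<open>auto simp: frechet_derivative_works\<close>)
  have "Ck_on n U (partial i (\<lambda>x. flat_exp k (f x)))" for i
  proof (rule Ck_on_cong[OF assms(1)])
    fix x assume x: "x \<in> U"
    from d[OF this]
    show "partial i (\<lambda>x. flat_exp k (f x)) x
        = partial i f x * (flat_exp (k + 2) (f x) + - real k * flat_exp (k + 1) (f x))"
      by (rule partial_eqI) (simp add: partial_def)
  next
    have *: "Ck_on n U (\<lambda>x. flat_exp m (f x))" for m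
      using Suc.IH Ck_on_SucD[OF Suc.prems] by blast
    show "Ck_on n U (\<lambda>x. partial i f x * (flat_exp (k + 2) (f x) + - real k * flat_exp (k + 1) (f x)))"
      using Suc.prems
      by (intro Ck_on_bilinear[OF assms(1) bounded_bilinear_mult] Ck_on_const Ck_on_add assms(1) *) auto
  qed
  then show ?case using d by (auto simp: differentiable_def)
qed

lemma smooth_on_flat_exp [smooth_intros]:
  "open U \<Longrightarrow> smooth_on U f \<Longrightarrow> smooth_on U (\<lambda>x. flat_exp k (f x))"
  by (simp add: smooth_on_def Ck_on_flat_exp)

lemma flat_exp_0_bounds: "0 \<le> flat_exp 0 y" "flat_exp 0 y \<le> 1"
  by (auto simp: flat_exp_def)

section \<open>Compactly supported smooth functions\<close>

lemma Cc_inftyD: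
  assumes "f \<in> Cc_infty U V"
  shows "smooth f" "\<And>x. f x \<in> V" "\<And>x. x \<notin> U \<Longrightarrow> f x = 0"
    "compact (closure {x. f x \<noteq> 0})" "closure {x. f x \<noteq> 0} \<subseteq> U"
  using assms closure_subset[of "{x. f x \<noteq> 0}"] unfolding Cc_infty_def by auto

lemma Cc_infty_smooth_on: "f \<in> Cc_infty U V \<Longrightarrow> smooth_on S f"
  using Cc_inftyD(1) smooth_iff_smooth_on smooth_on_subset by blast

text \<open>The usual way in: a smooth function on a punctured set, known to vanish off a compact set.\<close>

lemma Cc_inftyI:
  assumes "open S" "compact K" "K \<subseteq> S" "K \<subseteq> U" "\<And>x. x \<notin> K \<Longrightarrow> f x = 0" "smooth_on S f" "\<And>x. f x \<in> V"
  shows "f \<in> Cc_infty U V"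
proof -
  have cl: "closure {x. f x \<noteq> 0} \<subseteq> K"
    using assms(2,5) by (intro closure_minimal compact_imp_closed) auto
  have "smooth_on UNIV f"
    using assms Ck_on_glue[of S K f] compact_imp_closed unfolding smooth_on_def by blast
  moreover have "compact (closure {x. f x \<noteq> 0})"
    using cl assms(2) by (metis closed_Int_compact closed_closure inf.absorb_iff1)
  ultimately show ?thesis
    using cl assms unfolding Cc_infty_def smooth_iff_smooth_on by blast
qed

text \<open>An operation that maps zero to zero cannot enlarge the support, so for anything built from \<open>f\<close>
  only smoothness and the range are left to check.\<close>

lemma Cc_infty_transfer:
  assumes "f \<in> Cc_infty U V" "open S" "U \<subseteq> S" "\<And>x. f x = 0 \<Longrightarrow> h x = 0" "smooth_on S h" "\<And>x. h x \<in> V'"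
  shows "h \<in> Cc_infty U V'"
proof (rule Cc_inftyI[OF assms(2), of "closure {x. f x \<noteq> 0}"])
  show "h x = 0" if "x \<notin> closure {x. f x \<noteq> 0}" for x
    using that closure_subset[of "{x. f x \<noteq> 0}"] assms(4) by blast
qed (use Cc_inftyD[OF assms(1)] assms in auto)

lemma Cc_infty_mono: "f \<in> Cc_infty U V \<Longrightarrow> U \<subseteq> U' \<Longrightarrow> V \<subseteq> V' \<Longrightarrow> f \<in> Cc_infty U' V'"
  unfolding Cc_infty_def by auto

lemma partial_Cc_infty:
  assumes "f \<in> Cc_infty U V"
  shows "partial i f \<in> Cc_infty U UNIV"
proof (rule Cc_inftyI[of UNIV "closure {x. f x \<noteq> 0}"])
  show "partial i f x = 0" if "x \<notin> closure {x. f x \<noteq> 0}" for x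
    by (rule partial_eq_0_open[of "- closure {x. f x \<noteq> 0}"])
       (use that closure_subset[of "{x. f x \<noteq> 0}"] in \<open>auto simp: open_Compl\<close>)
qed (use Cc_inftyD[OF assms] smooth_on_partial[OF Cc_infty_smooth_on[OF assms]] in auto)

lemma Cc_infty_bounded:
  assumes "f \<in> Cc_infty U V"
  obtains B where "B > 0" "\<And>x. norm (f x) \<le> B"
proof -
  have "compact (f ` closure {x. f x \<noteq> 0})"
    using Cc_inftyD(4)[OF assms] Cc_infty_smooth_on[OF assms] smooth_on_continuous
    by (intro compact_continuous_image) blast+
  then obtain B where B: "B > 0" "\<And>x. x \<in> closure {x. f x \<noteq> 0} \<Longrightarrow> norm (f x) \<le> B"
    using compact_imp_bounded bounded_pos by (metis imageI)
  have "norm (f x) \<le> B" for x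
    using B closure_subset[of "{x. f x \<noteq> 0}"] by (cases "f x = 0") auto
  with B show ?thesis using that by blast
qed

lemma Cc_infty_bilinear:
  assumes "f \<in> Cc_infty U V" "open S" "U \<subseteq> S" "smooth_on S h" "bounded_bilinear pr"
  shows "(\<lambda>x. pr (f x) (h x)) \<in> Cc_infty U UNIV"
  by (rule Cc_infty_transfer[OF assms(1-3)])
     (use assms in \<open>auto intro: smooth_on_bilinear Cc_infty_smooth_on simp: bounded_bilinear.zero_left\<close>)

section \<open>Rules for partial derivatives\<close>

lemma partial_bilinear:
  assumes "bounded_bilinear pr" "f differentiable at x" "g differentiable at x"
  shows "partial i (\<lambda>x. pr (f x) (g x)) x = pr (f x) (partial i g x) + pr (partial i f x) (g x)"
  by (rule partial_eqI[OF bounded_bilinear.FDERIV[OF assms(1)]])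
     (use assms in \<open>auto simp: frechet_derivative_works partial_def\<close>)

lemmas partial_scaleR = partial_bilinear[OF bounded_bilinear_scaleR]
lemmas partial_inner = partial_bilinear[OF bounded_bilinear_inner]
lemmas partial_mult = partial_bilinear[OF bounded_bilinear_mult[where 'a=real]]

lemma partial_add:
  assumes "f differentiable at x" "g differentiable at x"
  shows "partial i (\<lambda>x. f x + g x) x = partial i f x + partial i g x"
  by (rule partial_eqI[OF has_derivative_add])
     (use assms in \<open>auto simp: frechet_derivative_works partial_def\<close>)

lemma partial_diff:
  assumes "f differentiable at x" "g differentiable at x"
  shows "partial i (\<lambda>x. f x - g x) x = partial i f x - partial i g x"
  by (rule partial_eqI[OF has_derivative_diff])
     (use assms in \<open>auto simp: frechet_derivative_works partial_def\<close>)

lemma partial_const: "partial i (\<lambda>x. c) x = 0"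
  by (rule partial_eqI[OF has_derivative_const]) simp

section \<open>Integration by parts\<close>

lemma continuous_compact_support_integrable:
  fixes f :: "real^3 \<Rightarrow> 'b::euclidean_space"
  assumes "continuous_on UNIV f" "compact K" "\<And>x. x \<notin> K \<Longrightarrow> f x = 0"
  shows "integrable lborel f"
proof -
  have "integrable lborel (\<lambda>x. indicator K x *\<^sub>R f x)"
    by (rule borel_integrable_compact) (use assms in \<open>auto intro: continuous_on_subset\<close>)
  moreover have "(\<lambda>x. indicator K x *\<^sub>R f x) = f"
    using assms(3) by (auto simp: indicator_def)
  ultimately show ?thesis by simp
qed

lemma Cc_infty_integrable_lborel:
  fixes f :: "real^3 \<Rightarrow> 'b::euclidean_space"
  assumes "f \<in> Cc_infty U V"
  shows "integrable lborel f"
  by (rule continuous_compact_support_integrable[of _ "closure {x. f x \<noteq> 0}"])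
     (use Cc_inftyD[OF assms] smooth_on_continuous[OF Cc_infty_smooth_on[OF assms]]
       closure_subset[of "{x. f x \<noteq> 0}"] in auto)

lemma lborel_integral_translation:
  fixes f :: "real^3 \<Rightarrow> 'b::euclidean_space"
  assumes "f \<in> borel_measurable borel"
  shows "(LINT x|lborel. f (x + a)) = (LINT x|lborel. f x)"
proof -
  have "(LINT x|lborel. f x) = (LINT x|distr lborel borel ((+) a). f x)"
    by (simp add: lborel_distr_plus)
  also have "\<dots> = (LINT x|lborel. f (a + x))"
    using assms by (intro integral_distr) auto
  finally show ?thesis by (simp add: add.commute)
qed

text \<open>Translation invariance makes the integral of every difference quotient vanish. The quotients are
  dominated by a Lipschitz constant of \<open>f\<close> on a fixed ball, so the limit may be taken under the
  integral; no iterated integration is involved.\<close>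

lemma integral_partial_lborel:
  fixes f :: "real^3 \<Rightarrow> 'b::euclidean_space"
  assumes f: "f \<in> Cc_infty U V"
  shows "(LINT x|lborel. partial i f x) = 0"
proof -
  let ?e = "axis i 1 :: real^3" and ?K = "closure {x. f x \<noteq> 0}"
  have cont: "continuous_on UNIV f"
    using smooth_on_continuous[OF Cc_infty_smooth_on[OF f]] .
  then have meas: "f \<in> borel_measurable borel" by (rule borel_measurable_continuous_onI)
  have int: "integrable lborel f" by (rule Cc_infty_integrable_lborel[OF f])
  have intt: "integrable lborel (\<lambda>x. f (x + a))" for a
    using int meas by (subst (asm) lborel_distr_plus[symmetric, of a], subst (asm) integrable_distr_eq)
       (auto simp: add.commute)
  obtain B where B: "B > 0" "\<And>x. norm (partial i f x) \<le> B"
    using Cc_infty_bounded[OF partial_Cc_infty[OF f]] by metis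
  have der: "((\<lambda>h. f (x + h *\<^sub>R ?e)) has_vector_derivative partial i f (x + h *\<^sub>R ?e)) (at h within S)" for x h S
  proof -
    have lin: "linear (frechet_derivative f (at (x + h *\<^sub>R ?e)))"
      and fd: "(f has_derivative frechet_derivative f (at (x + h *\<^sub>R ?e))) (at (x + h *\<^sub>R ?e))"
      using smooth_on_differentiable[OF Cc_infty_smooth_on[OF f, of UNIV]]
      by (auto simp: frechet_derivative_works linear_frechet_derivative)
    have "((\<lambda>h. x + h *\<^sub>R ?e) has_derivative (\<lambda>k. k *\<^sub>R ?e)) (at h within S)"
      by (auto intro!: derivative_eq_intros)
    from has_derivative_compose[where g = f, OF this fd]
    have "((\<lambda>h. f (x + h *\<^sub>R ?e)) has_derivative (\<lambda>k. frechet_derivative f (at (x + h *\<^sub>R ?e)) (k *\<^sub>R ?e))) (at h within S)" .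
    then show ?thesis using linear_scale[OF lin] by (simp add: has_vector_derivative_def partial_def)
  qed
  have lip: "norm (f (x + h *\<^sub>R ?e) - f x) \<le> B * \<bar>h\<bar>" for x h
  proof -
    have "norm (f (x + h *\<^sub>R ?e) - f (x + 0 *\<^sub>R ?e)) \<le> B * norm (h - 0)"
      by (rule differentiable_bound[of UNIV "\<lambda>h. f (x + h *\<^sub>R ?e)" "\<lambda>h k. k *\<^sub>R partial i f (x + h *\<^sub>R ?e)"])
         (use der B in \<open>auto simp: has_vector_derivative_def mult.commute[of B] intro!: onorm_le mult_left_mono\<close>)
    then show ?thesis by simp
  qed
  define D where "D = (\<lambda>n x. real (Suc n) *\<^sub>R (f (x + inverse (real (Suc n)) *\<^sub>R ?e) - f x))"
  obtain R where R: "R > 0" "\<And>x. x \<in> ?K \<Longrightarrow> norm x \<le> R"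
    using Cc_inftyD(4)[OF f] compact_imp_bounded bounded_pos by metis
  have fz: "f x = 0" if "norm x > R" for x
    using R(2)[of x] that closure_subset[of "{x. f x \<noteq> 0}"] by force
  have "(\<lambda>n. LINT x|lborel. D n x) \<longlonglongrightarrow> (LINT x|lborel. partial i f x)"
  proof (rule integral_dominated_convergence[where w="\<lambda>x. B * indicator (cball 0 (R + 1)) x"])
    show "partial i f \<in> borel_measurable lborel"
      using smooth_on_continuous[OF Cc_infty_smooth_on[OF partial_Cc_infty[OF f]], of UNIV]
      by (auto intro: borel_measurable_continuous_onI)
    show "D n \<in> borel_measurable lborel" for n
      unfolding D_def by (intro borel_measurable_scaleR borel_measurable_diff
        borel_measurable_integrable[OF int] borel_measurable_integrable[OF intt]) auto
    show "integrable lborel (\<lambda>x. B * indicator (cball 0 (R + 1)) x)"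
      by (rule integrable_mult_right, rule integrable_real_indicator) (simp, rule emeasure_lborel_cball_finite)
    show "AE x in lborel. (\<lambda>n. D n x) \<longlonglongrightarrow> partial i f x"
    proof (rule AE_I2)
      fix x
      let ?q = "\<lambda>h. (f (x + h *\<^sub>R ?e) - f x) /\<^sub>R h"
      have "((\<lambda>h. norm (f (x + h *\<^sub>R ?e) - f x - h *\<^sub>R partial i f x) / norm h) \<longlongrightarrow> 0) (at 0)"
        using der[of x 0 UNIV] by (simp add: has_vector_derivative_def has_derivative_at)
      then have "((\<lambda>h. norm (?q h - partial i f x)) \<longlongrightarrow> 0) (at 0)"
      proof (rule Lim_transform_eventually)
        have "norm (f (x + h *\<^sub>R ?e) - f x - h *\<^sub>R partial i f x) / norm h = norm (?q h - partial i f x)"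
          if "h \<noteq> 0" for h
        proof -
          have "?q h - partial i f x = (f (x + h *\<^sub>R ?e) - f x - h *\<^sub>R partial i f x) /\<^sub>R h"
            using that by (simp add: scaleR_diff_right)
          then show ?thesis by (simp only: norm_scaleR) (simp add: divide_inverse_commute)
        qed
        then show "\<forall>\<^sub>F h in at 0. norm (f (x + h *\<^sub>R ?e) - f x - h *\<^sub>R partial i f x) / norm h = norm (?q h - partial i f x)"
          by (simp add: eventually_at_filter)
      qed
      then have lim: "(?q \<longlongrightarrow> partial i f x) (at 0)"
        by (rule LIM_zero_cancel[OF tendsto_norm_zero_cancel])
      have "filterlim (\<lambda>n. inverse (real (Suc n))) (at 0) sequentially"
        using LIMSEQ_inverse_real_of_nat by (simp add: filterlim_at)
      from filterlim_compose[OF lim this]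
      have "(\<lambda>n. ?q (inverse (real (Suc n)))) \<longlonglongrightarrow> partial i f x" .
      then show "(\<lambda>n. D n x) \<longlonglongrightarrow> partial i f x" by (simp add: D_def)
    qed
    show "AE x in lborel. norm (D n x) \<le> B * indicator (cball 0 (R + 1)) x" for n
    proof (rule AE_I2)
      fix x :: "real^3"
      have "norm (D n x) \<le> real (Suc n) * (B * \<bar>inverse (real (Suc n))\<bar>)"
        unfolding D_def norm_scaleR using lip[of x "inverse (real (Suc n))"] by (intro mult_mono) auto
      also have "\<dots> = B" by (simp add: field_simps)
      finally have 1: "norm (D n x) \<le> B" .
      have "D n x = 0" if "norm x > R + 1"
      proof -
        have "norm (inverse (real (Suc n)) *\<^sub>R ?e) \<le> 1" by (simp add: norm_axis_1 field_simps)
        then have "norm (x + inverse (real (Suc n)) *\<^sub>R ?e) > R"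
          using that norm_diff_ineq[of x "inverse (real (Suc n)) *\<^sub>R ?e"] by linarith
        then show ?thesis using that fz by (simp add: D_def)
      qed
      with 1 show "norm (D n x) \<le> B * indicator (cball 0 (R + 1)) x"
        by (auto simp: indicator_def not_le)
    qed
  qed
  moreover have "(LINT x|lborel. D n x) = 0" for n
    unfolding D_def using int intt lborel_integral_translation[OF meas]
    by (simp add: Bochner_Integration.integral_diff)
  ultimately show ?thesis by (simp add: LIMSEQ_const_iff)
qed

abbreviation leb :: "(real^3) measure" where
  "leb \<equiv> lebesgue_on B1"

lemma finite_measure_B1: "finite_measure (leb)"
  by (rule finite_measure_lebesgue_on) simp

lemma bounded_imp_integrable_B1:
  fixes f :: "real^3 \<Rightarrow> 'b::euclidean_space"
  assumes "f \<in> borel_measurable (leb)" "AE x in leb. norm (f x) \<le> B"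
  shows "integrable (leb) f"
  using finite_measure.integrable_const_bound[OF finite_measure_B1 assms(2,1)] .

lemma integral_B1_Cc:
  fixes f :: "real^3 \<Rightarrow> 'b::euclidean_space"
  assumes f: "f \<in> Cc_infty B1 V"
  shows "integrable (leb) f" "(LINT x|leb. f x) = (LINT x|lborel. f x)"
proof -
  have [simp]: "(\<lambda>x. indicator B1 x *\<^sub>R f x) = f"
    using Cc_inftyD(3)[OF f] by (auto simp: indicator_def)
  have i: "integrable lborel f" by (rule Cc_infty_integrable_lborel[OF f])
  then have "integrable lebesgue f" by (simp add: integrable_completion)
  then show "integrable (leb) f" by (simp add: integrable_restrict_space)
  show "(LINT x|leb. f x) = (LINT x|lborel. f x)"
    using i by (simp add: integral_restrict_space integral_completion)
qed

lemma Cc_infty_measurable: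
  fixes f :: "real^3 \<Rightarrow> 'b::euclidean_space"
  shows "f \<in> Cc_infty B1 V \<Longrightarrow> f \<in> borel_measurable (leb)"
  by (rule borel_measurable_integrable[OF integral_B1_Cc(1)])

lemma integral_partial_eq_0:
  fixes f :: "real^3 \<Rightarrow> 'b::euclidean_space"
  assumes f: "f \<in> Cc_infty B1 V"
  shows "(LINT x|leb. partial i f x) = 0"
  using integral_B1_Cc(2)[OF partial_Cc_infty[OF f]] integral_partial_lborel[OF f] by simp

section \<open>Weak derivatives are unique\<close>

text \<open>A product of one-dimensional bumps. Because \<open>exp (- 1 / (n y))\<close> tends to 1 for \<open>y > 0\<close>, these test
  functions increase to the indicator of an open box.\<close>

definition box_bump :: "real^3 \<Rightarrow> real^3 \<Rightarrow> nat \<Rightarrow> real^3 \<Rightarrow> real" where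
  "box_bump a b n x = (\<Prod>i\<in>UNIV. flat_exp 0 (real (Suc n) * (x $ i - a $ i)) *
     flat_exp 0 (real (Suc n) * (b $ i - x $ i)))"

lemma box_bump_bounds: "0 \<le> box_bump a b n x" "box_bump a b n x \<le> 1"
  unfolding box_bump_def by (auto intro!: prod_nonneg prod_le_1 mult_le_one simp: flat_exp_0_bounds)

lemma box_bump_outside: "x \<notin> box a b \<Longrightarrow> box_bump a b n x = 0"
proof -
  assume "x \<notin> box a b"
  then obtain i where "x $ i - a $ i \<le> 0 \<or> b $ i - x $ i \<le> 0"
    by (force simp: mem_box_cart not_less)
  then have "flat_exp 0 (real (Suc n) * (x $ i - a $ i)) * flat_exp 0 (real (Suc n) * (b $ i - x $ i)) = 0"
    by (auto simp: flat_exp_def mult_le_0_iff)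
  then show ?thesis unfolding box_bump_def by (intro prod_zero) auto
qed

lemma box_bump_Cc:
  assumes "cbox a b \<subseteq> B1"
  shows "box_bump a b n \<in> Cc_infty B1 UNIV"
proof (rule Cc_inftyI[of UNIV "cbox a b"])
  show "smooth_on UNIV (box_bump a b n)"
    unfolding box_bump_def[abs_def] by (intro smooth_intros) auto
qed (use assms box_subset_cbox[of a b] in \<open>auto intro!: box_bump_outside\<close>)

lemma flat_exp_0_scaled_tendsto: "(\<lambda>n. flat_exp 0 (real (Suc n) * y)) \<longlonglongrightarrow> (if y > 0 then 1 else 0)"
proof (cases "y > 0")
  case True
  have "(\<lambda>n. inverse y * inverse (real (Suc n))) \<longlonglongrightarrow> inverse y * 0"
    by (intro tendsto_mult tendsto_const LIMSEQ_inverse_real_of_nat)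
  then have "(\<lambda>n. exp (- (inverse y * inverse (real (Suc n))))) \<longlonglongrightarrow> exp (- (inverse y * 0))"
    by (rule tendsto_exp[OF tendsto_minus])
  moreover have "flat_exp 0 (real (Suc n) * y) = exp (- (inverse y * inverse (real (Suc n))))" for n
    using True by (simp add: flat_exp_def mult_le_0_iff)
  ultimately show ?thesis using True by simp
next
  case False
  then have "flat_exp 0 (real (Suc n) * y) = 0" for n by (simp add: flat_exp_def mult_le_0_iff)
  with False show ?thesis by simp
qed

lemma box_bump_tendsto: "(\<lambda>n. box_bump a b n x) \<longlonglongrightarrow> indicator (box a b) x"
proof -
  have "(\<lambda>n. box_bump a b n x) \<longlonglongrightarrow> (\<Prod>i\<in>UNIV. (if x $ i - a $ i > 0 then 1 else 0) * (if b $ i - x $ i > 0 then 1 else 0))"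
    unfolding box_bump_def by (intro tendsto_prod tendsto_mult flat_exp_0_scaled_tendsto)
  moreover have "(\<Prod>i\<in>UNIV. (if x $ i - a $ i > 0 then 1 else 0) * (if b $ i - x $ i > 0 then 1 else 0)) = (indicator (box a b) x :: real)"
  proof (cases "x \<in> box a b")
    case True
    then show ?thesis by (auto simp: mem_box_cart)
  next
    case False
    then obtain i where "\<not> (a $ i < x $ i \<and> x $ i < b $ i)" by (auto simp: mem_box_cart)
    then have "(\<Prod>i\<in>UNIV. (if x $ i - a $ i > 0 then 1 else 0) * (if b $ i - x $ i > 0 then 1 else 0)) = (0::real)"
      by (intro prod_zero) auto
    with False show ?thesis by simp
  qed
  ultimately show ?thesis by simp
qed

text \<open>The bumps of the box are admissible test functions that are bounded by 1 and converge to its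
  indicator, so dominated convergence applies.\<close>

lemma integral_box_eq_0:
  assumes w: "locally_integrable w"
    and z: "\<And>\<phi>. \<phi> \<in> Cc_infty B1 (UNIV :: real set) \<Longrightarrow> (LINT x|leb. \<phi> x *\<^sub>R w x) = 0"
    and sub: "cbox a b \<subseteq> B1"
  shows "integral (cbox a b) w = 0"
proof -
  have int: "set_integrable lebesgue (cbox a b) w"
    using w sub unfolding locally_integrable_def by (meson compact_cbox)
  have intb: "set_integrable lebesgue (box a b) w"
    by (rule set_integrable_subset[OF int]) (auto simp: box_subset_cbox)
  have eq: "indicator B1 x *\<^sub>R (box_bump a b n x *\<^sub>R w x) = box_bump a b n x *\<^sub>R (indicator (cbox a b) x *\<^sub>R w x)" for n x
    using sub box_subset_cbox[of a b] box_bump_outside[of x a b n] by (auto simp: indicator_def)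
  have "(\<lambda>n. LINT x|lebesgue. box_bump a b n x *\<^sub>R (indicator (cbox a b) x *\<^sub>R w x))
      \<longlonglongrightarrow> (LINT x|lebesgue. indicator (box a b) x *\<^sub>R w x)"
  proof (rule integral_dominated_convergence[where w="\<lambda>x. norm (indicator (cbox a b) x *\<^sub>R w x)"])
    show "(\<lambda>x. indicator (box a b) x *\<^sub>R w x) \<in> borel_measurable lebesgue"
      using intb unfolding set_integrable_def by (rule borel_measurable_integrable)
    have "box_bump a b n \<in> borel_measurable lebesgue" for n
      using Cc_infty_integrable_lborel[OF box_bump_Cc[OF sub]] borel_measurable_integrable measurable_completion by blast
    from borel_measurable_scaleR[OF this borel_measurable_integrable[OF int[unfolded set_integrable_def]]]
    show "(\<lambda>x. box_bump a b n x *\<^sub>R (indicator (cbox a b) x *\<^sub>R w x)) \<in> borel_measurable lebesgue" for n .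
    show "integrable lebesgue (\<lambda>x. norm (indicator (cbox a b) x *\<^sub>R w x))"
      using int unfolding set_integrable_def by (rule integrable_norm)
    show "AE x in lebesgue. (\<lambda>n. box_bump a b n x *\<^sub>R (indicator (cbox a b) x *\<^sub>R w x)) \<longlonglongrightarrow> indicator (box a b) x *\<^sub>R w x"
    proof (rule AE_I2)
      fix x
      have "(\<lambda>n. box_bump a b n x *\<^sub>R (indicator (cbox a b) x *\<^sub>R w x)) \<longlonglongrightarrow> indicator (box a b) x *\<^sub>R (indicator (cbox a b) x *\<^sub>R w x)"
        by (intro tendsto_scaleR tendsto_const box_bump_tendsto)
      moreover have "indicator (box a b) x *\<^sub>R (indicator (cbox a b) x *\<^sub>R w x) = indicator (box a b) x *\<^sub>R w x"
        using box_subset_cbox[of a b] by (auto simp: indicator_def)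
      ultimately show "(\<lambda>n. box_bump a b n x *\<^sub>R (indicator (cbox a b) x *\<^sub>R w x)) \<longlonglongrightarrow> indicator (box a b) x *\<^sub>R w x"
        by (simp only:)
    qed
    show "AE x in lebesgue. norm (box_bump a b n x *\<^sub>R (indicator (cbox a b) x *\<^sub>R w x)) \<le> norm (indicator (cbox a b) x *\<^sub>R w x)" for n
          proof (rule AE_I2)
      fix x
      have "norm (box_bump a b n x *\<^sub>R (indicator (cbox a b) x *\<^sub>R w x)) = box_bump a b n x * norm (indicator (cbox a b) x *\<^sub>R w x)"
        by (simp only: norm_scaleR abs_of_nonneg[OF box_bump_bounds(1)])
      also have "\<dots> \<le> norm (indicator (cbox a b) x *\<^sub>R w x)"
        by (intro mult_left_le_one_le box_bump_bounds) simp
      finally show "norm (box_bump a b n x *\<^sub>R (indicator (cbox a b) x *\<^sub>R w x)) \<le> norm (indicator (cbox a b) x *\<^sub>R w x)" .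
    qed
  qed
  moreover have "(LINT x|lebesgue. box_bump a b n x *\<^sub>R (indicator (cbox a b) x *\<^sub>R w x)) = 0" for n
    using z[OF box_bump_Cc[OF sub]] by (simp add: integral_restrict_space eq del: scaleR_scaleR)
  ultimately have "(LINT x:box a b|lebesgue. w x) = 0"
    unfolding set_lebesgue_integral_def by (simp add: LIMSEQ_const_iff)
  then show ?thesis
    using set_lebesgue_integral_eq_integral(2)[OF intb] integral_open_interval[of a b w] by simp
qed

text \<open>All integrals over boxes inside the ball vanish. By Lebesgue's differentiation theorem almost every
  value of \<open>w\<close> is a limit of averages over shrinking boxes, hence zero. That theorem is applied to
  the restriction of \<open>w\<close> to a smaller closed ball, where \<open>w\<close> is integrable.\<close>

lemma fundamental_lemma_calculus_of_variations:
  assumes w: "locally_integrable w"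
    and z: "\<And>\<phi>. \<phi> \<in> Cc_infty B1 (UNIV :: real set) \<Longrightarrow> (LINT x|leb. \<phi> x *\<^sub>R w x) = 0"
  shows "AE x in leb. w x = 0"
proof -
  have "\<exists>N. negligible N \<and> (\<forall>x. norm x < r \<longrightarrow> x \<notin> N \<longrightarrow> w x = 0)" if r: "r < 1" for r
  proof -
    define f where "f x = (if x \<in> cball 0 r then w x else 0)" for x
    have "set_integrable lebesgue (cball 0 r) w"
      using w r unfolding locally_integrable_def by (auto dest!: spec[of _ "cball 0 r"])
    then have "w integrable_on cball 0 r" by (rule set_lebesgue_integral_eq_integral(1))
    then have "f integrable_on UNIV"
      unfolding f_def by (simp only: integrable_restrict_UNIV)
    then have "f integrable_on cbox a b" for a b
      using integrable_on_subcbox by blast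
    from integrable_ccontinuous_explicit[OF this] obtain N where N: "negligible N"
      "\<And>x e. \<lbrakk>x \<notin> N; 0 < e\<rbrakk> \<Longrightarrow> \<exists>d>0. \<forall>h. 0 < h \<and> h < d \<longrightarrow>
         norm (integral (cbox x (x + h *\<^sub>R One)) f /\<^sub>R h ^ DIM(real^3) - f x) < e"
      by blast
    have "w x = 0" if x: "norm x < r" "x \<notin> N" for x
    proof (rule ccontr)
      assume "w x \<noteq> 0"
      then obtain d where d: "d > 0" "\<And>h. 0 < h \<Longrightarrow> h < d \<Longrightarrow>
         norm (integral (cbox x (x + h *\<^sub>R One)) f /\<^sub>R h ^ DIM(real^3) - f x) < norm (w x)"
        using N(2)[OF x(2), of "norm (w x)"] by auto
      define h where "h = min (d / 2) ((r - norm x) / 3)"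
      have h: "0 < h" "h < d" "3 * h \<le> r - norm x" using d x min.cobounded2[of "d / 2" "(r - norm x) / 3"] by (auto simp: h_def)
      have sub: "cbox x (x + h *\<^sub>R One) \<subseteq> cball 0 r"
      proof
        fix y assume y: "y \<in> cbox x (x + h *\<^sub>R One)"
        have "\<bar>(y - x) $ i\<bar> \<le> h" for i
        proof -
          have "(One :: real^3) $ i = 1"
            using inner_sum_left_Basis[of "axis i 1 :: real^3" "\<lambda>_. 1"] by (simp add: inner_axis axis_in_Basis_iff)
          then have "(x + h *\<^sub>R One) $ i = x $ i + h" by (simp only: vector_add_component vector_scaleR_component) simp
          moreover have "x $ i \<le> y $ i" "y $ i \<le> (x + h *\<^sub>R One) $ i" using y by (simp_all only: mem_box_cart)
          ultimately show ?thesis by (simp only: vector_minus_component)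
        qed
        then have "norm (y - x) \<le> (\<Sum>i\<in>(UNIV::3 set). h)"
          by (intro order_trans[OF norm_le_l1_cart] sum_mono) auto
        then have "norm (y - x) \<le> 3 * h" by simp
        then show "y \<in> cball 0 r" using h norm_triangle_sub[of y x] by (simp add: dist_norm)
      qed
      have "integral (cbox x (x + h *\<^sub>R One)) f = integral (cbox x (x + h *\<^sub>R One)) w"
        using sub by (intro integral_cong) (auto simp: f_def)
      also have "\<dots> = 0" using sub r by (intro integral_box_eq_0 w z) (auto simp: subset_iff)
      finally show False using d(2)[OF h(1,2)] x by (simp add: f_def)
    qed
    with N(1) show ?thesis by blast
  qed
  then have "\<forall>r\<in>{..<1}. \<exists>N. negligible N \<and> (\<forall>x. norm x < r \<longrightarrow> x \<notin> N \<longrightarrow> w x = 0)" by simp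
  then obtain N where "\<forall>r\<in>{..<1}. negligible (N r) \<and> (\<forall>x. norm x < r \<longrightarrow> x \<notin> N r \<longrightarrow> w x = 0)"
    by (rule bchoice[THEN exE])
  then have N: "\<And>r. r < 1 \<Longrightarrow> negligible (N r)"
     "\<And>r x. r < 1 \<Longrightarrow> norm x < r \<Longrightarrow> x \<notin> N r \<Longrightarrow> w x = 0" by simp_all
  define r where "r n = 1 - inverse (real (Suc n))" for n
  have "negligible (\<Union>n. N (r n))" using N(1) by (intro negligible_Union_nat) (auto simp: r_def)
  then have "AE x in lebesgue. x \<notin> (\<Union>n. N (r n))"
    unfolding negligible_iff_null_sets by (rule AE_not_in)
  then have "AE x in lebesgue. x \<in> B1 \<longrightarrow> w x = 0"
  proof eventually_elim
    case (elim x)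
    show ?case
    proof
      assume "x \<in> B1"
      then obtain n where "inverse (real (Suc n)) < 1 - norm x" using reals_Archimedean[of "1 - norm x"] by auto
      then have "norm x < r n" by (simp add: r_def)
      then show "w x = 0" using elim N(2)[of "r n" x] by (auto simp: r_def)
    qed
  qed
  then show ?thesis by (simp add: AE_restrict_space_iff)
qed

lemma locally_integrable_diff:
  "locally_integrable f \<Longrightarrow> locally_integrable g \<Longrightarrow> locally_integrable (\<lambda>x. f x - g x)"
  unfolding locally_integrable_def by (auto intro: set_integral_diff(1))

lemma locally_integrable_add:
  "locally_integrable f \<Longrightarrow> locally_integrable g \<Longrightarrow> locally_integrable (\<lambda>x. f x + g x)"
  unfolding locally_integrable_def by (auto intro: set_integral_add(1))

lemma locally_integrable_scaleR:
  "locally_integrable f \<Longrightarrow> locally_integrable (\<lambda>x. c *\<^sub>R f x)"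
  unfolding locally_integrable_def by (auto intro: set_integrable_scaleR_right)

lemma Cc_scaleR_locally_integrable:
  assumes "\<phi> \<in> Cc_infty B1 (UNIV :: real set)" "locally_integrable Q"
  shows "integrable (leb) (\<lambda>x. \<phi> x *\<^sub>R Q x)"
proof -
  let ?K = "closure {x. \<phi> x \<noteq> 0}"
  obtain B where B: "\<And>x. norm (\<phi> x) \<le> B" using Cc_infty_bounded[OF assms(1)] by metis
  have i: "integrable lebesgue (\<lambda>x. indicator ?K x *\<^sub>R Q x)"
    using assms(2) Cc_inftyD(4,5)[OF assms(1)] unfolding locally_integrable_def set_integrable_def by blast
  have eq: "indicator B1 x *\<^sub>R (\<phi> x *\<^sub>R Q x) = \<phi> x *\<^sub>R (indicator ?K x *\<^sub>R Q x)" for x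
    using Cc_inftyD(3)[OF assms(1), of x] closure_subset[of "{x. \<phi> x \<noteq> 0}"] by (auto simp: indicator_def)
  have m: "\<phi> \<in> borel_measurable lebesgue"
    using Cc_infty_integrable_lborel[OF assms(1)] borel_measurable_integrable measurable_completion by blast
  have "integrable lebesgue (\<lambda>x. \<phi> x *\<^sub>R (indicator ?K x *\<^sub>R Q x))"
  proof (rule Bochner_Integration.integrable_bound[OF integrable_scaleR_right[OF i, of B]])
    show "(\<lambda>x. \<phi> x *\<^sub>R (indicator ?K x *\<^sub>R Q x)) \<in> borel_measurable lebesgue"
      by (rule borel_measurable_scaleR[OF m borel_measurable_integrable[OF i]])
    show "AE x in lebesgue. norm (\<phi> x *\<^sub>R (indicator ?K x *\<^sub>R Q x)) \<le> norm (B *\<^sub>R (indicator ?K x *\<^sub>R Q x))"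
      using B by (intro AE_I2) (auto simp: indicator_def intro!: mult_right_mono order_trans[OF _ abs_ge_self])
  qed
  moreover have "B1 \<inter> space lebesgue \<in> sets lebesgue" by simp
  ultimately show ?thesis by (simp only: integrable_restrict_space eq)
qed

lemma has_weak_partial_unique:
  assumes "has_weak_partial i Q g" "has_weak_partial i Q g'"
  shows "AE x in leb. g x = g' x"
proof -
  have "AE x in leb. g x - g' x = 0"
  proof (rule fundamental_lemma_calculus_of_variations)
    show "locally_integrable (\<lambda>x. g x - g' x)"
      using assms by (auto simp: has_weak_partial_def intro: locally_integrable_diff)
    fix \<phi> :: "real^3 \<Rightarrow> real" assume p: "\<phi> \<in> Cc_infty B1 UNIV"
    have "(LINT x|leb. partial i \<phi> x *\<^sub>R Q x) = - (LINT x|leb. \<phi> x *\<^sub>R g x)"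
      "(LINT x|leb. partial i \<phi> x *\<^sub>R Q x) = - (LINT x|leb. \<phi> x *\<^sub>R g' x)"
      using assms p unfolding has_weak_partial_def by blast+
    then have "(LINT x|leb. \<phi> x *\<^sub>R g x) = (LINT x|leb. \<phi> x *\<^sub>R g' x)" by simp
    moreover have "integrable (leb) (\<lambda>x. \<phi> x *\<^sub>R g x)" "integrable (leb) (\<lambda>x. \<phi> x *\<^sub>R g' x)"
      using assms p by (auto simp: has_weak_partial_def intro: Cc_scaleR_locally_integrable)
    ultimately show "(LINT x|leb. \<phi> x *\<^sub>R (g x - g' x)) = 0"
      by (simp add: scaleR_diff_right Bochner_Integration.integral_diff)
  qed
  then show ?thesis by simp
qed

lemma has_weak_partial_weak_partial: "has_weak_partial i Q g \<Longrightarrow> has_weak_partial i Q (weak_partial i Q)"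
  unfolding weak_partial_def by (rule someI[of "has_weak_partial i Q"])

text \<open>The choice made in the definition of \<open>weak_partial\<close> is harmless: up to a null set any weak
  derivative found by other means may take its place. This is what makes the energy computable.\<close>

lemma weak_partial_AE_eq: "has_weak_partial i Q g \<Longrightarrow> AE x in leb. weak_partial i Q x = g x"
  using has_weak_partial_unique has_weak_partial_weak_partial by blast

lemma has_weak_partial_add_scaleR:
  assumes "has_weak_partial i P f" "has_weak_partial i Q g"
  shows "has_weak_partial i (\<lambda>x. P x + c *\<^sub>R Q x) (\<lambda>x. f x + c *\<^sub>R g x)"
  unfolding has_weak_partial_def
proof (intro conjI ballI)
  have li: "locally_integrable P" "locally_integrable Q" "locally_integrable f" "locally_integrable g"
    using assms by (auto simp: has_weak_partial_def)
  then show "locally_integrable (\<lambda>x. P x + c *\<^sub>R Q x)" "locally_integrable (\<lambda>x. f x + c *\<^sub>R g x)"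
    by (auto intro: locally_integrable_add locally_integrable_scaleR)
  fix \<phi> :: "real^3 \<Rightarrow> real" assume p: "\<phi> \<in> Cc_infty B1 UNIV"
  have lin: "(LINT x|leb. \<psi> x *\<^sub>R (P' x + c *\<^sub>R Q' x))
      = (LINT x|leb. \<psi> x *\<^sub>R P' x) + c *\<^sub>R (LINT x|leb. \<psi> x *\<^sub>R Q' x)"
    if "\<psi> \<in> Cc_infty B1 (UNIV :: real set)" "locally_integrable P'" "locally_integrable Q'" for \<psi> P' Q'
  proof -
    note I = Cc_scaleR_locally_integrable[OF that(1,2)] Cc_scaleR_locally_integrable[OF that(1,3)]
    have "\<psi> x *\<^sub>R (P' x + c *\<^sub>R Q' x) = \<psi> x *\<^sub>R P' x + c *\<^sub>R (\<psi> x *\<^sub>R Q' x)" for x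
      by (simp add: scaleR_add_right mult.commute)
    then show ?thesis
      by (simp only: Bochner_Integration.integral_add[OF I(1) integrable_scaleR_right[OF I(2)]] integral_scaleR_right)
  qed
  have "(LINT x|leb. partial i \<phi> x *\<^sub>R (P x + c *\<^sub>R Q x))
     = (LINT x|leb. partial i \<phi> x *\<^sub>R P x) + c *\<^sub>R (LINT x|leb. partial i \<phi> x *\<^sub>R Q x)"
    by (rule lin[OF partial_Cc_infty[OF p] li(1,2)])
  also have "\<dots> = - ((LINT x|leb. \<phi> x *\<^sub>R f x) + c *\<^sub>R (LINT x|leb. \<phi> x *\<^sub>R g x))"
    using assms p by (simp add: has_weak_partial_def)
  also have "\<dots> = - (LINT x|leb. \<phi> x *\<^sub>R (f x + c *\<^sub>R g x))"
    by (simp only: lin[OF p li(3,4)])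
  finally show "(LINT x|leb. partial i \<phi> x *\<^sub>R (P x + c *\<^sub>R Q x)) = - (LINT x|leb. \<phi> x *\<^sub>R (f x + c *\<^sub>R g x))" .
qed

lemma Cc_locally_integrable:
  assumes "f \<in> Cc_infty B1 V"
  shows "locally_integrable f"
  unfolding locally_integrable_def set_integrable_def
proof (intro allI impI, elim conjE)
  fix K :: "(real^3) set" assume "compact K"
  then have "integrable lborel (\<lambda>x. indicator K x *\<^sub>R f x)"
    by (rule borel_integrable_compact[OF _ smooth_on_continuous[OF Cc_infty_smooth_on[OF assms]]])
  then show "integrable lebesgue (\<lambda>x. indicator K x *\<^sub>R f x)" by (simp add: integrable_completion)
qed

text \<open>Integrate Leibniz' rule for \<open>\<phi> f\<close>.\<close>

lemma Cc_has_weak_partial: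
  assumes f: "f \<in> Cc_infty B1 V"
  shows "has_weak_partial i f (partial i f)"
  unfolding has_weak_partial_def
proof (intro conjI ballI)
  show li: "locally_integrable f" "locally_integrable (partial i f)"
    using Cc_locally_integrable f partial_Cc_infty[OF f] by blast+
  fix \<phi> :: "real^3 \<Rightarrow> real" assume p: "\<phi> \<in> Cc_infty B1 UNIV"
  note I = Cc_scaleR_locally_integrable[OF p li(2)] Cc_scaleR_locally_integrable[OF partial_Cc_infty[OF p] li(1)]
  have "(LINT x|leb. partial i (\<lambda>x. \<phi> x *\<^sub>R f x) x) = 0"
    by (rule integral_partial_eq_0[OF Cc_infty_bilinear[OF p _ _ Cc_infty_smooth_on[OF f] bounded_bilinear_scaleR, of UNIV]]) auto
  also have "(LINT x|leb. partial i (\<lambda>x. \<phi> x *\<^sub>R f x) x) =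
    (LINT x|leb. \<phi> x *\<^sub>R partial i f x + partial i \<phi> x *\<^sub>R f x)"
    using smooth_on_differentiable[OF Cc_infty_smooth_on[OF p], of _ UNIV] smooth_on_differentiable[OF Cc_infty_smooth_on[OF f], of _ UNIV]
    by (simp add: partial_scaleR)
  finally have "(LINT x|leb. \<phi> x *\<^sub>R partial i f x) + (LINT x|leb. partial i \<phi> x *\<^sub>R f x) = 0"
    by (simp only: Bochner_Integration.integral_add[OF I])
  then show "(LINT x|leb. partial i \<phi> x *\<^sub>R f x) = - (LINT x|leb. \<phi> x *\<^sub>R partial i f x)"
    by (rule minus_unique[symmetric])
qed

section \<open>Matrix estimates\<close>

lemma norm_matrix_sq: "(norm (M :: real^3^3))\<^sup>2 = (\<Sum>i\<in>UNIV. \<Sum>j\<in>UNIV. (M $ i $ j)\<^sup>2)"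
  unfolding power2_norm_eq_inner by (simp add: inner_vec_def power2_eq_square)

text \<open>Every entry of the product is the inner product of a row and a column, so this is the
  Cauchy-Schwarz inequality summed over all entries.\<close>

lemma norm_matrix_mult_le:
  fixes A B :: "real^3^3"
  shows "norm (A ** B) \<le> norm A * norm B"
proof -
  have "(norm (A ** B))\<^sup>2 = (\<Sum>i\<in>UNIV. \<Sum>j\<in>UNIV. (row i A \<bullet> column j B)\<^sup>2)"
    unfolding norm_matrix_sq by (simp add: matrix_matrix_mult_def row_def column_def inner_vec_def)
  also have "\<dots> \<le> (\<Sum>i\<in>UNIV. \<Sum>j\<in>UNIV. (row i A \<bullet> row i A) * (column j B \<bullet> column j B))"
    by (intro sum_mono Cauchy_Schwarz_ineq)
  also have "\<dots> = (\<Sum>i\<in>UNIV. row i A \<bullet> row i A) * (\<Sum>j\<in>UNIV. column j B \<bullet> column j B)"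
    by (simp add: sum_product)
  also have "(\<Sum>i\<in>UNIV. row i A \<bullet> row i A) = (norm A)\<^sup>2"
    unfolding norm_matrix_sq by (simp add: row_def inner_vec_def power2_eq_square)
  also have "(\<Sum>j\<in>UNIV. column j B \<bullet> column j B) = (norm B)\<^sup>2"
    unfolding norm_matrix_sq by (subst sum.swap) (simp add: column_def inner_vec_def power2_eq_square)
  finally have "(norm (A ** B))\<^sup>2 \<le> (norm A * norm B)\<^sup>2" by (simp add: power_mult_distrib)
  then show ?thesis by (rule power2_le_imp_le) simp
qed

lemma bounded_bilinear_matrix_mult: "bounded_bilinear (\<lambda>(A :: real^3^3) (B :: real^3^3). A ** B)"
proof (rule bounded_bilinear.intro)
  show "\<exists>K. \<forall>(a :: real^3^3) (b :: real^3^3). norm (a ** b) \<le> norm a * norm b * K"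
    using norm_matrix_mult_le by (intro exI[of _ 1]) auto
qed (simp_all add: matrix_matrix_mult_def vec_eq_iff distrib_left distrib_right sum.distrib sum_distrib_left mult.assoc mult.left_commute)

lemmas matrix_mult_expand =
  bounded_bilinear.add_left[OF bounded_bilinear_matrix_mult] bounded_bilinear.add_right[OF bounded_bilinear_matrix_mult]
  bounded_bilinear.scaleR_left[OF bounded_bilinear_matrix_mult] bounded_bilinear.scaleR_right[OF bounded_bilinear_matrix_mult]

lemma bounded_linear_trace: "bounded_linear (trace :: real^3^3 \<Rightarrow> real)"
  unfolding linear_conv_bounded_linear[symmetric]
  by (auto simp: linear_iff trace_def sum_distrib_left sum.distrib)

lemma trace_mult_le:
  fixes A B :: "real^3^3"
  shows "\<bar>trace (A ** B)\<bar> \<le> norm A * norm B"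
proof -
  have "trace (A ** B) = A \<bullet> transpose B"
    by (simp add: trace_def matrix_matrix_mult_def inner_vec_def transpose_def)
  moreover have "(norm (transpose B))\<^sup>2 = (norm B)\<^sup>2"
    unfolding norm_matrix_sq by (subst sum.swap) (simp add: transpose_def)
  then have "norm (transpose B) = norm B" by simp
  ultimately show ?thesis using Cauchy_Schwarz_ineq2[of A "transpose B"] by simp
qed

lemma trace_mult3_le:
  fixes A B C :: "real^3^3"
  shows "\<bar>trace (A ** B ** C)\<bar> \<le> norm A * norm B * norm C"
  by (rule order_trans[OF trace_mult_le mult_right_mono[OF norm_matrix_mult_le norm_ge_zero]])

lemma measurable_trace_mult3:
  fixes f g h :: "'a \<Rightarrow> real^3^3"
  assumes "f \<in> borel_measurable M" "g \<in> borel_measurable M" "h \<in> borel_measurable M"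
  shows "(\<lambda>x. trace (f x ** g x ** h x :: real^3^3)) \<in> borel_measurable M"
proof -
  have c: "continuous_on UNIV (\<lambda>x :: (real^3^3) \<times> (real^3^3). fst x ** snd x)"
    by (intro bounded_bilinear.continuous_on[OF bounded_bilinear_matrix_mult] continuous_intros)
  have "(\<lambda>x. f x ** g x) \<in> borel_measurable M"
    by (rule borel_measurable_continuous_Pair[where H = "(**)", OF assms(1,2) c])
  then have "(\<lambda>x. f x ** g x ** h x) \<in> borel_measurable M"
    by (rule borel_measurable_continuous_Pair[where H = "(**)", OF _ assms(3) c])
  moreover have "(trace :: real^3^3 \<Rightarrow> real) \<in> borel_measurable borel"
    by (intro borel_measurable_continuous_onI linear_continuous_on bounded_linear_trace)
  ultimately show ?thesis by (rule measurable_compose)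
qed

section \<open>The energy along a line\<close>

text \<open>The energy density at \<open>Q + t \<Psi>\<close> is a polynomial of degree four in \<open>t\<close>; this and the next three
  functions are its coefficients of \<open>t\<close>, \<open>t\<^sup>2\<close>, \<open>t\<^sup>3\<close> and \<open>t\<^sup>4\<close>.\<close>

definition first_density :: "real \<Rightarrow> real \<Rightarrow> (real^3 \<Rightarrow> real^3^3) \<Rightarrow> (real^3 \<Rightarrow> real^3^3) \<Rightarrow> real^3 \<Rightarrow> real" where
  "first_density lam \<mu> Q \<Psi> x = (\<Sum>i\<in>UNIV. weak_partial i Q x \<bullet> partial i \<Psi> x)
     + lam * ((norm (Q x))\<^sup>2 * (Q x \<bullet> \<Psi> x) / sqrt 6 - trace (Q x ** Q x ** \<Psi> x))
     - \<mu> * ((1 - (norm (Q x))\<^sup>2) * (Q x \<bullet> \<Psi> x))"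

definition second_density :: "real \<Rightarrow> real \<Rightarrow> (real^3 \<Rightarrow> real^3^3) \<Rightarrow> (real^3 \<Rightarrow> real^3^3) \<Rightarrow> real^3 \<Rightarrow> real" where
  "second_density lam \<mu> Q \<Psi> x = (\<Sum>i\<in>UNIV. (norm (partial i \<Psi> x))\<^sup>2) / 2
     + lam * ((2 * (Q x \<bullet> \<Psi> x)\<^sup>2 + (norm (Q x))\<^sup>2 * (norm (\<Psi> x))\<^sup>2) / (2 * sqrt 6) - trace (Q x ** \<Psi> x ** \<Psi> x))
     + \<mu> * ((Q x \<bullet> \<Psi> x)\<^sup>2 - (1 - (norm (Q x))\<^sup>2) * (norm (\<Psi> x))\<^sup>2 / 2)"

definition third_density :: "real \<Rightarrow> real \<Rightarrow> (real^3 \<Rightarrow> real^3^3) \<Rightarrow> (real^3 \<Rightarrow> real^3^3) \<Rightarrow> real^3 \<Rightarrow> real" where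
  "third_density lam \<mu> Q \<Psi> x = lam * ((Q x \<bullet> \<Psi> x) * (norm (\<Psi> x))\<^sup>2 / sqrt 6 - trace (\<Psi> x ** \<Psi> x ** \<Psi> x) / 3)
     + \<mu> * ((Q x \<bullet> \<Psi> x) * (norm (\<Psi> x))\<^sup>2)"

definition fourth_density :: "real \<Rightarrow> real \<Rightarrow> (real^3 \<Rightarrow> real^3^3) \<Rightarrow> real^3 \<Rightarrow> real" where
  "fourth_density lam \<mu> \<Psi> x = (lam / (4 * sqrt 6) + \<mu> / 4) * ((norm (\<Psi> x))\<^sup>2)\<^sup>2"

definition energy_density :: "real \<Rightarrow> real \<Rightarrow> (real^3 \<Rightarrow> real^3^3) \<Rightarrow> real^3 \<Rightarrow> real" where
  "energy_density lam \<mu> Q x = 1 / 2 * (\<Sum>i\<in>UNIV. (norm (weak_partial i Q x))\<^sup>2) + lam * W (Q x)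
       + \<mu> / 4 * (1 - (norm (Q x))\<^sup>2)\<^sup>2"

lemma energy_eq: "energy lam \<mu> Q = (LINT x|leb. energy_density lam \<mu> Q x)"
  unfolding energy_def energy_density_def ..

lemma norm_add_scaleR_sq:
  fixes a b :: "'a::real_inner"
  shows "(norm (a + t *\<^sub>R b))\<^sup>2 = (norm a)\<^sup>2 + 2 * t * (a \<bullet> b) + t\<^sup>2 * (norm b)\<^sup>2"
  unfolding power2_norm_eq_inner by (simp add: inner_simps inner_commute power2_eq_square algebra_simps)

lemma trace_cube_add_scaleR:
  fixes Q P :: "real^3^3"
  shows "trace ((Q + t *\<^sub>R P) ** (Q + t *\<^sub>R P) ** (Q + t *\<^sub>R P)) =
    trace (Q ** Q ** Q) + 3 * t * trace (Q ** Q ** P) + 3 * t\<^sup>2 * trace (Q ** P ** P) + t ^ 3 * trace (P ** P ** P)"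
proof -
  have c: "trace (Q ** P ** Q) = trace (Q ** Q ** P)" "trace (P ** Q ** Q) = trace (Q ** Q ** P)"
    "trace (P ** Q ** P) = trace (Q ** P ** P)" "trace (P ** P ** Q) = trace (Q ** P ** P)"
    by (metis matrix_mul_assoc trace_mul_sym)+
  note l = bounded_linear.linear[OF bounded_linear_trace]
  show ?thesis
    by (simp add: matrix_mult_expand linear_add[OF l] linear_scale[OF l] c power2_eq_square power3_eq_cube algebra_simps)
qed

lemma W_add_scaleR:
  "W (Q + t *\<^sub>R P) = W Q + t * ((norm Q)\<^sup>2 * (Q \<bullet> P) / sqrt 6 - trace (Q ** Q ** P))
     + t\<^sup>2 * ((2 * (Q \<bullet> P)\<^sup>2 + (norm Q)\<^sup>2 * (norm P)\<^sup>2) / (2 * sqrt 6) - trace (Q ** P ** P))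
     + t ^ 3 * ((Q \<bullet> P) * (norm P)\<^sup>2 / sqrt 6 - trace (P ** P ** P) / 3)
     + t ^ 4 * ((norm P)\<^sup>2)\<^sup>2 / (4 * sqrt 6)"
proof -
  define r where "r = inverse (sqrt 6)"
  have r: "1 / (4 * sqrt 6) = r / 4" "y / sqrt 6 = y * r" "y / (2 * sqrt 6) = y * r / 2" "y / (4 * sqrt 6) = y * r / 4" for y
    unfolding r_def inverse_eq_divide by simp_all
  have p4: "norm z ^ 4 = ((norm z)\<^sup>2)\<^sup>2" for z :: "real^3^3" by simp
  have poly: "1 * r / 4 * (q + 2 * t * b + t\<^sup>2 * p)\<^sup>2 - 1 / 3 * (T0 + 3 * t * T1 + 3 * t\<^sup>2 * T2 + t ^ 3 * T3) + k
    = (1 * r / 4 * q\<^sup>2 - 1 / 3 * T0 + k) + t * (q * b * r - T1) + t\<^sup>2 * ((2 * b\<^sup>2 + q * p) * r / 2 - T2)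
      + t ^ 3 * (b * p * r - T3 / 3) + t ^ 4 * p\<^sup>2 * r / 4" for q b p T0 T1 T2 T3 k
  proof -
    have sq: "(q + 2 * t * b + t\<^sup>2 * p)\<^sup>2 = q\<^sup>2 + 4 * (t * (q * b)) + 4 * (t\<^sup>2 * b\<^sup>2)
        + 2 * (t\<^sup>2 * (q * p)) + 4 * (t ^ 3 * (b * p)) + t ^ 4 * p\<^sup>2"
      by (simp add: power2_eq_square power3_eq_cube power4_eq_xxxx algebra_simps)
    show ?thesis unfolding sq by (simp add: algebra_simps)
  qed
  show ?thesis
    unfolding W_def p4 norm_add_scaleR_sq trace_cube_add_scaleR r by (rule poly)
qed

lemma energy_density_add_scaleR:
  assumes "\<And>i. weak_partial i (\<lambda>x. Q x + t *\<^sub>R \<Psi> x) x = weak_partial i Q x + t *\<^sub>R partial i \<Psi> x"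
  shows "energy_density lam \<mu> (\<lambda>x. Q x + t *\<^sub>R \<Psi> x) x = energy_density lam \<mu> Q x + t * first_density lam \<mu> Q \<Psi> x
     + t\<^sup>2 * second_density lam \<mu> Q \<Psi> x + t ^ 3 * third_density lam \<mu> Q \<Psi> x + t ^ 4 * fourth_density lam \<mu> \<Psi> x"
proof -
  define q where "q = (norm (Q x))\<^sup>2"
  define p where "p = (norm (\<Psi> x))\<^sup>2"
  define b where "b = Q x \<bullet> \<Psi> x"
  have 1: "(\<Sum>i\<in>UNIV. (norm (weak_partial i Q x + t *\<^sub>R partial i \<Psi> x))\<^sup>2) = (\<Sum>i\<in>UNIV. (norm (weak_partial i Q x))\<^sup>2)
      + 2 * t * (\<Sum>i\<in>UNIV. weak_partial i Q x \<bullet> partial i \<Psi> x) + t\<^sup>2 * (\<Sum>i\<in>UNIV. (norm (partial i \<Psi> x))\<^sup>2)"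
    by (simp only: norm_add_scaleR_sq sum.distrib sum_distrib_left)
  have 2: "(1 - (q + 2 * t * b + t\<^sup>2 * p))\<^sup>2 = (1 - q)\<^sup>2 - 4 * t * ((1 - q) * b) + t\<^sup>2 * (4 * b\<^sup>2 - 2 * ((1 - q) * p))
     + 4 * t ^ 3 * (b * p) + t ^ 4 * p\<^sup>2"
    by (simp add: power2_eq_square power3_eq_cube power4_eq_xxxx algebra_simps)
  have poly: "1 / 2 * (S0 + 2 * t * S1 + t\<^sup>2 * S2)
      + lam * (w0 + t * w1 + t\<^sup>2 * w2 + t ^ 3 * w3 + t ^ 4 * p\<^sup>2 / c)
      + \<mu> / 4 * (d - 4 * t * f + t\<^sup>2 * (4 * b\<^sup>2 - 2 * g) + 4 * t ^ 3 * h + t ^ 4 * p\<^sup>2)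
    = 1 / 2 * S0 + lam * w0 + \<mu> / 4 * d + t * (S1 + lam * w1 - \<mu> * f)
      + t\<^sup>2 * (S2 / 2 + lam * w2 + \<mu> * (b\<^sup>2 - g / 2))
      + t ^ 3 * (lam * w3 + \<mu> * h) + t ^ 4 * ((lam / c + \<mu> / 4) * p\<^sup>2)" for S0 S1 S2 w0 w1 w2 w3 c d f g h b p
    by (simp add: algebra_simps)
  show ?thesis
    unfolding energy_density_def first_density_def second_density_def third_density_def fourth_density_def
      assms W_add_scaleR 1 norm_add_scaleR_sq[of "Q x" t "\<Psi> x"] q_def[symmetric] p_def[symmetric] b_def[symmetric] 2
    by (rule poly)
qed

text \<open>Lebesgue measure is complete, so a function that is only known through an almost everywhere
  identity, as the chosen weak derivative is, still is measurable.\<close>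

lemma AE_eq_measurable_B1:
  fixes f g :: "real^3 \<Rightarrow> 'b::euclidean_space"
  assumes "f \<in> borel_measurable (leb)" "AE x in leb. f x = g x"
  shows "g \<in> borel_measurable (leb)"
proof -
  let ?r = "\<lambda>f x. if x \<in> B1 then f x else (0 :: 'b)"
  have "?r f \<in> borel_measurable lebesgue"
    by (rule borel_measurable_if_I[OF assms(1)]) simp
  moreover have "AE x in lebesgue. ?r f x = ?r g x"
    using assms(2) by (auto simp: AE_restrict_space_iff elim: eventually_mono)
  ultimately have "?r g \<in> borel_measurable lebesgue"
    by (rule borel_measurable_AE)
  then show ?thesis
    by (rule borel_measurable_if_D)
qed

lemma W12_weak_partial:
  assumes "Q \<in> W12"
  shows "has_weak_partial i Q (weak_partial i Q)" "weak_partial i Q \<in> borel_measurable (leb)"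
    "integrable (leb) (\<lambda>x. (norm (weak_partial i Q x))\<^sup>2)"
    "integrable (leb) (weak_partial i Q)"
proof -
  obtain g where g: "g \<in> L2" "has_weak_partial i Q g" using assms by (auto simp: W12_def)
  then show w: "has_weak_partial i Q (weak_partial i Q)" by (intro has_weak_partial_weak_partial)
  have ae: "AE x in leb. g x = weak_partial i Q x"
    by (rule has_weak_partial_unique[OF g(2) w])
  have gm: "g \<in> borel_measurable (leb)" "integrable (leb) (\<lambda>x. (norm (g x))\<^sup>2)"
    using g by (auto simp: L2_def)
  show m: "weak_partial i Q \<in> borel_measurable (leb)"
    by (rule AE_eq_measurable_B1[OF gm(1) ae])
  show sq: "integrable (leb) (\<lambda>x. (norm (weak_partial i Q x))\<^sup>2)"
  proof (rule integrable_cong_AE_imp[OF gm(2)])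
    show "(\<lambda>x. (norm (weak_partial i Q x))\<^sup>2) \<in> borel_measurable (leb)" using m by measurable
    show "AE x in leb. (norm (g x))\<^sup>2 = (norm (weak_partial i Q x))\<^sup>2" using ae by eventually_elim simp
  qed
  have "integrable (leb) (\<lambda>x. norm (weak_partial i Q x))"
    proof (rule finite_measure.square_integrable_imp_integrable[OF finite_measure_B1])
    show "(\<lambda>x. norm (weak_partial i Q x)) \<in> borel_measurable (leb)" using m by measurable
  qed (rule sq)
  then show "integrable (leb) (weak_partial i Q)"
    by (simp only: integrable_norm_iff[OF m])
qed

lemma W12_measurable: "Q \<in> W12 \<Longrightarrow> Q \<in> borel_measurable (leb)"
  by (simp add: W12_def L2_def)

context
  fixes Q \<Psi> :: "real^3 \<Rightarrow> real^3^3" and V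
  assumes Q: "Q \<in> W12" and Q1: "AE x in leb. norm (Q x) \<le> 1" and \<Psi>: "\<Psi> \<in> Cc_infty B1 V"
begin

lemma bounded_Psi: obtains B where "B > 0" "\<And>x. norm (\<Psi> x) \<le> B" "\<And>i x. norm (partial i \<Psi> x) \<le> B"
proof -
  obtain B where B: "B > 0" "\<And>x. norm (\<Psi> x) \<le> B" using Cc_infty_bounded[OF \<Psi>] by blast
  have "\<exists>b. \<forall>x. norm (partial i \<Psi> x) \<le> b" for i
    by (rule Cc_infty_bounded[OF partial_Cc_infty[OF \<Psi>, of i]]) blast
  then have "\<forall>i. \<exists>b. \<forall>x. norm (partial i \<Psi> x) \<le> b" ..
  then obtain b where "\<forall>i x. norm (partial i \<Psi> x) \<le> b i" by (rule choice[THEN exE])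
  then have b: "\<And>i x. norm (partial i \<Psi> x) \<le> b i" by simp
  have b0: "0 \<le> b i" for i using order_trans[OF norm_ge_zero b[of i 0]] .
  have bs: "b i \<le> sum b UNIV" for i using b0 by (simp add: member_le_sum)
  have "0 \<le> sum b UNIV" using b0 by (simp add: sum_nonneg)
  then have "B + sum b UNIV + 1 > 0" "norm (\<Psi> x) \<le> B + sum b UNIV + 1"
    "norm (partial i \<Psi> x) \<le> B + sum b UNIV + 1" for i x
    using B(1) B(2)[of x] b[of i x] bs[of i] by linarith+
  then show ?thesis
    using that[of "B + sum b UNIV + 1"] by blast
qed

lemmas measurables = W12_measurable[OF Q] Cc_infty_measurable[OF \<Psi>] Cc_infty_measurable[OF partial_Cc_infty[OF \<Psi>]]
  W12_weak_partial(2)[OF Q]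

lemma integrable_gradient_component:
  "integrable (leb) (\<lambda>x. weak_partial i Q x \<bullet> partial i \<Psi> x)"
proof -
  obtain B where "B > 0" "\<And>x. norm (\<Psi> x) \<le> B" and B: "\<And>i x. norm (partial i \<Psi> x) \<le> B" using bounded_Psi by blast
  have "norm (weak_partial i Q x \<bullet> partial i \<Psi> x) \<le> norm (B * norm (weak_partial i Q x))" for x
  proof -
    have "\<bar>weak_partial i Q x \<bullet> partial i \<Psi> x\<bar> \<le> norm (weak_partial i Q x) * B"
      using B by (intro order_trans[OF Cauchy_Schwarz_ineq2] mult_left_mono) auto
    also have "\<dots> \<le> \<bar>B * norm (weak_partial i Q x)\<bar>" by (simp add: mult.commute)
    finally show ?thesis by simp
  qed
  note bound = this
  show "integrable (leb) (\<lambda>x. weak_partial i Q x \<bullet> partial i \<Psi> x)"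
  proof (rule Bochner_Integration.integrable_bound[of _ "\<lambda>x. B * norm (weak_partial i Q x)", OF _ _ AE_I2])
    show "integrable (leb) (\<lambda>x. B * norm (weak_partial i Q x))"
      by (intro integrable_mult_right integrable_norm W12_weak_partial(4)[OF Q])
    show "(\<lambda>x. weak_partial i Q x \<bullet> partial i \<Psi> x) \<in> borel_measurable (leb)"
      by (intro borel_measurable_inner measurables)
  qed (rule bound)
qed

lemma integrable_gradient_product:
  "integrable (leb) (\<lambda>x. \<Sum>i\<in>UNIV. weak_partial i Q x \<bullet> partial i \<Psi> x)"
  by (rule Bochner_Integration.integrable_sum) (rule integrable_gradient_component)

lemma integrable_bounded_polynomial:
  assumes m: "f \<in> borel_measurable (leb)"
    and b: "\<And>B x. norm (Q x) \<le> 1 \<Longrightarrow> norm (\<Psi> x) \<le> B \<Longrightarrow> (\<And>i. norm (partial i \<Psi> x) \<le> B) \<Longrightarrow> \<bar>f x\<bar> \<le> c B"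
  shows "integrable (leb) (f :: real^3 \<Rightarrow> real)"
proof -
  obtain B where "B > 0" and B: "\<And>x. norm (\<Psi> x) \<le> B" "\<And>i x. norm (partial i \<Psi> x) \<le> B" using bounded_Psi by blast
  show ?thesis
  proof (rule bounded_imp_integrable_B1[OF m, of "c B"])
    show "AE x in leb. norm (f x) \<le> c B"
      using Q1 by eventually_elim (use B b in \<open>simp add: real_norm_def\<close>)
  qed
qed

lemma inner_bound: "norm (Q x) \<le> 1 \<Longrightarrow> norm (\<Psi> x) \<le> B \<Longrightarrow> \<bar>Q x \<bullet> \<Psi> x\<bar> \<le> B"
  using Cauchy_Schwarz_ineq2[of "Q x" "\<Psi> x"] mult_mono[of "norm (Q x)" 1 "norm (\<Psi> x)" B] by simp

lemma integrable_densities: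
  "integrable (leb) (\<lambda>x. (norm (Q x))\<^sup>2 * (Q x \<bullet> \<Psi> x))"
  "integrable (leb) (\<lambda>x. trace (Q x ** Q x ** \<Psi> x))"
  "integrable (leb) (\<lambda>x. trace (Q x ** \<Psi> x ** \<Psi> x))"
  "integrable (leb) (\<lambda>x. trace (\<Psi> x ** \<Psi> x ** \<Psi> x))"
  "integrable (leb) (\<lambda>x. trace (Q x ** Q x ** Q x))"
  "integrable (leb) (\<lambda>x. (1 - (norm (Q x))\<^sup>2) * (Q x \<bullet> \<Psi> x))"
  "integrable (leb) (\<lambda>x. (norm (partial i \<Psi> x))\<^sup>2)"
  "integrable (leb) (\<lambda>x. (Q x \<bullet> \<Psi> x)\<^sup>2)"
  "integrable (leb) (\<lambda>x. (norm (Q x))\<^sup>2 * (norm (\<Psi> x))\<^sup>2)"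
  "integrable (leb) (\<lambda>x. (1 - (norm (Q x))\<^sup>2) * (norm (\<Psi> x))\<^sup>2)"
  "integrable (leb) (\<lambda>x. (Q x \<bullet> \<Psi> x) * (norm (\<Psi> x))\<^sup>2)"
  "integrable (leb) (\<lambda>x. ((norm (\<Psi> x))\<^sup>2)\<^sup>2)"
  "integrable (leb) (\<lambda>x. norm (Q x) ^ 4)"
  "integrable (leb) (\<lambda>x. (1 - (norm (Q x))\<^sup>2)\<^sup>2)"
proof -
  note [measurable] = measurables and [intro!] = measurable_trace_mult3
  have t3: "\<bar>trace (A ** B ** C)\<bar> \<le> a * b * c" if "norm A \<le> a" "norm B \<le> b" "norm C \<le> c" for A B C :: "real^3^3" and a b c
  proof -
    have "0 \<le> a" "0 \<le> b" using that norm_ge_zero order_trans by blast+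
    then have "norm A * norm B * norm C \<le> a * b * c" using that by (intro mult_mono mult_nonneg_nonneg) auto
    with trace_mult3_le[of A B C] show ?thesis by linarith
  qed
  have p1: "(norm (Q x))\<^sup>2 \<le> 1" if "norm (Q x) \<le> 1" for x using that by (simp add: power_le_one)
  show "integrable (leb) (\<lambda>x. (norm (Q x))\<^sup>2 * (Q x \<bullet> \<Psi> x))"
    by (rule integrable_bounded_polynomial[where c="\<lambda>B. 1 * B"], measurable)
       (unfold abs_mult, intro mult_mono, auto simp: p1 inner_bound)
  show "integrable (leb) (\<lambda>x. trace (Q x ** Q x ** \<Psi> x))"
    by (rule integrable_bounded_polynomial[where c="\<lambda>B. 1 * 1 * B"]) (intro measurable_trace_mult3 measurables, rule t3, auto)
  show "integrable (leb) (\<lambda>x. trace (Q x ** \<Psi> x ** \<Psi> x))"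
    by (rule integrable_bounded_polynomial[where c="\<lambda>B. 1 * B * B"]) (intro measurable_trace_mult3 measurables, rule t3, auto)
  show "integrable (leb) (\<lambda>x. trace (\<Psi> x ** \<Psi> x ** \<Psi> x))"
    by (rule integrable_bounded_polynomial[where c="\<lambda>B. B * B * B"]) (intro measurable_trace_mult3 measurables, rule t3, auto)
  show "integrable (leb) (\<lambda>x. trace (Q x ** Q x ** Q x))"
    by (rule integrable_bounded_polynomial[where c="\<lambda>B. 1 * 1 * 1"]) (intro measurable_trace_mult3 measurables, rule t3, auto)
  show "integrable (leb) (\<lambda>x. (1 - (norm (Q x))\<^sup>2) * (Q x \<bullet> \<Psi> x))"
    by (rule integrable_bounded_polynomial[where c="\<lambda>B. 1 * B"], measurable)
       (unfold abs_mult, intro mult_mono, auto simp: p1 inner_bound)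
  show "integrable (leb) (\<lambda>x. (norm (partial i \<Psi> x))\<^sup>2)"
    by (rule integrable_bounded_polynomial[where c="\<lambda>B. B\<^sup>2"], measurable) (auto intro!: power_mono)
  show "integrable (leb) (\<lambda>x. (Q x \<bullet> \<Psi> x)\<^sup>2)"
  proof (rule integrable_bounded_polynomial[where c="\<lambda>B. B\<^sup>2"])
    show "\<bar>(Q x \<bullet> \<Psi> x)\<^sup>2\<bar> \<le> B\<^sup>2" if "norm (Q x) \<le> 1" "norm (\<Psi> x) \<le> B" for B x
      using power_mono[OF inner_bound[OF that] abs_ge_zero, of 2] by simp
  qed measurable
  show "integrable (leb) (\<lambda>x. (norm (Q x))\<^sup>2 * (norm (\<Psi> x))\<^sup>2)"
    by (rule integrable_bounded_polynomial[where c="\<lambda>B. 1 * B\<^sup>2"], measurable)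
       (unfold abs_mult, intro mult_mono, auto simp: p1 power_mono)
  show "integrable (leb) (\<lambda>x. (1 - (norm (Q x))\<^sup>2) * (norm (\<Psi> x))\<^sup>2)"
    by (rule integrable_bounded_polynomial[where c="\<lambda>B. 1 * B\<^sup>2"], measurable)
       (unfold abs_mult, intro mult_mono, auto simp: p1 power_mono)
  show "integrable (leb) (\<lambda>x. (Q x \<bullet> \<Psi> x) * (norm (\<Psi> x))\<^sup>2)"
    by (rule integrable_bounded_polynomial[where c="\<lambda>B. B * B\<^sup>2"], measurable)
       (unfold abs_mult, intro mult_mono, auto simp: inner_bound power_mono order_trans[OF norm_ge_zero])
  show "integrable (leb) (\<lambda>x. ((norm (\<Psi> x))\<^sup>2)\<^sup>2)"
    by (rule integrable_bounded_polynomial[where c="\<lambda>B. (B\<^sup>2)\<^sup>2"], measurable) (auto intro!: power_mono)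
  show "integrable (leb) (\<lambda>x. norm (Q x) ^ 4)"
    by (rule integrable_bounded_polynomial[where c="\<lambda>B. 1"], measurable) (auto simp: power_le_one)
  show "integrable (leb) (\<lambda>x. (1 - (norm (Q x))\<^sup>2)\<^sup>2)"
    by (rule integrable_bounded_polynomial[where c="\<lambda>B. 1"], measurable) (auto simp: power_le_one p1)
qed

lemma integrable_energy_density: "integrable (leb) (energy_density lam \<mu> Q)"
  unfolding energy_density_def[abs_def] W_def
  using integrable_densities(5,13,14) W12_weak_partial(3)[OF Q] finite_measure.integrable_const[OF finite_measure_B1]
  by (intro Bochner_Integration.integrable_add integrable_mult_right Bochner_Integration.integrable_diff
      Bochner_Integration.integrable_sum) auto

lemma integrable_first_density: "integrable (leb) (first_density lam \<mu> Q \<Psi>)"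
  unfolding first_density_def[abs_def]
  using integrable_densities integrable_gradient_product
  by (intro Bochner_Integration.integrable_add integrable_mult_right Bochner_Integration.integrable_diff integrable_divide_zero) auto

lemma integrable_second_density: "integrable (leb) (second_density lam \<mu> Q \<Psi>)"
  unfolding second_density_def[abs_def]
  using integrable_densities
  by (intro Bochner_Integration.integrable_add integrable_mult_right Bochner_Integration.integrable_diff
      integrable_divide_zero Bochner_Integration.integrable_sum) auto

lemma integrable_third_density: "integrable (leb) (third_density lam \<mu> Q \<Psi>)"
  unfolding third_density_def[abs_def]
  using integrable_densities
  by (intro Bochner_Integration.integrable_add integrable_mult_right Bochner_Integration.integrable_diff integrable_divide_zero) auto

lemma integrable_fourth_density: "integrable (leb) (fourth_density lam \<mu> \<Psi>)"
  unfolding fourth_density_def[abs_def]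
  using integrable_densities by (intro integrable_mult_right) auto

text \<open>Weak derivatives are additive almost everywhere and \<open>Q\<close> is bounded, so the expansion of the density
  may be integrated term by term; first and second variation are then coefficients of a polynomial.\<close>

lemma energy_add_scaleR:
  "energy lam \<mu> (\<lambda>x. Q x + t *\<^sub>R \<Psi> x) = energy lam \<mu> Q + t * (LINT x|leb. first_density lam \<mu> Q \<Psi> x)
     + t\<^sup>2 * (LINT x|leb. second_density lam \<mu> Q \<Psi> x)
     + t ^ 3 * (LINT x|leb. third_density lam \<mu> Q \<Psi> x)
     + t ^ 4 * (LINT x|leb. fourth_density lam \<mu> \<Psi> x)"
proof -
  let ?P = "\<lambda>x. energy_density lam \<mu> Q x + t * first_density lam \<mu> Q \<Psi> x
     + t\<^sup>2 * second_density lam \<mu> Q \<Psi> x + t ^ 3 * third_density lam \<mu> Q \<Psi> x + t ^ 4 * fourth_density lam \<mu> \<Psi> x"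
  note I = integrable_energy_density[of lam \<mu>] integrable_first_density[of lam \<mu>] integrable_second_density[of lam \<mu>] integrable_third_density[of lam \<mu>] integrable_fourth_density[of lam \<mu>]
  have int: "integrable (leb) ?P"
    by (intro Bochner_Integration.integrable_add integrable_mult_right I)
  have "AE x in leb. weak_partial i (\<lambda>x. Q x + t *\<^sub>R \<Psi> x) x = weak_partial i Q x + t *\<^sub>R partial i \<Psi> x" for i
    by (rule weak_partial_AE_eq[OF has_weak_partial_add_scaleR[OF W12_weak_partial(1)[OF Q] Cc_has_weak_partial[OF \<Psi>]]])
  then have "AE x in leb. \<forall>i\<in>UNIV. weak_partial i (\<lambda>x. Q x + t *\<^sub>R \<Psi> x) x = weak_partial i Q x + t *\<^sub>R partial i \<Psi> x"
    by (intro AE_finite_allI) auto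
  then have ae: "AE x in leb. ?P x = energy_density lam \<mu> (\<lambda>x. Q x + t *\<^sub>R \<Psi> x) x"
    by eventually_elim (rule energy_density_add_scaleR[symmetric], simp)
  have "(LINT x|leb. energy_density lam \<mu> (\<lambda>x. Q x + t *\<^sub>R \<Psi> x) x) = (LINT x|leb. ?P x)"
    by (rule integral_cong_AE[symmetric, OF borel_measurable_integrable[OF int]
        AE_eq_measurable_B1[OF borel_measurable_integrable[OF int] ae] ae])
  also have "\<dots> = (LINT x|leb. energy_density lam \<mu> Q x) + t * (LINT x|leb. first_density lam \<mu> Q \<Psi> x)
     + t\<^sup>2 * (LINT x|leb. second_density lam \<mu> Q \<Psi> x)
     + t ^ 3 * (LINT x|leb. third_density lam \<mu> Q \<Psi> x)
     + t ^ 4 * (LINT x|leb. fourth_density lam \<mu> \<Psi> x)"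
    by (simp add: I)
  finally show ?thesis by (simp only: energy_eq)
qed

lemma DERIV_energy:
  "((\<lambda>t. energy lam \<mu> (\<lambda>x. Q x + t *\<^sub>R \<Psi> x)) has_real_derivative
      (LINT x|leb. first_density lam \<mu> Q \<Psi> x) + 2 * t * (LINT x|leb. second_density lam \<mu> Q \<Psi> x)
      + 3 * t\<^sup>2 * (LINT x|leb. third_density lam \<mu> Q \<Psi> x) + 4 * t ^ 3 * (LINT x|leb. fourth_density lam \<mu> \<Psi> x)) (at t)"
  unfolding energy_add_scaleR by (auto intro!: derivative_eq_intros simp: algebra_simps)

lemma second_variation_eq: "second_variation lam \<mu> \<Psi> Q = 2 * (LINT x|leb. second_density lam \<mu> Q \<Psi> x)"
proof -
  have d: "deriv (\<lambda>t. energy lam \<mu> (\<lambda>x. Q x + t *\<^sub>R \<Psi> x)) = (\<lambda>t.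
      (LINT x|leb. first_density lam \<mu> Q \<Psi> x) + 2 * t * (LINT x|leb. second_density lam \<mu> Q \<Psi> x)
      + 3 * t\<^sup>2 * (LINT x|leb. third_density lam \<mu> Q \<Psi> x) + 4 * t ^ 3 * (LINT x|leb. fourth_density lam \<mu> \<Psi> x))"
    using DERIV_energy by (intro ext DERIV_imp_deriv)
  show ?thesis unfolding second_variation_def numeral_2_eq_2 funpow.simps o_def id_def d
    by (rule DERIV_imp_deriv) (auto intro!: derivative_eq_intros)
qed

lemma critical_point_first_density:
  assumes "V = S0" "critical_point lam \<mu> Q"
  shows "(LINT x|leb. first_density lam \<mu> Q \<Psi> x) = 0"
proof -
  have "((\<lambda>t. energy lam \<mu> (\<lambda>x. Q x + t *\<^sub>R \<Psi> x)) has_real_derivative 0) (at 0)"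
    using assms \<Psi> unfolding critical_point_def by blast
  from DERIV_unique[OF DERIV_energy[of lam \<mu> 0] this] show ?thesis by simp
qed

end

section \<open>The constant norm hedgehog\<close>

lemma bounded_bilinear_outer_product: "bounded_bilinear outer_product"
proof (rule bounded_bilinear.intro)
  show "\<exists>K. \<forall>a b. norm (outer_product a b) \<le> norm a * norm b * K"
  proof (intro exI[of _ 1] allI)
    fix a b
    have "(norm (outer_product a b))\<^sup>2 = (norm a * norm b)\<^sup>2"
      unfolding norm_matrix_sq power_mult_distrib power2_norm_eq_inner
      by (simp add: outer_product_def inner_vec_def sum_product power2_eq_square mult.assoc mult.left_commute)
    then show "norm (outer_product a b) \<le> norm a * norm b * 1" by simp
  qed
qed (simp_all add: outer_product_def vec_eq_iff distrib_left distrib_right mult.left_commute)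

lemma inner_outer_product: "outer_product a b \<bullet> outer_product c d = (a \<bullet> c) * (b \<bullet> d)"
  by (simp add: outer_product_def inner_vec_def sum_product mult.assoc mult.left_commute)

lemma inner_outer_product_mat1:
  "outer_product a b \<bullet> mat 1 = a \<bullet> b" "mat 1 \<bullet> outer_product a b = a \<bullet> b"
  by (simp_all add: outer_product_def inner_vec_def mat_def if_distrib if_distribR cong: if_cong)

lemma inner_outer_product_matrix: "outer_product a b \<bullet> v = a \<bullet> (v *v b)"
  by (simp add: outer_product_def inner_vec_def matrix_vector_mult_def sum_distrib_left mult.assoc mult.left_commute mult.commute)

lemma inner_mat1: "v \<bullet> (mat 1 :: real^3^3) = trace v" "(mat 1 :: real^3^3) \<bullet> mat 1 = 3"
  by (simp_all add: inner_vec_def mat_def trace_def if_distrib cong: if_cong)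

lemma S0_simps:
  assumes "v \<in> S0"
  shows "trace v = 0" "x \<bullet> (v *v y) = (v *v x) \<bullet> y"
proof -
  show "trace v = 0" using assms by (simp add: S0_def)
  have "v *v x = x v* v" using assms transpose_matrix_vector[of v x] by (simp add: S0_def)
  then show "x \<bullet> (v *v y) = (v *v x) \<bullet> y" by (simp add: dot_lmul_matrix)
qed

text \<open>This form avoids the square root hidden in \<open>norm\<close> and is the one to differentiate.\<close>

lemma Hbar_eq: "Hbar x = sqrt (3 / 2) *\<^sub>R (inverse (x \<bullet> x) *\<^sub>R outer_product x x - (1 / 3) *\<^sub>R mat 1)"
proof -
  have "inverse (norm x) * inverse (norm x) = inverse (x \<bullet> x)"
    by (metis inverse_mult_distrib norm_eq_square power2_eq_square power2_norm_eq_inner)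
  then show ?thesis
    by (simp add: Hbar_def bounded_bilinear.scaleR_left[OF bounded_bilinear_outer_product]
      bounded_bilinear.scaleR_right[OF bounded_bilinear_outer_product])
qed

lemma smooth_on_Hbar [smooth_intros]: "smooth_on (- {0}) Hbar"
proof -
  have o: "open (- {0 :: real^3})" by (simp add: open_Compl)
  have "smooth_on (- {0}) (\<lambda>x. outer_product x x)"
    by (rule smooth_on_bilinear[OF o bounded_bilinear_outer_product smooth_on_ident smooth_on_ident])
  then show ?thesis
    unfolding Hbar_eq[abs_def] by (intro smooth_intros o) auto
qed

lemma inner_Hbar_Hbar: "x \<noteq> 0 \<Longrightarrow> Hbar x \<bullet> Hbar x = 1"
  unfolding Hbar_eq
  by (simp add: inner_diff_left inner_diff_right inner_outer_product inner_outer_product_mat1 inner_mat1(2))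
     (simp add: field_simps)

lemma norm_Hbar: "x \<noteq> 0 \<Longrightarrow> norm (Hbar x) = 1"
  by (simp add: norm_eq_sqrt_inner inner_Hbar_Hbar)

lemma Hbar_in_S0: "x \<noteq> 0 \<Longrightarrow> Hbar x \<in> S0"
proof -
  assume x: "x \<noteq> 0"
  have "trace (Hbar x) = Hbar x \<bullet> mat 1" by (rule inner_mat1(1)[symmetric])
  also have "\<dots> = 0" using x by (simp add: Hbar_eq inner_diff_left inner_outer_product_mat1 inner_mat1(2))
  finally have "trace (Hbar x) = 0" .
  moreover have "transpose (Hbar x) = Hbar x"
    by (simp add: Hbar_eq transpose_def outer_product_def vec_eq_iff mat_def mult.commute)
  ultimately show ?thesis by (simp add: S0_def)
qed

lemma Hbar_inner_matrix:
  assumes "v \<in> S0"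
  shows "Hbar x \<bullet> v = sqrt (3 / 2) * (x \<bullet> (v *v x)) / (x \<bullet> x)"
  using S0_simps(1)[OF assms] inner_mat1(1)[of v] inner_commute[of "mat 1" v]
  by (simp add: Hbar_eq inner_diff_left inner_outer_product_matrix field_simps)

text \<open>The partial derivatives of \<open>Hbar\<close> away from the origin, in closed form.\<close>

definition dHbar :: "3 \<Rightarrow> real^3 \<Rightarrow> real^3^3" where
  "dHbar i x = sqrt (3 / 2) *\<^sub>R (inverse (x \<bullet> x) *\<^sub>R (outer_product x (axis i 1) + outer_product (axis i 1) x)
      - (2 * x $ i * inverse (x \<bullet> x) * inverse (x \<bullet> x)) *\<^sub>R outer_product x x)"

lemma partial_Hbar:
  assumes "x \<noteq> 0"
  shows "partial i Hbar x = dHbar i x"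
proof -
  note d = bounded_bilinear.FDERIV[OF bounded_bilinear_outer_product has_derivative_ident has_derivative_ident]
  have t: "((\<lambda>x. inverse (x \<bullet> x)) has_derivative (\<lambda>h. - (inverse (x \<bullet> x) * (x \<bullet> h + h \<bullet> x) * inverse (x \<bullet> x)))) (at x)"
    using assms by (intro Deriv.has_derivative_inverse has_derivative_inner has_derivative_ident) auto
  show ?thesis unfolding Hbar_eq[abs_def]
    by (rule partial_eqI[OF has_derivative_scaleR_right[OF has_derivative_diff[OF has_derivative_scaleR[OF t d] has_derivative_const]]])
       (simp add: dHbar_def inner_axis inner_axis' algebra_simps)
qed

lemma inner_self_sum: "(x :: real^3) \<bullet> x = (\<Sum>i\<in>UNIV. (x $ i)\<^sup>2)"
  by (simp add: inner_vec_def power2_eq_square)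

lemma inner_dHbar_dHbar:
  assumes "x \<noteq> 0"
  shows "dHbar i x \<bullet> dHbar i x = 3 / (x \<bullet> x) - 3 * (x $ i)\<^sup>2 / (x \<bullet> x)\<^sup>2"
proof -
  define t where "t = x \<bullet> x"
  have "t \<noteq> 0" using assms by (simp add: t_def)
  have "dHbar i x \<bullet> dHbar i x = 3 / 2 * (inverse t * inverse t * (2 * t + 2 * (x $ i)\<^sup>2)
     - 2 * inverse t * (2 * x $ i * inverse t * inverse t) * (2 * x $ i * t) + (2 * x $ i * inverse t * inverse t)\<^sup>2 * t\<^sup>2)"
    unfolding dHbar_def t_def
    by (simp add: inner_diff_left inner_diff_right inner_add_left inner_add_right inner_outer_product inner_axis inner_axis' inner_commute power2_eq_square)
       (simp add: algebra_simps)
  also have "\<dots> = 3 / t - 3 * (x $ i)\<^sup>2 / t\<^sup>2"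
    using \<open>t \<noteq> 0\<close> by (simp add: field_simps power2_eq_square)
  finally show ?thesis by (simp add: t_def)
qed

text \<open>The energy density of the hedgehog. The number 6 is the eigenvalue of the Laplacian of the sphere on
  quadratic harmonics; it becomes the limit of the Lagrange multiplier \<open>\<mu> (1 - |H|\<^sup>2) |x|\<^sup>2\<close>.\<close>

lemma sum_norm_dHbar:
  assumes "x \<noteq> 0"
  shows "(\<Sum>i\<in>UNIV. (norm (dHbar i x))\<^sup>2) = 6 / (x \<bullet> x)"
proof -
  have "(\<Sum>i\<in>UNIV. (norm (dHbar i x))\<^sup>2) = 9 / (x \<bullet> x) - 3 * (\<Sum>i\<in>UNIV. (x $ i)\<^sup>2) / (x \<bullet> x)\<^sup>2"
    unfolding power2_norm_eq_inner inner_dHbar_dHbar[OF assms]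
    by (simp add: sum_subtractf sum_divide_distrib[symmetric] sum_distrib_left[symmetric])
  also have "\<dots> = 6 / (x \<bullet> x)"
    unfolding inner_self_sum[symmetric] using assms by (simp add: field_simps power2_eq_square)
  finally show ?thesis .
qed

lemma Hbar_inner_dHbar:
  assumes "x \<noteq> 0"
  shows "Hbar x \<bullet> dHbar i x = 0"
  using assms unfolding Hbar_eq dHbar_def
  by (simp add: inner_diff_left inner_diff_right inner_add_left inner_add_right inner_outer_product inner_outer_product_mat1
      inner_axis inner_axis')
     (simp add: field_simps)

lemma dHbar_inner_matrix:
  assumes "v \<in> S0"
  shows "dHbar i x \<bullet> v = sqrt (3 / 2) * (2 * (v *v x) $ i / (x \<bullet> x) - 2 * x $ i * (x \<bullet> (v *v x)) / (x \<bullet> x)\<^sup>2)"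
proof -
  have "x \<bullet> (v *v axis i 1) = (v *v x) $ i" "axis i 1 \<bullet> (v *v x) = (v *v x) $ i"
    by (simp_all add: S0_simps(2)[OF assms, of x] inner_axis inner_axis')
  then show ?thesis
    unfolding dHbar_def divide_inverse power2_eq_square inverse_mult_distrib
    by (simp add: inner_diff_left inner_add_left inner_outer_product_matrix algebra_simps)
qed

lemma sum_dHbar_inner_matrix_sq:
  assumes v: "v \<in> S0" and x: "x \<noteq> 0"
  shows "(\<Sum>i\<in>UNIV. (dHbar i x \<bullet> v)\<^sup>2)
     = 6 * ((v *v x) \<bullet> (v *v x)) / (x \<bullet> x)\<^sup>2 - 6 * (x \<bullet> (v *v x))\<^sup>2 / (x \<bullet> x) ^ 3"
proof -
  define t where "t = x \<bullet> x"
  define q where "q = x \<bullet> (v *v x)"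
  have t: "t \<noteq> 0" using x by (simp add: t_def)
  have "(dHbar i x \<bullet> v)\<^sup>2 = 6 / t\<^sup>2 * ((v *v x) $ i)\<^sup>2 - 12 * q / t ^ 3 * (x $ i * (v *v x) $ i) + 6 * q\<^sup>2 / t ^ 4 * (x $ i)\<^sup>2" for i
    unfolding dHbar_inner_matrix[OF v] power_mult_distrib t_def[symmetric] q_def[symmetric]
    using t by (simp add: field_simps power2_eq_square power3_eq_cube power4_eq_xxxx)
  then have "(\<Sum>i\<in>UNIV. (dHbar i x \<bullet> v)\<^sup>2) = 6 / t\<^sup>2 * (\<Sum>i\<in>UNIV. ((v *v x) $ i)\<^sup>2)
      - 12 * q / t ^ 3 * (\<Sum>i\<in>UNIV. x $ i * (v *v x) $ i) + 6 * q\<^sup>2 / t ^ 4 * (\<Sum>i\<in>UNIV. (x $ i)\<^sup>2)"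
    by (simp only: sum.distrib sum_subtractf sum_distrib_left)
  also have "\<dots> = 6 / t\<^sup>2 * ((v *v x) \<bullet> (v *v x)) - 12 * q / t ^ 3 * q + 6 * q\<^sup>2 / t ^ 4 * t"
    by (simp only: inner_self_sum[symmetric] t_def[symmetric]) (simp add: q_def inner_vec_def)
  finally show ?thesis
    unfolding t_def[symmetric] q_def[symmetric] using t by (simp add: field_simps power2_eq_square power3_eq_cube power4_eq_xxxx)
qed

text \<open>\<open>Hbar\<close> is homogeneous of degree zero, so its radial derivative vanishes.\<close>

lemma sum_coord_dHbar_inner_matrix:
  assumes v: "v \<in> S0" and x: "x \<noteq> 0"
  shows "(\<Sum>i\<in>UNIV. x $ i * (dHbar i x \<bullet> v)) = 0"
proof -
  have "(\<Sum>i\<in>UNIV. x $ i * (dHbar i x \<bullet> v)) = sqrt (3 / 2) * (2 * (x \<bullet> (v *v x)) / (x \<bullet> x) - 2 * (x \<bullet> x) * (x \<bullet> (v *v x)) / (x \<bullet> x)\<^sup>2)"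
    unfolding dHbar_inner_matrix[OF v]
    by (simp add: inner_vec_def[of x "v *v x"] inner_vec_def[of x x] sum_subtractf[symmetric] sum_distrib_left sum_distrib_right sum_divide_distrib right_diff_distrib mult_ac)
  also have "\<dots> = 0" using x by (simp add: power2_eq_square)
  finally show ?thesis .
qed

text \<open>Differentiate \<open>Hbar \<bullet> Hbar = 1\<close> twice.\<close>

lemma Hbar_inner_second_partial:
  assumes "x \<noteq> 0"
  shows "Hbar x \<bullet> partial i (partial i Hbar) x = - (norm (dHbar i x))\<^sup>2"
proof -
  have dH: "Hbar differentiable at x" "partial i Hbar differentiable at x"
    using assms by (auto intro!: smooth_on_differentiable[of "- {0}"] smooth_on_partial smooth_on_Hbar)
  have "partial i (\<lambda>y. Hbar y \<bullet> partial i Hbar y) x = partial i (\<lambda>y. 0) x"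
    by (rule partial_cong[of "- {0}"]) (use assms in \<open>auto simp: partial_Hbar Hbar_inner_dHbar\<close>)
  then have "Hbar x \<bullet> partial i (partial i Hbar) x + partial i Hbar x \<bullet> partial i Hbar x = 0"
    by (simp add: partial_inner[OF dH] partial_const)
  then show ?thesis using assms by (simp add: partial_Hbar power2_norm_eq_inner)
qed

section \<open>Test fields along the hedgehog\<close>

text \<open>In Leibniz' rule the mixed terms drop out since \<open>Hbar\<close> is orthogonal to its derivatives. The identity
  allows the equation of \<open>H = u Hbar\<close> to be tested with \<open>f Hbar\<close> without any regularity of \<open>u\<close>: all
  derivatives can be moved to the test field.\<close>

lemma Hbar_inner_second_partial_product:
  assumes f: "f \<in> Cc_infty (B1 - {0}) (UNIV :: real set)" and x: "x \<noteq> 0"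
  shows "Hbar x \<bullet> laplacian (\<lambda>y. f y *\<^sub>R Hbar y) x
    = laplacian f x - 6 * f x / (x \<bullet> x)"
proof -
  note fs = Cc_infty_smooth_on[OF f, of "- {0}"]
  have d: "f differentiable at y" "partial i f differentiable at y" "Hbar differentiable at y" "partial i Hbar differentiable at y"
    if "y \<noteq> 0" for y i
    using that by (auto intro!: smooth_on_differentiable[of "- {0}"] smooth_on_partial smooth_on_Hbar fs)
  have "Hbar x \<bullet> partial i (partial i (\<lambda>y. f y *\<^sub>R Hbar y)) x = partial i (partial i f) x - f x * (norm (dHbar i x))\<^sup>2" for i
  proof -
    have "partial i (partial i (\<lambda>y. f y *\<^sub>R Hbar y)) x = partial i (\<lambda>y. f y *\<^sub>R partial i Hbar y + partial i f y *\<^sub>R Hbar y) x"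
    proof (rule partial_cong[of "- {0}"])
      show "(\<lambda>y. f y *\<^sub>R partial i Hbar y + partial i f y *\<^sub>R Hbar y) differentiable at x"
        by (intro differentiable_add differentiable_scaleR d x)
    qed (use x d in \<open>auto simp: partial_scaleR\<close>)
    also have "\<dots> = f x *\<^sub>R partial i (partial i Hbar) x + partial i f x *\<^sub>R partial i Hbar x
      + (partial i f x *\<^sub>R partial i Hbar x + partial i (partial i f) x *\<^sub>R Hbar x)"
      by (simp add: partial_add partial_scaleR d x differentiable_scaleR)
    finally have e: "partial i (partial i (\<lambda>y. f y *\<^sub>R Hbar y)) x = f x *\<^sub>R partial i (partial i Hbar) x + partial i f x *\<^sub>R partial i Hbar x
      + (partial i f x *\<^sub>R partial i Hbar x + partial i (partial i f) x *\<^sub>R Hbar x)" .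
    show ?thesis
      unfolding e by (simp only: inner_add_right inner_scaleR_right Hbar_inner_second_partial[OF x] inner_Hbar_Hbar[OF x]
        partial_Hbar[OF x] Hbar_inner_dHbar[OF x])
  qed
  then show ?thesis
    by (simp add: inner_sum_right sum_subtractf sum_distrib_left[symmetric] sum_norm_dHbar[OF x])
qed

text \<open>The definition of weak derivatives uses scalar test functions; matrix-valued ones are treated entry
  by entry.\<close>

lemma weak_partial_inner:
  assumes w: "has_weak_partial i Q g" and p: "\<psi> \<in> Cc_infty B1 V"
    and ig: "integrable (leb) g" and iQ: "integrable (leb) Q"
  shows "(LINT x|leb. g x \<bullet> \<psi> x) = - (LINT x|leb. Q x \<bullet> partial i \<psi> x)"
proof -
  have comp: "(\<lambda>x. \<psi> x $ j $ k) \<in> Cc_infty B1 UNIV" for j k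
    by (rule Cc_infty_transfer[OF p, of UNIV]) (auto intro!: smooth_intros Cc_infty_smooth_on[OF p])
  have dcomp: "partial i (\<lambda>x. \<psi> x $ j $ k) x = partial i \<psi> x $ j $ k" for j k x
  proof -
    have "(\<psi> has_derivative frechet_derivative \<psi> (at x)) (at x)"
      using smooth_on_differentiable[OF Cc_infty_smooth_on[OF p, of UNIV]] by (auto simp: frechet_derivative_works)
    from bounded_linear.has_derivative[OF bounded_linear_vec_nth bounded_linear.has_derivative[OF bounded_linear_vec_nth this]]
    show ?thesis by (rule partial_eqI) (simp add: partial_def)
  qed
  have lg: "locally_integrable g" "locally_integrable Q" using w by (auto simp: has_weak_partial_def)
  have nth: "(LINT x|leb. h x) $ j $ k = (LINT x|leb. h x $ j $ k)"
    if "integrable (leb) h" for h :: "real^3 \<Rightarrow> real^3^3" and j k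
    using integral_bounded_linear[OF bounded_linear_compose[OF bounded_linear_vec_nth bounded_linear_vec_nth] that, of j k] by simp
  have ic: "integrable (leb) (\<lambda>x. h x $ j $ k)"
    if "integrable (leb) h" for h :: "real^3 \<Rightarrow> real^3^3" and j k
    using integrable_bounded_linear[OF bounded_linear_compose[OF bounded_linear_vec_nth bounded_linear_vec_nth] that, of j k] by simp
  have one: "(LINT x|leb. g x $ j $ k * \<psi> x $ j $ k) = - (LINT x|leb. Q x $ j $ k * partial i \<psi> x $ j $ k)" for j k
  proof -
    let ?f = "\<lambda>x. \<psi> x $ j $ k"
    have "(LINT x|leb. partial i ?f x *\<^sub>R Q x) $ j $ k = (- (LINT x|leb. ?f x *\<^sub>R g x)) $ j $ k"
      using w comp unfolding has_weak_partial_def by simp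
    then show ?thesis
      using nth[OF Cc_scaleR_locally_integrable[OF comp lg(1)], of j k j k]
        nth[OF Cc_scaleR_locally_integrable[OF partial_Cc_infty[OF comp] lg(2)], of i j k j k]
      by (simp add: dcomp mult.commute)
  qed
  have i1: "integrable (leb) (\<lambda>x. g x $ j $ k * \<psi> x $ j $ k)" for j k
    using ic[OF Cc_scaleR_locally_integrable[OF comp lg(1)], of j k j k] by (simp add: mult.commute)
  have i2: "integrable (leb) (\<lambda>x. Q x $ j $ k * partial i \<psi> x $ j $ k)" for j k
    using ic[OF Cc_scaleR_locally_integrable[OF partial_Cc_infty[OF comp] lg(2)], of i j k j k] by (simp add: dcomp mult.commute)
  have e: "A \<bullet> B = (\<Sum>j\<in>UNIV. \<Sum>k\<in>UNIV. A $ j $ k * B $ j $ k)" for A B :: "real^3^3"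
    by (simp add: inner_vec_def)
  show ?thesis unfolding e by (simp add: i1 i2 one sum_negf)
qed

section \<open>Moments on spheres\<close>

text \<open>For \<open>h\<close> orthogonal to \<open>x\<close>, a radial function is constant along the great circle through \<open>x\<close> in
  direction \<open>h\<close>, so the gradient has no tangential component. At the origin the function vanishes
  identically nearby.\<close>

lemma radial_gradient_parallel:
  fixes g :: "real^3 \<Rightarrow> real"
  assumes g: "g \<in> Cc_infty (B1 - {0}) UNIV" and r: "radial g"
  shows "\<exists>m. \<forall>i. partial i g x = m * x $ i"
proof (cases "x = 0")
  case True
  then have "partial i g x = 0" for i
    using Cc_inftyD(3)[OF partial_Cc_infty[OF g], of x] by simp
  then show ?thesis by (intro exI[of _ 0]) simp
next
  case x: False
  define D where "D = frechet_derivative g (at x)"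
  have gD: "(g has_derivative D) (at x)"
    using smooth_on_differentiable[OF Cc_infty_smooth_on[OF g, of UNIV]] by (simp add: D_def frechet_derivative_works)
  have linD: "linear D" using gD has_derivative_linear by blast
  have D0: "D h = 0" if h: "h \<bullet> x = 0" for h
  proof (cases "h = 0")
    case True
    then show ?thesis using linear_0[OF linD] by simp
  next
    case False
    define k where "k = (norm x / norm h) *\<^sub>R h"
    have k: "k \<bullet> x = 0" "x \<bullet> k = 0" "k \<bullet> k = x \<bullet> x"
      using h False by (auto simp: k_def inner_commute dot_square_norm power2_eq_square)
    define c where "c s = cos s *\<^sub>R x + sin s *\<^sub>R k" for s
    have "(norm (c s))\<^sup>2 = (norm x)\<^sup>2" for s
    proof -
      have "c s \<bullet> c s = cos s * (cos s * (x \<bullet> x)) + sin s * (sin s * (x \<bullet> x))"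
        unfolding c_def by (simp add: inner_add_left inner_add_right k)
      also have "\<dots> = (cos s * cos s + sin s * sin s) * (x \<bullet> x)" by (simp only: distrib_right mult.assoc)
      finally show ?thesis by (simp add: power2_norm_eq_inner)
    qed
    then have "norm (c s) = norm x" for s by simp
    then have gc: "(\<lambda>s. g (c s)) = (\<lambda>s. g x)" using r unfolding radial_def by blast
    have cd: "(c has_derivative (\<lambda>s. s *\<^sub>R k)) (at 0)"
      unfolding c_def[abs_def] by (auto intro!: derivative_eq_intros)
    have "c 0 = x" by (simp add: c_def)
    with gD have "(g has_derivative D) (at (c 0))" by simp
    from has_derivative_compose[OF cd this]
    have "((\<lambda>s. g x) has_derivative (\<lambda>s. D (s *\<^sub>R k))) (at 0)" by (simp only: gc)
    then have "(\<lambda>s. D (s *\<^sub>R k)) = (\<lambda>s. 0)"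
      by (rule has_derivative_unique[OF _ has_derivative_const])
    from fun_cong[OF this, of 1] have "(norm x / norm h) * D h = 0"
      by (simp add: k_def linear_scale[OF linD])
    then show ?thesis using x False by simp
  qed
  define m where "m = D x / (x \<bullet> x)"
  have "partial i g x = m * x $ i" for i
  proof -
    define h where "h = axis i 1 - (x $ i / (x \<bullet> x)) *\<^sub>R x"
    have "h \<bullet> x = 0" using x by (simp add: h_def inner_diff_left inner_axis')
    then have "D (axis i 1) = (x $ i / (x \<bullet> x)) * D x"
      using D0[of h] by (simp add: h_def linear_diff[OF linD] linear_scale[OF linD])
    then show ?thesis by (simp add: partial_def D_def[symmetric] m_def)
  qed
  then show ?thesis by blast
qed

lemma radial_square: "radial (\<lambda>x. F (x \<bullet> x))"
  by (simp add: radial_def dot_square_norm)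

lemma radial_mult:
  assumes "radial g" "radial h"
  shows "radial (\<lambda>x. g x * h x)"
  unfolding radial_def
proof (intro allI impI)
  fix x y :: "real^3" assume "norm x = norm y"
  then have "g x = g y" "h x = h y" using assms unfolding radial_def by blast+
  then show "g x * h x = g y * h y" by (simp only:)
qed

text \<open>On a sphere of radius \<open>r\<close>, \<open>r\<^sup>2 \<Delta> p - k (k + 1) p\<close> is the spherical Laplacian of the homogeneous
  function \<open>p\<close> of degree \<open>k\<close>, which has mean zero. In Cartesian terms: the field
  \<open>g (|x|\<^sup>2 \<nabla>p - k p x)\<close> is tangential, so differentiating the radial factor \<open>g\<close> contributes nothing,
  and its divergence is the integrand.\<close>

lemma radial_moment:
  fixes g p :: "real^3 \<Rightarrow> real"
  assumes g: "g \<in> Cc_infty (B1 - {0}) UNIV" and r: "radial g"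
    and p: "smooth_on UNIV p" and euler: "\<And>x. (\<Sum>i\<in>UNIV. x $ i * partial i p x) = k * p x"
  shows "(LINT x|leb. g x * ((x \<bullet> x) * laplacian p x - k * (k + 1) * p x)) = 0"
proof -
  have "\<forall>x. \<exists>m. \<forall>i. partial i g x = m * x $ i" using radial_gradient_parallel[OF g r] ..
  then obtain m where "\<forall>x i. partial i g x = m x * x $ i" by (rule choice[THEN exE])
  then have m: "\<And>i x. partial i g x = m x * x $ i" by simp
  define V where "V i x = g x * ((x \<bullet> x) * partial i p x - k * p x * x $ i)" for i x
  have gB: "g \<in> Cc_infty B1 UNIV" by (rule Cc_infty_mono[OF g]) auto
  have sm: "smooth_on UNIV (\<lambda>x. (x \<bullet> x) * partial i p x - k * p x * x $ i)" for i
    by (intro smooth_intros smooth_on_partial p open_UNIV)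
  have V: "V i \<in> Cc_infty B1 UNIV" for i
    unfolding V_def[abs_def] by (rule Cc_infty_bilinear[OF gB open_UNIV _ sm bounded_bilinear_mult]) simp
  have d: "g differentiable at x" "p differentiable at x" "partial i p differentiable at x"
     "(\<lambda>x. (x \<bullet> x) * partial i p x - k * p x * x $ i) differentiable at x"
     "(\<lambda>x. x \<bullet> x) differentiable at x" "(\<lambda>x. x $ i) differentiable at x" "(\<lambda>x. k * p x) differentiable at x"
     "(\<lambda>x. (x \<bullet> x) * partial i p x) differentiable at x" "(\<lambda>x. k * p x * x $ i) differentiable at x" for i and x :: "real^3"
    by (auto intro!: smooth_on_differentiable[of UNIV] smooth_intros smooth_on_partial p Cc_infty_smooth_on[OF gB])
  have dt: "partial i (\<lambda>x. x \<bullet> x) x = 2 * x $ i" for i and x :: "real^3"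
    by (rule partial_eqI[OF has_derivative_inner[OF has_derivative_ident has_derivative_ident]]) (simp add: inner_axis inner_axis')
  have dx: "partial i (\<lambda>x. x $ i) x = 1" for i and x :: "real^3"
    by (subst partial_bounded_linear_ident[OF bounded_linear_vec_nth]) simp
  have dV: "partial i (V i) x = m x * ((x \<bullet> x) * (x $ i * partial i p x) - k * p x * (x $ i)\<^sup>2)
     + g x * (2 * (x $ i * partial i p x) + (x \<bullet> x) * partial i (partial i p) x - k * (x $ i * partial i p x) - k * p x)" for i x
    unfolding V_def[abs_def] partial_mult[OF d(1) d(4)] partial_diff[OF d(8) d(9)] partial_mult[OF d(5) d(3)]
      partial_mult[OF d(7) d(6)] partial_mult[OF differentiable_const d(2)] partial_const dt dx m
    by (simp add: algebra_simps power2_eq_square)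
  have "(\<Sum>i\<in>UNIV. partial i (V i) x) = g x * ((x \<bullet> x) * laplacian p x - k * (k + 1) * p x)" for x
  proof -
    have "(\<Sum>i\<in>UNIV. partial i (V i) x) = m x * ((x \<bullet> x) * (\<Sum>i\<in>UNIV. x $ i * partial i p x) - k * p x * (\<Sum>i\<in>UNIV. (x $ i)\<^sup>2))
     + g x * (2 * (\<Sum>i\<in>UNIV. x $ i * partial i p x) + (x \<bullet> x) * laplacian p x
         - k * (\<Sum>i\<in>UNIV. x $ i * partial i p x) - 3 * (k * p x))"
      unfolding dV by (simp add: sum.distrib sum_subtractf sum_distrib_left[symmetric])
    then show ?thesis unfolding euler inner_self_sum[symmetric] by (simp add: algebra_simps)
  qed
  moreover have "(LINT x|leb. (\<Sum>i\<in>UNIV. partial i (V i) x)) = 0"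
    by (subst Bochner_Integration.integral_sum)
       (auto intro: integral_B1_Cc(1)[OF partial_Cc_infty[OF V]] simp: integral_partial_eq_0[OF V])
  ultimately show ?thesis by simp
qed

lemma Cc_mult_smooth:
  fixes g h :: "real^3 \<Rightarrow> real"
  assumes "g \<in> Cc_infty (B1 - {0}) UNIV" "smooth_on (- {0}) h"
  shows "(\<lambda>x. g x * h x) \<in> Cc_infty (B1 - {0}) UNIV"
  by (rule Cc_infty_bilinear[OF assms(1) _ _ assms(2) bounded_bilinear_mult]) (auto simp: open_Compl)

lemma Cc_punctured_integrable:
  fixes g :: "real^3 \<Rightarrow> 'b::euclidean_space"
  shows "g \<in> Cc_infty (B1 - {0}) V \<Longrightarrow> integrable (leb) g"
  by (rule integral_B1_Cc(1)[of g V]) (auto intro: Cc_infty_mono)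

lemma S4_inner_self: "v \<in> S4 \<Longrightarrow> (\<Sum>i\<in>UNIV. \<Sum>j\<in>UNIV. (v $ i $ j)\<^sup>2) = 1"
  using norm_matrix_sq[of v] by (simp add: S4_def)

lemma smooth_on_matrix_vector: "smooth_on U (\<lambda>x. v *v x)" for v :: "real^3^3"
  by (rule smooth_on_bounded_linear_ident) (rule matrix_vector_mul_bounded_linear)

lemma open_punctured: "open (- {0 :: real^3})"
  by (simp add: open_Compl)

lemma partial_matrix_quadratics:
  assumes v: "v \<in> S0"
  shows "partial i (\<lambda>x. x \<bullet> (v *v x)) x = 2 * (v *v x) $ i"
    and "partial i (\<lambda>x. (v *v x) $ i) x = v $ i $ i"
    and "partial i (\<lambda>x. (x \<bullet> (v *v x))\<^sup>2) x = 4 * (x \<bullet> (v *v x)) * (v *v x) $ i"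
    and "partial i (\<lambda>x. (v *v x) \<bullet> (v *v x)) x = 2 * (v *v (v *v x)) $ i"
    and "partial i (\<lambda>x. (v *v (v *v x)) $ i) x = (\<Sum>j\<in>UNIV. (v $ i $ j)\<^sup>2)"
proof -
  have l: "bounded_linear (\<lambda>x. v *v x)" by (rule matrix_vector_mul_bounded_linear)
  note dl = bounded_linear_imp_has_derivative[OF l]
  have col: "(v *v axis i 1) $ j = v $ j $ i" for j
    by (simp add: matrix_vector_mult_basis column_def)
  have ax: "x \<bullet> (v *v axis i 1) = (v *v x) $ i" for x
    by (simp add: S0_simps(2)[OF v] inner_axis)
  have q: "((\<lambda>x. x \<bullet> (v *v x)) has_derivative (\<lambda>h. x \<bullet> (v *v h) + h \<bullet> (v *v x))) (at x)"
    by (rule has_derivative_inner[OF has_derivative_ident dl])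
  show "partial i (\<lambda>x. x \<bullet> (v *v x)) x = 2 * (v *v x) $ i"
    by (rule partial_eqI[OF q]) (simp add: ax inner_axis')
  show "partial i (\<lambda>x. (v *v x) $ i) x = v $ i $ i"
    by (rule partial_eqI[OF bounded_linear.has_derivative[OF bounded_linear_vec_nth dl]]) (rule col)
  show "partial i (\<lambda>x. (x \<bullet> (v *v x))\<^sup>2) x = 4 * (x \<bullet> (v *v x)) * (v *v x) $ i"
    unfolding power2_eq_square
    by (rule partial_eqI[OF has_derivative_mult[OF q q]]) (simp add: ax inner_axis')
  show "partial i (\<lambda>x. (v *v x) \<bullet> (v *v x)) x = 2 * (v *v (v *v x)) $ i"
    by (rule partial_eqI[OF has_derivative_inner[OF dl dl]])
       (simp add: ax inner_commute[of "v *v axis i 1"])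
  have "(v *v (v *v axis i 1)) $ i = (\<Sum>j\<in>UNIV. (v $ i $ j)\<^sup>2)"
  proof -
    have s: "v $ j $ i = v $ i $ j" for j
      using v unfolding S0_def transpose_def by (metis (mono_tags, lifting) mem_Collect_eq vec_lambda_beta)
    have "(v *v (v *v axis i 1)) $ i = (\<Sum>j\<in>UNIV. v $ i $ j * (v *v axis i 1) $ j)"
      by (simp only: matrix_vector_mult_def vec_lambda_beta)
    then show ?thesis by (simp add: col s power2_eq_square)
  qed
  then show "partial i (\<lambda>x. (v *v (v *v x)) $ i) x = (\<Sum>j\<in>UNIV. (v $ i $ j)\<^sup>2)"
    by (intro partial_eqI[OF bounded_linear.has_derivative[OF bounded_linear_vec_nth bounded_linear.has_derivative[OF l dl]]])
qed

lemma partial_scale: "f differentiable at x \<Longrightarrow> partial i (\<lambda>x. c * f x) x = c * partial i f x" for f :: "real^3 \<Rightarrow> real"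
  by (rule partial_eqI[OF has_derivative_mult_right]) (auto simp: frechet_derivative_works partial_def)

text \<open>\<open>|v x|\<^sup>2\<close> is homogeneous of degree 2 with Laplacian \<open>2 |v|\<^sup>2 = 2\<close>, so its mean over the unit sphere
  is 1/3. The factor \<open>1 / |x|\<^sup>2\<close> is absorbed in the radial weight.\<close>

lemma sphere_moment_2:
  assumes g: "g \<in> Cc_infty (B1 - {0}) UNIV" and r: "radial g" and v: "v \<in> S4"
  shows "(LINT x|leb. g x * (((v *v x) \<bullet> (v *v x)) / (x \<bullet> x))) = (LINT x|leb. g x) / 3"
proof -
  have v0: "v \<in> S0" using v by (simp add: S4_def)
  define p where "p = (\<lambda>x. (v *v x) \<bullet> (v *v x))"
  have smp: "smooth_on U p" if "open U" for U
    unfolding p_def by (intro smooth_intros smooth_on_matrix_vector that)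
  have dp: "partial i p = (\<lambda>x. 2 * (v *v (v *v x)) $ i)" for i
    unfolding p_def by (rule ext) (rule partial_matrix_quadratics[OF v0])
  have lap: "laplacian p x = 2" for x
  proof -
    have "(\<lambda>x. (v *v (v *v x)) $ i) differentiable at x" for i
      by (intro bounded_linear_imp_differentiable bounded_linear_compose[OF bounded_linear_vec_nth]
         bounded_linear_compose[OF matrix_vector_mul_bounded_linear matrix_vector_mul_bounded_linear])
    then have "partial i (partial i p) x = 2 * (\<Sum>j\<in>UNIV. (v $ i $ j)\<^sup>2)" for i
      unfolding dp by (simp add: partial_scale partial_matrix_quadratics(5)[OF v0])
    then show ?thesis using S4_inner_self[OF v] by (simp add: sum_distrib_left[symmetric])
  qed
  have eu: "(\<Sum>i\<in>UNIV. x $ i * partial i p x) = 2 * p x" for x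
  proof -
    have "(\<Sum>i\<in>UNIV. x $ i * partial i p x) = 2 * (x \<bullet> (v *v (v *v x)))"
      unfolding dp inner_vec_def by (simp add: sum_distrib_left mult.left_commute)
    then show ?thesis by (simp add: p_def S0_simps(2)[OF v0, of x "v *v x"])
  qed
  have smi: "smooth_on (- {0}) (\<lambda>x :: real^3. inverse (x \<bullet> x))"
    by (intro smooth_intros open_punctured) auto
  define g' where "g' x = g x * inverse (x \<bullet> x)" for x
  have g': "g' \<in> Cc_infty (B1 - {0}) UNIV" unfolding g'_def[abs_def] by (rule Cc_mult_smooth[OF g smi])
  have r': "radial g'" unfolding g'_def[abs_def] by (rule radial_mult[OF r radial_square])
  have "(LINT x|leb. g' x * ((x \<bullet> x) * laplacian p x - 2 * (2 + 1) * p x)) = 0"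
    by (rule radial_moment[OF g' r' smp[OF open_UNIV] eu])
  moreover define F where "F x = g x * (p x / (x \<bullet> x))" for x
  have "g' x * ((x \<bullet> x) * laplacian p x - 2 * (2 + 1) * p x) = 2 * g x - 6 * F x" for x
    unfolding lap g'_def F_def using Cc_inftyD(3)[OF g, of x] by (cases "x = 0") (auto simp: field_simps)
  ultimately have "(LINT x|leb. 2 * g x - 6 * F x) = 0" by (simp only:)
  moreover have "integrable (leb) F" unfolding F_def[abs_def]
    by (rule Cc_punctured_integrable[OF Cc_mult_smooth[OF g]]) (intro smooth_intros smp open_punctured, auto)
  ultimately have "6 * (LINT x|leb. F x) = 2 * (LINT x|leb. g x)"
    using Cc_punctured_integrable[OF g] by simp
  then show ?thesis by (simp add: F_def p_def)
qed

text \<open>The square of \<open>q = x \<bullet> v x\<close> is homogeneous of degree 4. As \<open>v\<close> is traceless, \<open>q\<close> is harmonic and the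
  Laplacian of \<open>q\<^sup>2\<close> is \<open>8 |v x|\<^sup>2\<close>, so the mean of \<open>q\<^sup>2\<close> over the unit sphere is 8/20 of the mean 1/3 of
  \<open>|v x|\<^sup>2\<close>.\<close>

lemma sphere_moment_4:
  assumes g: "g \<in> Cc_infty (B1 - {0}) UNIV" and r: "radial g" and v: "v \<in> S4"
  shows "(LINT x|leb. g x * ((x \<bullet> (v *v x))\<^sup>2 / (x \<bullet> x)\<^sup>2)) = 2 / 15 * (LINT x|leb. g x)"
proof -
  have v0: "v \<in> S0" using v by (simp add: S4_def)
  define q where "q = (\<lambda>x. x \<bullet> (v *v x))"
  define p where "p = (\<lambda>x. (v *v x) \<bullet> (v *v x))"
  have sm: "smooth_on U (\<lambda>x. (q x)\<^sup>2)" "smooth_on U p" "smooth_on U q" if "open U" for U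
    unfolding q_def p_def by (intro smooth_intros smooth_on_matrix_vector that)+
  have dq: "partial i (\<lambda>x. (q x)\<^sup>2) = (\<lambda>x. (4 * q x) * (v *v x) $ i)" for i
    unfolding q_def by (rule ext) (rule partial_matrix_quadratics[OF v0])
  have lap: "laplacian (\<lambda>x. (q x)\<^sup>2) x = 8 * p x" for x
  proof -
    have d: "(\<lambda>x. (v *v x) $ i) differentiable at x" "q differentiable at x" "(\<lambda>x. 4 * q x) differentiable at x" for i
      by (auto intro!: smooth_on_differentiable[of UNIV] smooth_intros sm smooth_on_matrix_vector)
    have "partial i (partial i (\<lambda>x. (q x)\<^sup>2)) x = 4 * q x * v $ i $ i + 8 * (v *v x) $ i * (v *v x) $ i" for i
      unfolding dq partial_mult[OF d(3) d(1)] partial_scale[OF d(2)] partial_matrix_quadratics(2)[OF v0]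
      by (simp add: q_def partial_matrix_quadratics(1)[OF v0])
    then have "laplacian (\<lambda>x. (q x)\<^sup>2) x = 4 * q x * trace v + 8 * p x"
      by (simp add: sum.distrib sum_distrib_left trace_def p_def inner_vec_def mult.assoc)
    then show ?thesis using S0_simps(1)[OF v0] by simp
  qed
  have eu: "(\<Sum>i\<in>UNIV. x $ i * partial i (\<lambda>x. (q x)\<^sup>2) x) = 4 * (q x)\<^sup>2" for x
  proof -
    have "(\<Sum>i\<in>UNIV. x $ i * partial i (\<lambda>x. (q x)\<^sup>2) x) = 4 * q x * (\<Sum>i\<in>UNIV. x $ i * (v *v x) $ i)"
      unfolding dq by (simp add: sum_distrib_left mult_ac)
    then show ?thesis by (simp add: q_def inner_vec_def power2_eq_square)
  qed
  have smi: "smooth_on (- {0}) (\<lambda>x :: real^3. inverse ((x \<bullet> x)\<^sup>2))"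
    by (intro smooth_intros open_punctured) auto
  define g' where "g' x = g x * inverse ((x \<bullet> x)\<^sup>2)" for x
  have g': "g' \<in> Cc_infty (B1 - {0}) UNIV" unfolding g'_def[abs_def] by (rule Cc_mult_smooth[OF g smi])
  have r': "radial g'" unfolding g'_def[abs_def] by (rule radial_mult[OF r radial_square])
  have "(LINT x|leb. g' x * ((x \<bullet> x) * laplacian (\<lambda>x. (q x)\<^sup>2) x - 4 * (4 + 1) * (q x)\<^sup>2)) = 0"
    by (rule radial_moment[OF g' r' sm(1)[OF open_UNIV] eu])
  moreover define F where "F x = g x * (p x / (x \<bullet> x))" for x
  moreover define E where "E x = g x * ((q x)\<^sup>2 / (x \<bullet> x)\<^sup>2)" for x
  have "g' x * ((x \<bullet> x) * laplacian (\<lambda>x. (q x)\<^sup>2) x - 4 * (4 + 1) * (q x)\<^sup>2) = 8 * F x - 20 * E x" for x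
  proof (cases "x = 0")
    case True
    then show ?thesis using Cc_inftyD(3)[OF g, of x] by (simp add: g'_def F_def E_def)
  next
    case False
    then show ?thesis unfolding lap g'_def F_def E_def by (simp add: field_simps power2_eq_square)
  qed
  ultimately have "(LINT x|leb. 8 * F x - 20 * E x) = 0" by (simp only:)
  moreover have "integrable (leb) F" unfolding F_def[abs_def]
    by (rule Cc_punctured_integrable[OF Cc_mult_smooth[OF g]]) (intro smooth_intros sm open_punctured, auto)
  moreover have "integrable (leb) E" unfolding E_def[abs_def]
    by (rule Cc_punctured_integrable[OF Cc_mult_smooth[OF g]]) (intro smooth_on_divide smooth_on_power smooth_intros sm open_punctured, auto)
  ultimately have "20 * (LINT x|leb. E x) = 8 * (LINT x|leb. F x)" by simp
  moreover have "(LINT x|leb. F x) = (LINT x|leb. g x) / 3"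
    unfolding F_def p_def by (rule sphere_moment_2[OF g r v])
  ultimately show ?thesis by (simp add: E_def q_def)
qed

section \<open>The radial cut-off\<close>

text \<open>The cut-off is a bump in the variable \<open>s = ln (|x|\<^sup>2)\<close>, centred at \<open>- M\<close> with half-width 20. In this
  variable the Laplacian becomes \<open>4 k'' + 2 k'\<close> up to the factor \<open>1 / |x|\<^sup>2\<close>, and translation in \<open>s\<close> is
  dilation in \<open>x\<close>. The primed functions are the first two derivatives.\<close>

definition profile :: "real \<Rightarrow> real \<Rightarrow> real" where
  "profile M s = flat_exp 0 (1 - ((s + M) / 20)\<^sup>2)"

definition profile' :: "real \<Rightarrow> real \<Rightarrow> real" where
  "profile' M s = - flat_exp 2 (1 - ((s + M) / 20)\<^sup>2) * ((s + M) / 200)"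

definition profile'' :: "real \<Rightarrow> real \<Rightarrow> real" where
  "profile'' M s = (flat_exp 4 (1 - ((s + M) / 20)\<^sup>2) - 2 * flat_exp 3 (1 - ((s + M) / 20)\<^sup>2)) * ((s + M) / 200)\<^sup>2
     - flat_exp 2 (1 - ((s + M) / 20)\<^sup>2) / 200"

lemma DERIV_profile: "(profile M has_real_derivative profile' M s) (at s)"
proof -
  have w: "((\<lambda>s. 1 - ((s + M) / 20)\<^sup>2) has_real_derivative - ((s + M) / 200)) (at s)"
    by (auto intro!: derivative_eq_intros simp: field_simps)
  show ?thesis
    using DERIV_chain2[OF DERIV_flat_exp[of 0] w] unfolding profile_def[abs_def] profile'_def by (simp add: numeral_2_eq_2)
qed

lemma DERIV_profile': "(profile' M has_real_derivative profile'' M s) (at s)"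
proof -
  have w: "((\<lambda>s. 1 - ((s + M) / 20)\<^sup>2) has_real_derivative - ((s + M) / 200)) (at s)"
    by (auto intro!: derivative_eq_intros simp: field_simps)
  have l: "((\<lambda>s. (s + M) / 200) has_real_derivative 1 / 200) (at s)"
    by (auto intro!: derivative_eq_intros)
  have "((\<lambda>s. - flat_exp 2 (1 - ((s + M) / 20)\<^sup>2)) has_real_derivative
      - ((flat_exp (2 + 2) (1 - ((s + M) / 20)\<^sup>2) - real 2 * flat_exp (2 + 1) (1 - ((s + M) / 20)\<^sup>2)) * - ((s + M) / 200))) (at s)"
    by (rule DERIV_minus[OF DERIV_chain2[OF DERIV_flat_exp w]])
  note D = this
  have gen: "- ((a - real 2 * b) * - c) * c + 1 / 200 * - f = (a - 2 * b) * c\<^sup>2 - f / 200" for a b c f :: real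
    by (simp add: power2_eq_square algebra_simps)
  have num: "(2 + 2 :: nat) = 4" "(2 + 1 :: nat) = 3" by simp_all
  from DERIV_mult[OF D l] show ?thesis
    unfolding profile'_def[abs_def] profile''_def by (rule DERIV_cong) (simp only: num gen)
qed

text \<open>Hardy's inequality is not saturated by functions of compact support, but on a long interval in \<open>s\<close>
  its constant is nearly attained; the margin between 2 and the sharp value 1/4 is wide enough for an
  explicit bump. At the edges of the support the second derivative is positive and dominates, so
  after division by the exponential a polynomial inequality in \<open>d = 1 - (z / 20)\<^sup>2\<close> is left.\<close>

lemma profile_subsolution: "4 * profile'' M s + 2 * profile' M s \<ge> - 2 * profile M s"
proof -
  define z where "z = s + M"
  define d where "d = 1 - (z / 20)\<^sup>2"
  have dz: "d = 1 - z\<^sup>2 / 400" by (simp add: d_def power_divide)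
  note u = profile_def profile'_def profile''_def d_def[symmetric] z_def[symmetric]
  show ?thesis
  proof (cases "d \<le> 0")
    case True
    then show ?thesis unfolding u by (simp add: flat_exp_def)
  next
    case False
    then have d: "d > 0" by simp
    have z2: "z\<^sup>2 = 400 * (1 - d)" by (simp add: dz)
    then have "z\<^sup>2 \<le> 20\<^sup>2" using d by simp
    then have z: "\<bar>z\<bar> \<le> 20" using abs_le_square_iff[of z 20] by simp
    define e where "e = exp (- inverse d)"
    have e: "e > 0" by (simp add: e_def)
    have f: "flat_exp k d = e / d ^ k" for k using d by (simp add: flat_exp_def e_def divide_inverse power_inverse)
    have A: "0 \<le> 2 * d ^ 4 - 14 / 100 * d\<^sup>2 - 12 / 100 * d + 4 / 100"
    proof -
      \<comment> \<open>The quartic is nearly tight around d = 3/10, hence the square of d^2 - 9/100.\<close>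
      have "2 * d ^ 4 - 14 / 100 * d\<^sup>2 - 12 / 100 * d + 4 / 100
          = 2 * (d\<^sup>2 - 9 / 100)\<^sup>2 + 22 / 100 * (d - 3 / 11)\<^sup>2 + (4 / 100 - 162 / 10000 - 22 / 100 * (3 / 11)\<^sup>2)"
        by (simp add: power2_eq_square power4_eq_xxxx algebra_simps)
      then show ?thesis by (simp add: power2_eq_square)
    qed
    have B: "z * d\<^sup>2 \<le> 20 * d\<^sup>2" using z by (intro mult_right_mono) auto
    have "0 \<le> (2 * d ^ 4 - 14 / 100 * d\<^sup>2 - 12 / 100 * d + 4 / 100) + (20 * d\<^sup>2 - z * d\<^sup>2) / 100"
      by (rule add_nonneg_nonneg[OF A divide_nonneg_nonneg]) (use B in simp_all)
    also have "\<dots> = 4 * ((1 - 2 * d) * (1 - d) / 100 - d\<^sup>2 / 200) - 2 * (z / 200) * d\<^sup>2 + 2 * d ^ 4"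
      by (simp add: power2_eq_square field_simps)
    finally have "0 \<le> e / d ^ 4 * (4 * ((1 - 2 * d) * (1 - d) / 100 - d\<^sup>2 / 200) - 2 * (z / 200) * d\<^sup>2 + 2 * d ^ 4)"
      by (rule mult_nonneg_nonneg[rotated]) (use e d in simp)
    also have "\<dots> = 4 * ((e / d ^ 4 - 2 * (e / d ^ 3)) * ((1 - d) / 100) - e / d\<^sup>2 / 200) + 2 * (- (e / d\<^sup>2) * (z / 200)) + 2 * e"
      using d by (simp add: field_simps power2_eq_square power3_eq_cube power4_eq_xxxx)
    also have "(1 - d) / 100 = (z / 200)\<^sup>2" using z2 by (simp add: power_divide)
    finally show ?thesis unfolding u f by simp
  qed
qed

definition cutoff :: "real \<Rightarrow> real^3 \<Rightarrow> real" where
  "cutoff M x = profile M (ln (x \<bullet> x))"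

lemma radial_cutoff: "radial (cutoff M)"
  by (simp add: radial_def cutoff_def dot_square_norm)

lemma profile_eq_0: "\<bar>s + M\<bar> \<ge> 20 \<Longrightarrow> profile M s = 0"
  using abs_le_square_iff[of 20 "s + M"] by (simp add: profile_def flat_exp_def power_divide)

lemma cutoff_nonneg: "0 \<le> cutoff M x"
  by (simp add: cutoff_def profile_def flat_exp_0_bounds)

lemma cutoff_support:
  assumes M: "M > 20" and n: "cutoff M x \<noteq> 0"
  shows "x \<noteq> 0" "exp (- M - 20) \<le> x \<bullet> x" "x \<bullet> x \<le> exp (- M + 20)"
proof -
  have s: "\<bar>ln (x \<bullet> x) + M\<bar> < 20" using n profile_eq_0[of "ln (x \<bullet> x)" M] unfolding cutoff_def by fastforce
  show x: "x \<noteq> 0"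
  proof
    assume "x = 0"
    then show False using s M by simp
  qed
  then have t: "x \<bullet> x > 0" by simp
  show "exp (- M - 20) \<le> x \<bullet> x" using s t by (simp add: ln_ge_iff[symmetric])
  show "x \<bullet> x \<le> exp (- M + 20)" using s t exp_le_cancel_iff[of "ln (x \<bullet> x)" "- M + 20"] by simp
qed

lemma cutoff_Cc:
  assumes M: "M > 20"
  shows "cutoff M \<in> Cc_infty (B1 - {0}) UNIV"
proof (rule Cc_inftyI[OF open_punctured])
  let ?K = "{x :: real^3. exp (- M - 20) \<le> x \<bullet> x} \<inter> {x. x \<bullet> x \<le> exp (- M + 20)}"
  have lt: "exp (- M + 20) < 1" using M by simp
  have sub: "?K \<subseteq> B1 - {0}"
  proof
    fix x assume x: "x \<in> ?K"
    then have "x \<bullet> x \<le> exp (- M + 20)" by blast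
    with lt have "x \<bullet> x < 1" by linarith
    then have "(norm x)\<^sup>2 < 1\<^sup>2" by (simp add: power2_norm_eq_inner)
    then have "norm x < 1" by (rule power2_less_imp_less) simp
    moreover have "x \<noteq> 0" using x by (auto simp: not_le)
    ultimately show "x \<in> B1 - {0}" by simp
  qed
  have "closed ?K"
    by (intro closed_Int closed_Collect_le continuous_intros)
  moreover have "bounded ?K" using sub bounded_subset[OF bounded_ball] by blast
  ultimately show "compact ?K" by (simp add: compact_eq_bounded_closed)
  show "?K \<subseteq> B1 - {0}" "?K \<subseteq> - {0}" using sub by auto
  show "cutoff M x = 0" if "x \<notin> ?K" for x
    using cutoff_support[OF M, of x] that by auto
  show "smooth_on (- {0}) (cutoff M)"
    unfolding cutoff_def[abs_def] profile_def by (intro smooth_intros open_punctured) auto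
qed auto

lemma partial_radial_ln:
  assumes x: "x \<noteq> 0" and F: "(F has_real_derivative F') (at (ln (x \<bullet> x)))"
  shows "((\<lambda>x. F (ln (x \<bullet> x))) has_derivative (\<lambda>h. (2 * (x \<bullet> h) * inverse (x \<bullet> x)) * F')) (at x)"
    "partial i (\<lambda>x. F (ln (x \<bullet> x))) x = F' * (2 * x $ i / (x \<bullet> x))"
proof -
  have "((\<lambda>x. ln (x \<bullet> x)) has_derivative (\<lambda>h. (x \<bullet> h + h \<bullet> x) * inverse (x \<bullet> x))) (at x)"
    using x by (intro has_derivative_ln has_derivative_inner has_derivative_ident) auto
  from DERIV_compose_FDERIV[OF F this]
  show d: "((\<lambda>x. F (ln (x \<bullet> x))) has_derivative (\<lambda>h. (2 * (x \<bullet> h) * inverse (x \<bullet> x)) * F')) (at x)"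
    by (simp add: inner_commute)
  show "partial i (\<lambda>x. F (ln (x \<bullet> x))) x = F' * (2 * x $ i / (x \<bullet> x))"
    by (rule partial_eqI[OF d]) (simp add: inner_axis divide_inverse)
qed

lemma partial_cutoff:
  assumes "x \<noteq> 0"
  shows "partial i (cutoff M) x = profile' M (ln (x \<bullet> x)) * (2 * x $ i / (x \<bullet> x))"
  unfolding cutoff_def[abs_def] by (rule partial_radial_ln(2)[OF assms DERIV_profile])

lemma cutoff_laplacian:
  assumes x: "x \<noteq> 0"
  shows "laplacian (cutoff M) x = (4 * profile'' M (ln (x \<bullet> x)) + 2 * profile' M (ln (x \<bullet> x))) / (x \<bullet> x)"
proof -
  define t where "t = x \<bullet> x"
  have t: "t > 0" using x by (simp add: t_def)
  let ?a = "\<lambda>y. profile' M (ln (y \<bullet> y))"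
  have "partial i (partial i (cutoff M)) x = 4 * profile'' M (ln t) * (x $ i)\<^sup>2 / t\<^sup>2 + 2 * profile' M (ln t) / t - 4 * profile' M (ln t) * (x $ i)\<^sup>2 / t\<^sup>2" for i
  proof -
    have t': "((\<lambda>x. inverse (x \<bullet> x)) has_derivative (\<lambda>h. - (inverse (x \<bullet> x) * (x \<bullet> h + h \<bullet> x) * inverse (x \<bullet> x)))) (at x)"
      using x by (intro Deriv.has_derivative_inverse has_derivative_inner has_derivative_ident) auto
    note d = has_derivative_mult[OF partial_radial_ln(1)[OF x DERIV_profile']
        has_derivative_mult[OF has_derivative_mult_right[OF bounded_linear_imp_has_derivative[OF bounded_linear_vec_nth], of 2] t']]
    have "partial i (partial i (cutoff M)) x = partial i (\<lambda>y. ?a y * (2 * y $ i * inverse (y \<bullet> y))) x"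
    proof (rule partial_cong[OF open_punctured])
      show "(\<lambda>y. ?a y * (2 * y $ i * inverse (y \<bullet> y))) differentiable at x" using d[of M i] unfolding differentiable_def by blast
    qed (use x in \<open>auto simp: partial_cutoff divide_inverse\<close>)
    also have "\<dots> = 4 * profile'' M (ln t) * (x $ i)\<^sup>2 / t\<^sup>2 + 2 * profile' M (ln t) / t - 4 * profile' M (ln t) * (x $ i)\<^sup>2 / t\<^sup>2"
      by (rule partial_eqI[OF d])
         (use t in \<open>simp add: t_def[symmetric] inner_axis inner_axis' field_simps power2_eq_square\<close>)
    finally show ?thesis .
  qed
  then have "laplacian (cutoff M) x
     = 4 * profile'' M (ln t) * (\<Sum>i\<in>UNIV. (x $ i)\<^sup>2) / t\<^sup>2 + 6 * profile' M (ln t) / t - 4 * profile' M (ln t) * (\<Sum>i\<in>UNIV. (x $ i)\<^sup>2) / t\<^sup>2"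
    by (simp add: sum.distrib sum_subtractf sum_divide_distrib[symmetric] sum_distrib_left[symmetric])
  also have "\<dots> = (4 * profile'' M (ln t) + 2 * profile' M (ln t)) / t"
    unfolding inner_self_sum[symmetric] t_def[symmetric] using t by (simp add: field_simps power2_eq_square)
  finally show ?thesis by (simp only: t_def)
qed

text \<open>After integration by parts the left-hand side becomes the Dirichlet energy of the cut-off, while the
  right-hand side is twice its Hardy integral.\<close>

lemma cutoff_hardy:
  assumes x: "x \<noteq> 0"
  shows "- (cutoff M x * laplacian (cutoff M) x) \<le> 2 * (cutoff M x)\<^sup>2 / (x \<bullet> x)"
proof -
  have "- (4 * profile'' M (ln (x \<bullet> x)) + 2 * profile' M (ln (x \<bullet> x))) \<le> 2 * cutoff M x"
    using profile_subsolution[of M "ln (x \<bullet> x)"] by (simp add: cutoff_def)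
  from mult_left_mono[OF this cutoff_nonneg[of M x]]
  have "- (cutoff M x * (4 * profile'' M (ln (x \<bullet> x)) + 2 * profile' M (ln (x \<bullet> x)))) \<le> 2 * (cutoff M x)\<^sup>2"
    by (simp add: power2_eq_square algebra_simps)
  from divide_right_mono[OF this, of "x \<bullet> x"] show ?thesis
    unfolding cutoff_laplacian[OF x] by simp
qed

section \<open>The tangential variation\<close>

lemma S0_add_scaleR:
  assumes "A \<in> S0" "B \<in> S0"
  shows "c *\<^sub>R A + d *\<^sub>R B \<in> S0"
proof -
  have "transpose (c *\<^sub>R A + d *\<^sub>R B) = c *\<^sub>R transpose A + d *\<^sub>R transpose B"
    by (simp add: transpose_def vec_eq_iff)
  then show ?thesis
    using assms unfolding S0_def
    by (simp add: linear_add[OF bounded_linear.linear[OF bounded_linear_trace]] linear_scale[OF bounded_linear.linear[OF bounded_linear_trace]])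
qed

lemma zero_in_S0: "0 \<in> S0"
  using linear_0[OF bounded_linear.linear[OF bounded_linear_trace]] by (simp add: S0_def transpose_def vec_eq_iff)

lemma zero_Cc_infty: "(\<lambda>x. 0) \<in> Cc_infty B1 S0"
  by (rule Cc_inftyI[of UNIV "{}"]) (auto intro: smooth_intros zero_in_S0)

lemma S0_scaleR: "A \<in> S0 \<Longrightarrow> c *\<^sub>R A \<in> S0"
  using S0_add_scaleR[of A 0 c 0] zero_in_S0 by simp

lemma Cc_punctured_at_0: "f \<in> Cc_infty (B1 - {0}) V \<Longrightarrow> f 0 = 0"
  using Cc_inftyD(3)[of f "B1 - {0}" V 0] by simp

lemma scaleR_const_Cc:
  assumes "\<xi> \<in> Cc_infty (B1 - {0}) (UNIV :: real set)" "v \<in> S0"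
  shows "(\<lambda>x. \<xi> x *\<^sub>R v) \<in> Cc_infty (B1 - {0}) S0"
  by (rule Cc_infty_transfer[OF assms(1) open_UNIV])
     (auto intro!: smooth_intros Cc_infty_smooth_on[OF assms(1)] S0_scaleR assms(2))

lemma scaleR_Hbar_Cc:
  assumes "f \<in> Cc_infty (B1 - {0}) (UNIV :: real set)"
  shows "(\<lambda>x. f x *\<^sub>R Hbar x) \<in> Cc_infty (B1 - {0}) S0"
proof (rule Cc_infty_transfer[OF assms open_punctured])
  show "f x *\<^sub>R Hbar x \<in> S0" for x
    using Cc_punctured_at_0[OF assms] by (cases "x = 0") (auto simp: zero_in_S0 intro: S0_scaleR Hbar_in_S0)
qed (auto intro!: smooth_intros open_punctured Cc_infty_smooth_on[OF assms])

lemma tangential_part_eq: "tangential_part (\<lambda>x. \<xi> x *\<^sub>R v) x = \<xi> x *\<^sub>R (v - (Hbar x \<bullet> v) *\<^sub>R Hbar x)"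
  by (simp add: tangential_part_def scaleR_diff_right)

lemma tangential_part_Cc:
  assumes \<xi>: "\<xi> \<in> Cc_infty (B1 - {0}) (UNIV :: real set)" and v: "v \<in> S0"
  shows "tangential_part (\<lambda>x. \<xi> x *\<^sub>R v) \<in> Cc_infty (B1 - {0}) S0"
proof (rule Cc_infty_transfer[OF \<xi> open_punctured])
  show "smooth_on (- {0}) (tangential_part (\<lambda>x. \<xi> x *\<^sub>R v))"
    unfolding tangential_part_eq[abs_def] by (intro smooth_intros open_punctured Cc_infty_smooth_on[OF \<xi>])
  show "tangential_part (\<lambda>x. \<xi> x *\<^sub>R v) x \<in> S0" for x
  proof (cases "x = 0")
    case True
    then show ?thesis using Cc_punctured_at_0[OF \<xi>] by (simp add: tangential_part_eq zero_in_S0)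
  next
    case False
    from S0_add_scaleR[OF v Hbar_in_S0[OF False], of "\<xi> x" "- \<xi> x * (Hbar x \<bullet> v)"]
    show ?thesis by (simp add: tangential_part_eq scaleR_diff_right)
  qed
qed (auto simp: tangential_part_eq)

lemma Hbar_inner_tangential: "x \<noteq> 0 \<Longrightarrow> Hbar x \<bullet> tangential_part \<Phi> x = 0"
  by (simp add: tangential_part_def inner_diff_right inner_Hbar_Hbar)

lemma norm_tangential_sq:
  assumes "x \<noteq> 0" "v \<in> S4"
  shows "(norm (tangential_part (\<lambda>x. \<xi> x *\<^sub>R v) x))\<^sup>2 = (\<xi> x)\<^sup>2 * (1 - (Hbar x \<bullet> v)\<^sup>2)"
proof -
  have "v \<bullet> v = 1" using assms(2) by (simp add: S4_def norm_eq_1)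
  then have "(v - (Hbar x \<bullet> v) *\<^sub>R Hbar x) \<bullet> (v - (Hbar x \<bullet> v) *\<^sub>R Hbar x) = 1 - (Hbar x \<bullet> v)\<^sup>2"
    using inner_Hbar_Hbar[OF assms(1)] inner_commute[of v "Hbar x"]
    by (simp add: inner_diff_left inner_diff_right power2_eq_square)
  then show ?thesis
    unfolding tangential_part_eq norm_scaleR power_mult_distrib power2_norm_eq_inner by simp
qed

lemma partial_tangential:
  assumes \<xi>: "\<xi> \<in> Cc_infty (B1 - {0}) (UNIV :: real set)" and x: "x \<noteq> 0"
  shows "partial i (tangential_part (\<lambda>x. \<xi> x *\<^sub>R v)) x
    = partial i \<xi> x *\<^sub>R (v - (Hbar x \<bullet> v) *\<^sub>R Hbar x)
      - \<xi> x *\<^sub>R ((dHbar i x \<bullet> v) *\<^sub>R Hbar x + (Hbar x \<bullet> v) *\<^sub>R dHbar i x)"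
proof -
  have H: "(Hbar has_derivative frechet_derivative Hbar (at x)) (at x)"
    and X: "(\<xi> has_derivative frechet_derivative \<xi> (at x)) (at x)"
    using smooth_on_differentiable[OF smooth_on_Hbar, of x] smooth_on_differentiable[OF Cc_infty_smooth_on[OF \<xi>], of x UNIV] x
    by (auto simp: frechet_derivative_works)
  have dH: "frechet_derivative Hbar (at x) (axis i 1) = dHbar i x"
    using partial_Hbar[OF x, of i] by (simp add: partial_def)
  note d = has_derivative_scaleR[OF X has_derivative_diff[OF has_derivative_const[of v]
        has_derivative_scaleR[OF has_derivative_inner_left[OF H, of v] H]]]
  show ?thesis
    unfolding tangential_part_eq[abs_def]
    by (rule partial_eqI[OF d]) (simp add: dH partial_def algebra_simps)
qed

text \<open>Expanding the square, one uses that \<open>v - (Hbar \<bullet> v) Hbar\<close> is orthogonal to \<open>Hbar\<close>, and that the terms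
  which mix \<open>\<nabla>\<xi>\<close> with derivatives of \<open>Hbar\<close> add up to a radial derivative of \<open>Hbar\<close>, hence to zero.\<close>

lemma sum_norm_partial_tangential:
  assumes \<xi>: "\<xi> \<in> Cc_infty (B1 - {0}) (UNIV :: real set)" and r: "radial \<xi>" and v: "v \<in> S4" and x: "x \<noteq> 0"
  shows "(\<Sum>i\<in>UNIV. (norm (partial i (tangential_part (\<lambda>x. \<xi> x *\<^sub>R v)) x))\<^sup>2)
    = (\<Sum>i\<in>UNIV. (partial i \<xi> x)\<^sup>2) * (1 - (Hbar x \<bullet> v)\<^sup>2)
      + (\<xi> x)\<^sup>2 * ((\<Sum>i\<in>UNIV. (dHbar i x \<bullet> v)\<^sup>2) + (Hbar x \<bullet> v)\<^sup>2 * (6 / (x \<bullet> x)))"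
proof -
  have v0: "v \<in> S0" and vv: "v \<bullet> v = 1" using v by (auto simp: S4_def norm_eq_1)
  define a where "a = Hbar x \<bullet> v"
  obtain m where m: "\<And>i. partial i \<xi> x = m * x $ i" using radial_gradient_parallel[OF \<xi> r] by blast
  have HH: "Hbar x \<bullet> Hbar x = 1" "Hbar x \<bullet> dHbar i x = 0" "dHbar i x \<bullet> Hbar x = 0" "v \<bullet> Hbar x = a" for i
    using inner_Hbar_Hbar[OF x] Hbar_inner_dHbar[OF x, of i] by (auto simp: inner_commute a_def)
  have "(norm (partial i (tangential_part (\<lambda>x. \<xi> x *\<^sub>R v)) x))\<^sup>2
     = (partial i \<xi> x)\<^sup>2 * (1 - a\<^sup>2) + (\<xi> x)\<^sup>2 * (dHbar i x \<bullet> v)\<^sup>2 + (\<xi> x)\<^sup>2 * a\<^sup>2 * (norm (dHbar i x))\<^sup>2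
       - (2 * \<xi> x * a * m) * (x $ i * (dHbar i x \<bullet> v))" for i
  proof -
    define c b X D where cb: "c = m * x $ i" "b = dHbar i x \<bullet> v" "X = \<xi> x" "D = dHbar i x \<bullet> dHbar i x"
    have vd: "v \<bullet> dHbar i x = b" by (simp add: cb inner_commute)
    show ?thesis
      unfolding partial_tangential[OF \<xi> x] power2_norm_eq_inner m a_def[symmetric] cb[symmetric]
      unfolding inner_diff_left inner_diff_right inner_add_left inner_add_right inner_scaleR_left inner_scaleR_right
        HH vd vv a_def[symmetric] cb[symmetric]
      by (simp add: cb(1) power2_eq_square algebra_simps)
  qed
  then have "(\<Sum>i\<in>UNIV. (norm (partial i (tangential_part (\<lambda>x. \<xi> x *\<^sub>R v)) x))\<^sup>2)
     = (\<Sum>i\<in>UNIV. (partial i \<xi> x)\<^sup>2) * (1 - a\<^sup>2) + (\<xi> x)\<^sup>2 * (\<Sum>i\<in>UNIV. (dHbar i x \<bullet> v)\<^sup>2) + (\<xi> x)\<^sup>2 * a\<^sup>2 * (\<Sum>i\<in>UNIV. (norm (dHbar i x))\<^sup>2)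
       - (2 * \<xi> x * a * m) * (\<Sum>i\<in>UNIV. x $ i * (dHbar i x \<bullet> v))"
    by (simp only: sum.distrib sum_subtractf sum_distrib_left sum_distrib_right)
  then show ?thesis
    by (simp add: sum_norm_dHbar[OF x] sum_coord_dHbar_inner_matrix[OF v0 x] a_def algebra_simps)
qed

text \<open>Without the middle term, this is the density of the second variation of the Dirichlet energy of
  sphere-valued maps at \<open>Hbar\<close>. The middle term leaves room for all contributions of the bulk
  potential: \<open>3 lam |\<Psi>|\<^sup>2\<close> for its second derivative and \<open>lam |\<Psi>|\<^sup>2\<close> for its first derivative in the equation
  that determines the multiplier.\<close>

definition limit_density :: "real \<Rightarrow> (real^3 \<Rightarrow> real^3^3) \<Rightarrow> real^3 \<Rightarrow> real" where
  "limit_density lam \<Psi> x = (\<Sum>i\<in>UNIV. (norm (partial i \<Psi> x))\<^sup>2) + 4 * lam * (norm (\<Psi> x))\<^sup>2 - 6 * (norm (\<Psi> x))\<^sup>2 / (x \<bullet> x)"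

text \<open>The dependence on \<open>v\<close> is collected in the two quotients whose spherical means are known.\<close>

lemma limit_density_tangential:
  assumes \<xi>: "\<xi> \<in> Cc_infty (B1 - {0}) (UNIV :: real set)" and r: "radial \<xi>" and v: "v \<in> S4" and x: "x \<noteq> 0"
  shows "limit_density lam (tangential_part (\<lambda>x. \<xi> x *\<^sub>R v)) x
    = ((\<Sum>i\<in>UNIV. (partial i \<xi> x)\<^sup>2) + 4 * lam * (\<xi> x)\<^sup>2) * (1 - 3 / 2 * ((x \<bullet> (v *v x))\<^sup>2 / (x \<bullet> x)\<^sup>2))
      + (\<xi> x)\<^sup>2 / (x \<bullet> x) * (6 * (((v *v x) \<bullet> (v *v x)) / (x \<bullet> x)) + 12 * ((x \<bullet> (v *v x))\<^sup>2 / (x \<bullet> x)\<^sup>2) - 6)"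
proof -
  have v0: "v \<in> S0" using v by (auto simp: S4_def)
  define t where "t = x \<bullet> x"
  define q where "q = x \<bullet> (v *v x)"
  have t: "t \<noteq> 0" using x by (simp add: t_def)
  have a: "(Hbar x \<bullet> v)\<^sup>2 = 3 / 2 * (q\<^sup>2 / t\<^sup>2)"
    unfolding Hbar_inner_matrix[OF v0] by (simp add: power_divide power_mult_distrib t_def q_def)
  show ?thesis
    unfolding limit_density_def sum_norm_partial_tangential[OF \<xi> r v x] norm_tangential_sq[OF x v] a
      sum_dHbar_inner_matrix_sq[OF v0 x] t_def[symmetric] q_def[symmetric]
    using t by (simp add: field_simps power2_eq_square power3_eq_cube)
qed

text \<open>The set where \<open>f\<close> is positive is open and nonempty, hence not a null set.\<close>

lemma integral_Cc_pos:
  fixes f :: "real^3 \<Rightarrow> real"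
  assumes f: "f \<in> Cc_infty B1 UNIV" and n: "\<And>x. f x \<ge> 0" and p: "f x0 > 0"
  shows "(LINT x|leb. f x) > 0"
proof (rule ccontr)
  assume "\<not> ?thesis"
  moreover have "0 \<le> (LINT x|lborel. f x)" by (simp add: n)
  ultimately have z: "(LINT x|lborel. f x) = 0" using integral_B1_Cc(2)[OF f] by linarith
  have o: "open {x. f x > 0}"
    using smooth_on_continuous[OF Cc_infty_smooth_on[OF f, of UNIV]] by (intro open_Collect_less) auto
  have "AE x in lborel. f x = 0"
    using integral_nonneg_eq_0_iff_AE[OF Cc_infty_integrable_lborel[OF f]] n z by simp
  then have "AE x in lebesgue. f x = 0" by (rule AE_completion)
  then have "AE x in lebesgue. x \<notin> {x. f x > 0}" by eventually_elim simp
  then have "{x. f x > 0} \<in> null_sets lebesgue"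
    using o by (subst AE_iff_null_sets) auto
  then have "negligible {x. f x > 0}" by (simp add: negligible_iff_null_sets)
  then show False using open_not_negligible[OF o] p by blast
qed

text \<open>Integrate the derivatives of \<open>f \<partial>\<^sub>i f\<close>.\<close>

lemma integral_gradient_sq:
  assumes f: "f \<in> Cc_infty B1 (UNIV :: real set)"
  shows "(LINT x|leb. (\<Sum>i\<in>UNIV. (partial i f x)\<^sup>2)) = (LINT x|leb. - (f x * laplacian f x))"
proof -
  have F: "(\<lambda>x. f x * partial i f x) \<in> Cc_infty B1 UNIV" for i
    by (rule Cc_infty_bilinear[OF f open_UNIV _ smooth_on_partial[OF Cc_infty_smooth_on[OF f]] bounded_bilinear_mult]) simp
  have G: "(\<lambda>x. f x * partial i (partial i f) x) \<in> Cc_infty B1 UNIV" for i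
    by (rule Cc_infty_bilinear[OF f open_UNIV _ smooth_on_partial[OF smooth_on_partial[OF Cc_infty_smooth_on[OF f]]] bounded_bilinear_mult]) simp
  have S: "(\<lambda>x. (partial i f x)\<^sup>2) \<in> Cc_infty B1 UNIV" for i
    by (rule Cc_infty_transfer[OF partial_Cc_infty[OF f, of i] open_UNIV]) (auto intro!: smooth_intros smooth_on_partial Cc_infty_smooth_on[OF f])
  have dd: "f differentiable at x" "partial i f differentiable at x" for i x
    by (auto intro!: smooth_on_differentiable[of UNIV] smooth_on_partial Cc_infty_smooth_on[OF f])
  have "(LINT x|leb. f x * partial i (partial i f) x + (partial i f x)\<^sup>2) = 0" for i
    using integral_partial_eq_0[OF F, of i i] by (simp add: partial_mult dd power2_eq_square)
  then have "(LINT x|leb. (partial i f x)\<^sup>2) = - (LINT x|leb. f x * partial i (partial i f) x)" for i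
    using Bochner_Integration.integral_add[OF integral_B1_Cc(1)[OF G] integral_B1_Cc(1)[OF S], of i i] by simp
  then show ?thesis
    using integral_B1_Cc(1)[OF S] integral_B1_Cc(1)[OF G]
    by (simp add: sum_distrib_left sum_negf)
qed

lemma limit_density_Cc:
  assumes \<Psi>: "\<Psi> \<in> Cc_infty (B1 - {0}) V"
  shows "limit_density lam \<Psi> \<in> Cc_infty (B1 - {0}) UNIV"
proof -
  have "(\<lambda>x. (norm (\<Psi> x))\<^sup>2 * (4 * lam - 6 / (x \<bullet> x))) \<in> Cc_infty (B1 - {0}) UNIV"
    unfolding power2_norm_eq_inner
    by (rule Cc_infty_transfer[OF \<Psi> open_punctured]) (auto intro!: smooth_intros open_punctured Cc_infty_smooth_on[OF \<Psi>])
  note A = this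
  have B: "(\<lambda>x. (norm (partial i \<Psi> x))\<^sup>2) \<in> Cc_infty (B1 - {0}) UNIV" for i
    unfolding power2_norm_eq_inner
    by (rule Cc_infty_transfer[OF partial_Cc_infty[OF \<Psi>, of i] open_UNIV]) (auto intro!: smooth_intros smooth_on_partial Cc_infty_smooth_on[OF \<Psi>])
  let ?K = "closure {x. \<Psi> x \<noteq> 0}"
  show ?thesis
  proof (rule Cc_inftyI[OF open_punctured])
    show "compact ?K" "?K \<subseteq> B1 - {0}" "?K \<subseteq> - {0}" using Cc_inftyD(4,5)[OF \<Psi>] by auto
    show "limit_density lam \<Psi> x = 0" if "x \<notin> ?K" for x
    proof -
      have "\<Psi> x = 0" using that closure_subset[of "{x. \<Psi> x \<noteq> 0}"] by blast
      moreover have "partial i \<Psi> x = 0" for i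
        by (rule partial_eq_0_open[of "- ?K"])
           (use that closure_subset[of "{x. \<Psi> x \<noteq> 0}"] in \<open>auto simp: open_Compl\<close>)
      ultimately show ?thesis by (simp add: limit_density_def)
    qed
    have "limit_density lam \<Psi> = (\<lambda>x. (\<Sum>i\<in>UNIV. (norm (partial i \<Psi> x))\<^sup>2) + (norm (\<Psi> x))\<^sup>2 * (4 * lam - 6 / (x \<bullet> x)))"
      by (simp add: limit_density_def fun_eq_iff algebra_simps)
    then show "smooth_on (- {0}) (limit_density lam \<Psi>)"
      using Cc_infty_smooth_on[OF A] Cc_infty_smooth_on[OF B] by (simp add: smooth_on_add smooth_on_sum open_punctured)
  qed auto
qed

lemma partial_cutoff_sq_radial: "radial (\<lambda>x. \<Sum>i\<in>UNIV. (partial i (cutoff M) x)\<^sup>2)" if M: "M > 20"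
proof -
  have "(\<Sum>i\<in>UNIV. (partial i (cutoff M) x)\<^sup>2) = (profile' M (ln (x \<bullet> x)))\<^sup>2 * (4 / (x \<bullet> x))" for x
  proof (cases "x = 0")
    case True
    then show ?thesis using Cc_punctured_at_0[OF partial_Cc_infty[OF cutoff_Cc[OF M]]] by simp
  next
    case False
    have "(\<Sum>i\<in>UNIV. (partial i (cutoff M) x)\<^sup>2) = (profile' M (ln (x \<bullet> x)))\<^sup>2 * 4 / (x \<bullet> x)\<^sup>2 * (\<Sum>i\<in>UNIV. (x $ i)\<^sup>2)"
      unfolding partial_cutoff[OF False] by (simp add: sum_distrib_left power_mult_distrib power_divide mult.assoc)
    then show ?thesis using False unfolding inner_self_sum[symmetric] by (simp add: power2_eq_square)
  qed
  then show ?thesis using radial_square[of "\<lambda>t. (profile' M (ln t))\<^sup>2 * (4 / t)"] by (simp only:)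
qed

text \<open>Inserting the spherical means 1/3 and 2/15 gives
  \<open>4/5 \<integral> |\<nabla>\<xi>|\<^sup>2 + 4 lam \<xi>\<^sup>2 - 3 \<xi>\<^sup>2 / |x|\<^sup>2\<close>. The gradient term is at most 2, and, as the support lies close
  to the origin, the term with \<open>lam\<close> at most 1/2 times the integral of \<open>\<xi>\<^sup>2 / |x|\<^sup>2\<close>.\<close>

lemma limit_density_negative:
  assumes lam: "lam > 0" and M: "M > 20" "4 * lam * exp (- M + 20) \<le> 1 / 2" and v: "v \<in> S4"
  shows "(LINT x|leb. limit_density lam (tangential_part (\<lambda>x. cutoff M x *\<^sub>R v)) x) < 0"
proof -
  let ?\<xi> = "cutoff M"
  note C = cutoff_Cc[OF M(1)] and r = radial_cutoff[of M]
  note sC = Cc_infty_smooth_on[OF C]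
  define G1 where "G1 x = (\<Sum>i\<in>UNIV. (partial i ?\<xi> x)\<^sup>2) + 4 * lam * (?\<xi> x)\<^sup>2" for x
  define G0 where "G0 x = (\<Sum>i\<in>UNIV. (partial i ?\<xi> x)\<^sup>2)" for x
  define G2 where "G2 x = (?\<xi> x)\<^sup>2 * inverse (x \<bullet> x)" for x
  define P where "P x = ((v *v x) \<bullet> (v *v x)) / (x \<bullet> x)" for x
  define Q where "Q x = (x \<bullet> (v *v x))\<^sup>2 / (x \<bullet> x)\<^sup>2" for x
  define K where "K = closure {x. ?\<xi> x \<noteq> 0}"
  have K: "compact K" "K \<subseteq> B1 - {0}" "K \<subseteq> - {0}" "closed K"
    using Cc_inftyD(4,5)[OF C] unfolding K_def by auto
  have x0: "?\<xi> x = 0" if "x \<notin> K" for x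
    using that closure_subset[of "{x. ?\<xi> x \<noteq> 0}"] unfolding K_def by blast
  have p0: "partial i ?\<xi> x = 0" if "x \<notin> K" for i x
    by (rule partial_eq_0_open[of "- K"]) (use that x0 K(4) in \<open>auto simp: open_Compl\<close>)
  have CK: "f \<in> Cc_infty (B1 - {0}) UNIV"
    if "smooth_on (- {0}) f" "\<And>x. x \<notin> K \<Longrightarrow> f x = 0" for f :: "real^3 \<Rightarrow> real"
    by (rule Cc_inftyI[OF open_punctured K(1,3,2) that(2,1)]) auto
  have cc: "G1 \<in> Cc_infty (B1 - {0}) UNIV" "G0 \<in> Cc_infty (B1 - {0}) UNIV" "G2 \<in> Cc_infty (B1 - {0}) UNIV"
    unfolding G1_def[abs_def] G0_def[abs_def] G2_def[abs_def]
    by (rule CK, intro smooth_intros open_punctured smooth_on_partial sC, auto simp: p0 x0)+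
  have rad: "radial G1" "radial G2"
  proof -
    show "radial G1" unfolding radial_def
    proof (intro allI impI)
      fix x y :: "real^3" assume e: "norm x = norm y"
      then have "(\<Sum>i\<in>UNIV. (partial i ?\<xi> x)\<^sup>2) = (\<Sum>i\<in>UNIV. (partial i ?\<xi> y)\<^sup>2)" "?\<xi> x = ?\<xi> y"
        using partial_cutoff_sq_radial[OF M(1)] r unfolding radial_def by blast+
      then show "G1 x = G1 y" by (simp only: G1_def)
    qed
    have "radial (\<lambda>x. (?\<xi> x)\<^sup>2)" unfolding power2_eq_square by (rule radial_mult[OF r r])
    from radial_mult[OF this radial_square] show "radial G2" unfolding G2_def[abs_def] .
  qed
  have smP: "smooth_on (- {0}) P" "smooth_on (- {0}) Q" unfolding P_def[abs_def] Q_def[abs_def]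
    by (intro smooth_on_divide smooth_intros open_punctured smooth_on_matrix_vector, auto)+
  note I = Cc_punctured_integrable[OF cc(1)] Cc_punctured_integrable[OF cc(2)] Cc_punctured_integrable[OF cc(3)]
    Cc_punctured_integrable[OF Cc_mult_smooth[OF cc(1) smP(2)]] Cc_punctured_integrable[OF Cc_mult_smooth[OF cc(3) smP(1)]]
    Cc_punctured_integrable[OF Cc_mult_smooth[OF cc(3) smP(2)]]
  have eq: "limit_density lam (tangential_part (\<lambda>x. ?\<xi> x *\<^sub>R v)) x
      = G1 x - 3 / 2 * (G1 x * Q x) + 6 * (G2 x * P x) + 12 * (G2 x * Q x) - 6 * G2 x" for x
  proof (cases "x = 0")
    case True
    have v0: "v \<in> S0" using v by (simp add: S4_def)
    have "limit_density lam (tangential_part (\<lambda>x. ?\<xi> x *\<^sub>R v)) 0 = 0"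
      by (rule Cc_punctured_at_0[OF limit_density_Cc[OF tangential_part_Cc[OF C v0]]])
    moreover have "G1 0 = 0" "G2 0 = 0" by (rule Cc_punctured_at_0[OF cc(1)], rule Cc_punctured_at_0[OF cc(3)])
    ultimately show ?thesis unfolding True by simp
  next
    case False
    have G2: "(?\<xi> x)\<^sup>2 / (x \<bullet> x) = G2 x" unfolding G2_def by (rule divide_inverse)
    show ?thesis
      unfolding limit_density_tangential[OF C r v False] G1_def[symmetric] P_def[symmetric] Q_def[symmetric] G2
      by (simp add: algebra_simps)
  qed
  have mom: "(LINT x|leb. G1 x * Q x) = 2 / 15 * (LINT x|leb. G1 x)"
    "(LINT x|leb. G2 x * P x) = (LINT x|leb. G2 x) / 3"
    "(LINT x|leb. G2 x * Q x) = 2 / 15 * (LINT x|leb. G2 x)"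
    unfolding P_def Q_def
    by (rule sphere_moment_4[OF cc(1) rad(1) v] sphere_moment_2[OF cc(3) rad(2) v] sphere_moment_4[OF cc(3) rad(2) v])+
  have "(LINT x|leb. limit_density lam (tangential_part (\<lambda>x. ?\<xi> x *\<^sub>R v)) x)
     = (LINT x|leb. G1 x) - 3 / 2 * (LINT x|leb. G1 x * Q x) + 6 * (LINT x|leb. G2 x * P x)
       + 12 * (LINT x|leb. G2 x * Q x) - 6 * (LINT x|leb. G2 x)"
    unfolding eq using I by simp
  also have "\<dots> = 4 / 5 * (LINT x|leb. G1 x) - 12 / 5 * (LINT x|leb. G2 x)"
    unfolding mom by simp
  also have "\<dots> < 0"
  proof -
    have CB: "?\<xi> \<in> Cc_infty B1 UNIV" by (rule Cc_infty_mono[OF C]) auto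
    have lapC: "(\<lambda>x. - (?\<xi> x * laplacian ?\<xi> x)) \<in> Cc_infty (B1 - {0}) UNIV"
      by (rule CK) (intro smooth_intros open_punctured smooth_on_partial sC, auto simp: x0)
    have "(LINT x|leb. G0 x) \<le> (LINT x|leb. 2 * G2 x)"
      unfolding G0_def integral_gradient_sq[OF CB]
    proof (rule integral_mono[OF Cc_punctured_integrable[OF lapC]])
      show "- (?\<xi> x * laplacian ?\<xi> x) \<le> 2 * G2 x" for x
        using cutoff_hardy[of x M] Cc_punctured_at_0[OF C] by (cases "x = 0") (auto simp: G2_def inverse_eq_divide)
    qed (use I in simp)
    moreover have "(LINT x|leb. G1 x) \<le> (LINT x|leb. G0 x + 1 / 2 * G2 x)"
    proof (rule integral_mono)
      show "G1 x \<le> G0 x + 1 / 2 * G2 x" for x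
      proof (cases "?\<xi> x = 0")
        case True
        then show ?thesis by (simp add: G1_def G0_def G2_def)
      next
        case False
        note s = cutoff_support[OF M(1) False]
        have t: "x \<bullet> x > 0" using s(1) by simp
        have "4 * lam * (x \<bullet> x) \<le> 1 / 2"
          using mult_left_mono[OF s(3), of "4 * lam"] lam M(2) by linarith
        then have "4 * lam \<le> 1 / 2 * inverse (x \<bullet> x)" using t by (simp add: field_simps)
        from mult_right_mono[OF this zero_le_power2[of "?\<xi> x"]] show ?thesis
          by (simp add: G1_def G0_def G2_def mult_ac)
      qed
    qed (use I in simp_all)
    moreover have "(LINT x|leb. G2 x) > 0"
    proof (rule integral_Cc_pos)
      show "G2 \<in> Cc_infty B1 UNIV" by (rule Cc_infty_mono[OF cc(3)]) auto
      show "G2 x \<ge> 0" for x by (simp add: G2_def)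
      \<comment> \<open>At this point the profile is evaluated at the centre of its support.\<close>
      let ?x0 = "exp (- M / 2) *\<^sub>R axis 1 1 :: real^3"
      have "?x0 \<bullet> ?x0 = exp (- M / 2) * exp (- M / 2)" by (simp add: inner_axis)
      also have "\<dots> = exp (- M)" by (simp add: exp_add[symmetric])
      finally have x0: "?x0 \<bullet> ?x0 = exp (- M)" .
      show "G2 ?x0 > 0" unfolding G2_def cutoff_def x0 profile_def by (simp add: flat_exp_def)
    qed
    ultimately show ?thesis using I by simp
  qed
  finally show ?thesis .
qed

section \<open>Large penalty forces unit norm\<close>

lemma AE_nonzero: "AE x in leb. x \<noteq> 0"
proof -
  have "AE x in lebesgue. x \<notin> {0 :: real^3}"
    by (rule AE_not_in) (simp add: negligible_iff_null_sets[symmetric])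
  then show ?thesis by (auto simp: AE_restrict_space_iff elim: eventually_mono)
qed

lemma AE_in_B1: "AE x in leb. x \<in> B1"
  using AE_space[of "leb"] by (simp add: space_restrict_space)

lemma W12_add_scaleR:
  assumes P: "P \<in> W12" and Q: "Q \<in> W12"
  shows "(\<lambda>x. P x + c *\<^sub>R Q x) \<in> W12"
proof -
  have L2: "(\<lambda>x. f x + c *\<^sub>R g x) \<in> L2" if f: "f \<in> L2" and g: "g \<in> L2" for f g
  proof -
    have m: "f \<in> borel_measurable (leb)" "g \<in> borel_measurable (leb)"
      and i: "integrable (leb) (\<lambda>x. (norm (f x))\<^sup>2)" "integrable (leb) (\<lambda>x. (norm (g x))\<^sup>2)"
      using f g by (auto simp: L2_def)
    have m': "(\<lambda>x. f x + c *\<^sub>R g x) \<in> borel_measurable (leb)"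
      using m by measurable
    have "integrable (leb) (\<lambda>x. (norm (f x + c *\<^sub>R g x))\<^sup>2)"
    proof (rule Bochner_Integration.integrable_bound)
      show "integrable (leb) (\<lambda>x. 2 * (norm (f x))\<^sup>2 + 2 * c\<^sup>2 * (norm (g x))\<^sup>2)"
        using i by simp
      show "(\<lambda>x. (norm (f x + c *\<^sub>R g x))\<^sup>2) \<in> borel_measurable (leb)"
        using m' by measurable
      have "(norm (f x + c *\<^sub>R g x))\<^sup>2 \<le> 2 * (norm (f x))\<^sup>2 + 2 * c\<^sup>2 * (norm (g x))\<^sup>2" for x
      proof -
        have "0 \<le> (norm (f x + (- c) *\<^sub>R g x))\<^sup>2" by simp
        then show ?thesis unfolding norm_add_scaleR_sq by simp
      qed
      then show "AE x in leb. norm ((norm (f x + c *\<^sub>R g x))\<^sup>2) \<le> norm (2 * (norm (f x))\<^sup>2 + 2 * c\<^sup>2 * (norm (g x))\<^sup>2)"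
        by (intro AE_I2) simp
    qed
    with m' show ?thesis by (simp add: L2_def)
  qed
  have "AE x in leb. P x \<in> S0" "AE x in leb. Q x \<in> S0" using P Q by (auto simp: W12_def)
  then have S: "AE x in leb. P x + c *\<^sub>R Q x \<in> S0"
  proof eventually_elim
    case (elim x)
    then show ?case using S0_add_scaleR[of "P x" "Q x" 1 c] by simp
  qed
  have "\<exists>h\<in>L2. has_weak_partial i (\<lambda>x. P x + c *\<^sub>R Q x) h" for i
  proof -
    obtain f g where "f \<in> L2" "has_weak_partial i P f" "g \<in> L2" "has_weak_partial i Q g"
      using P Q unfolding W12_def by blast
    then show ?thesis using L2[of f g] has_weak_partial_add_scaleR[of i P f Q g c] by blast
  qed
  moreover have "(\<lambda>x. P x + c *\<^sub>R Q x) \<in> L2" using P Q L2 by (simp add: W12_def)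
  ultimately show ?thesis using S by (simp add: W12_def)
qed

lemma zero_W12_0: "(\<lambda>x. 0) \<in> W12_0"
proof -
  note z = zero_Cc_infty
  have p: "partial i (\<lambda>x :: real^3. 0 :: real^3^3) = (\<lambda>x. 0)" for i by (rule ext) (rule partial_const)
  have l: "(\<lambda>x. 0) \<in> L2" by (simp add: L2_def)
  have "has_weak_partial i (\<lambda>x. 0) (\<lambda>x. 0)" for i using Cc_has_weak_partial[OF z, of i] by (simp only: p)
  then have "(\<lambda>x. 0) \<in> W12" using l zero_in_S0 unfolding W12_def by blast
  moreover have "W12_dist_sq (\<lambda>x. 0) (\<lambda>x. 0) = 0" by (simp add: W12_dist_sq_def)
  then have "(\<lambda>n :: nat. W12_dist_sq (\<lambda>x. 0) (\<lambda>x. 0)) \<longlonglongrightarrow> 0" by simp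
  ultimately show ?thesis unfolding W12_0_def using z by (intro CollectI conjI exI[of _ "\<lambda>n x. 0"]) auto
qed

lemma equivariant_Hbar: "equivariant Hbar"
  unfolding equivariant_def
proof (intro allI impI AE_I2)
  fix R :: "real^3^3" and x :: "real^3"
  assume R: "orthogonal_matrix R"
  have "orthogonal_transformation ((*v) R)" using R by (simp add: orthogonal_transformation_matrix)
  then have n: "(R *v x) \<bullet> (R *v x) = x \<bullet> x" by (simp add: orthogonal_transformation_def)
  have o: "outer_product (R *v x) (R *v x) = R ** outer_product x x ** transpose R"
    by (simp add: outer_product_def matrix_matrix_mult_def matrix_vector_mult_def transpose_def vec_eq_iff
        sum_product sum_distrib_left sum_distrib_right mult_ac)
  have RR: "R ** mat 1 ** transpose R = mat 1" using R by (simp add: orthogonal_matrix_def)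
  have e: "R ** (A - B) ** transpose R = R ** A ** transpose R - R ** B ** transpose R" for A B :: "real^3^3"
    by (simp add: bounded_bilinear.diff_left[OF bounded_bilinear_matrix_mult] bounded_bilinear.diff_right[OF bounded_bilinear_matrix_mult])
  show "Hbar (R *v x) = R ** Hbar x ** transpose R"
    unfolding Hbar_eq n o using RR by (simp add: e matrix_mult_expand)
qed

text \<open>The scalar factor is normalised by \<open>sqrt (3 / 2)\<close>, so that it is the norm of \<open>H\<close>.\<close>

definition radial_profile :: "(real \<Rightarrow> real) \<Rightarrow> (real^3 \<Rightarrow> real^3^3) \<Rightarrow> bool" where
  "radial_profile u H \<longleftrightarrow> u ` {0..1} \<subseteq> {0..1} \<and> mono_on {0..1} u \<and>
     (\<forall>x. x \<noteq> 0 \<longrightarrow> norm x < 1 \<longrightarrow> H x = u (norm x) *\<^sub>R Hbar x)"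

lemma radial_profileD:
  assumes "radial_profile u H"
  shows "0 \<le> r \<Longrightarrow> r \<le> 1 \<Longrightarrow> 0 \<le> u r \<and> u r \<le> 1"
    and "0 \<le> b \<Longrightarrow> b \<le> c \<Longrightarrow> c \<le> 1 \<Longrightarrow> u b \<le> u c"
    and "x \<noteq> 0 \<Longrightarrow> norm x < 1 \<Longrightarrow> H x = u (norm x) *\<^sub>R Hbar x"
  using assms unfolding radial_profile_def by (auto simp: mono_on_def image_subset_iff)

lemma radial_hedgehog_profile:
  assumes "radial_hedgehog lam \<mu> H"
  obtains u where "radial_profile u H"
proof -
  obtain s :: "real \<Rightarrow> real" where s: "mono_on {0..1} s" "s 0 = 0" "s 1 = sqrt (3 / 2)"
    "\<And>x. 0 < norm x \<and> norm x < 1 \<Longrightarrow> H x = s (norm x) *\<^sub>R (outer_product (x /\<^sub>R norm x) (x /\<^sub>R norm x) - (1 / 3) *\<^sub>R mat 1)"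
    using assms unfolding radial_hedgehog_def by blast
  define u where "u r = s r / sqrt (3 / 2)" for r
  have m: "s a \<le> s b" if "0 \<le> a" "a \<le> b" "b \<le> 1" for a b
    using s(1) that by (auto simp: mono_on_def)
  have "0 \<le> u r" "u r \<le> 1" if "r \<in> {0..1}" for r
    using m[of 0 r] m[of r 1] that s(2,3) by (simp_all add: u_def)
  moreover have "mono_on {0..1} u"
    using m by (auto simp: mono_on_def u_def intro: divide_right_mono)
  moreover have "H x = u (norm x) *\<^sub>R Hbar x" if "x \<noteq> 0" "norm x < 1" for x
    using s(4)[of x] that by (simp add: u_def Hbar_def)
  ultimately have "radial_profile u H" by (auto simp: radial_profile_def image_subset_iff)
  then show ?thesis by (rule that)
qed

lemma AE_hedgehog:
  assumes "\<And>x. x \<noteq> 0 \<Longrightarrow> norm x < 1 \<Longrightarrow> P x"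
  shows "AE x in leb. P x"
  using AE_nonzero AE_in_B1 by eventually_elim (simp add: assms)

lemma hedgehog_norm_le_1:
  assumes "radial_hedgehog lam \<mu> H"
  shows "AE x in leb. norm (H x) \<le> 1"
proof -
  obtain u where "radial_profile u H" by (rule radial_hedgehog_profile[OF assms])
  note u = radial_profileD[OF this]
  show ?thesis
  proof (rule AE_hedgehog)
    fix x :: "real^3" assume "x \<noteq> 0" "norm x < 1"
    then show "norm (H x) \<le> 1" using u(1)[of "norm x"] u(3)[of x] by (simp add: norm_Hbar)
  qed
qed

lemma hedgehog_W12: "radial_hedgehog lam \<mu> H \<Longrightarrow> H \<in> W12"
  by (simp add: radial_hedgehog_def admissible_def)

text \<open>That the hedgehog with constant norm belongs to the Sobolev space, despite its singularity, needs no
  computation: the boundary condition of \<open>H\<close> says that \<open>H - Hbar\<close> does.\<close>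

lemma Hbar_admissible:
  assumes "radial_hedgehog lam \<mu> H"
  shows "Hbar \<in> admissible"
proof -
  have "(\<lambda>x. H x - Hbar x) \<in> W12"
    using assms by (simp add: radial_hedgehog_def admissible_def agree_on_boundary_def W12_0_def)
  from W12_add_scaleR[OF hedgehog_W12[OF assms] this, of "-1"] have "Hbar \<in> W12" by simp
  then show ?thesis
    using equivariant_Hbar zero_W12_0 by (simp add: admissible_def agree_on_boundary_def)
qed

lemma W_ge: "norm Q \<le> 1 \<Longrightarrow> W Q \<ge> - 1"
proof -
  assume n: "norm Q \<le> 1"
  have "norm Q * norm Q * norm Q \<le> 1 * 1 * 1" using n by (intro mult_mono mult_nonneg_nonneg) auto
  then have t: "trace (Q ** Q ** Q) \<le> 1" using trace_mult3_le[of Q Q Q] by linarith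
  have a: "0 \<le> 1 / (4 * sqrt 6) * norm Q ^ 4" "0 \<le> 1 / (12 * sqrt 6)" by simp_all
  show ?thesis unfolding W_def using t a by linarith
qed

text \<open>\<open>Hbar\<close> is a competitor whose energy is free of \<open>\<mu>\<close>, so the energies of the minimisers are bounded
  uniformly in \<open>\<mu>\<close>, and in particular the penalty term is.\<close>

lemma hedgehog_norm_defect:
  assumes lam: "lam > 0"
  shows "\<exists>C. \<forall>\<mu> H. \<mu> > 0 \<longrightarrow> radial_hedgehog lam \<mu> H \<longrightarrow> (LINT x|leb. (1 - (norm (H x))\<^sup>2)\<^sup>2) \<le> C / \<mu>"
proof -
  define E where "E = energy lam 0 Hbar"
  define V where "V = (LINT x|leb. (1 :: real))"
  have "(LINT x|leb. (1 - (norm (H x))\<^sup>2)\<^sup>2) \<le> 4 * (E + lam * V) / \<mu>"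
    if \<mu>: "\<mu> > 0" and H: "radial_hedgehog lam \<mu> H" for \<mu> H
  proof -
    have HbW: "Hbar \<in> W12" using Hbar_admissible[OF H] by (simp add: admissible_def)
    have Hb1: "AE x in leb. norm (Hbar x) \<le> 1" by (rule AE_hedgehog) (simp add: norm_Hbar)
    note iHb = integrable_energy_density[OF HbW Hb1 zero_Cc_infty] and iH = integrable_energy_density[OF hedgehog_W12[OF H] hedgehog_norm_le_1[OF H] zero_Cc_infty]
    have i2: "integrable (leb) (\<lambda>x. (1 - (norm (H x))\<^sup>2)\<^sup>2)"
      using integrable_densities(14)[OF hedgehog_W12[OF H] hedgehog_norm_le_1[OF H] zero_Cc_infty] .
    have "energy lam \<mu> Hbar = E"
      unfolding E_def energy_eq
    proof (rule integral_cong_AE)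
      show "AE x in leb. energy_density lam \<mu> Hbar x = energy_density lam 0 Hbar x"
        by (rule AE_hedgehog) (simp add: energy_density_def norm_Hbar)
    qed (use iHb borel_measurable_integrable in blast)+
    then have le: "energy lam \<mu> H \<le> E"
      using H Hbar_admissible[OF H] unfolding radial_hedgehog_def by metis
    have "(LINT x|leb. \<mu> / 4 * (1 - (norm (H x))\<^sup>2)\<^sup>2 - lam * 1) \<le> energy lam \<mu> H"
      unfolding energy_eq
    proof (rule integral_mono_AE)
      show "integrable (leb) (\<lambda>x. \<mu> / 4 * (1 - (norm (H x))\<^sup>2)\<^sup>2 - lam * 1)"
        by (intro Bochner_Integration.integrable_diff integrable_mult_right i2 finite_measure.integrable_const[OF finite_measure_B1])
      show "AE x in leb. \<mu> / 4 * (1 - (norm (H x))\<^sup>2)\<^sup>2 - lam * 1 \<le> energy_density lam \<mu> H x"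
        using hedgehog_norm_le_1[OF H]
      proof eventually_elim
        case (elim x)
        have "lam * W (H x) \<ge> lam * (- 1)" using W_ge[OF elim] lam by (intro mult_left_mono) auto
        moreover have "0 \<le> 1 / 2 * (\<Sum>i\<in>UNIV. (norm (weak_partial i H x))\<^sup>2)" by (simp add: sum_nonneg)
        ultimately show ?case unfolding energy_density_def by linarith
      qed
    qed (rule iH)
    moreover have "(LINT x|leb. \<mu> / 4 * (1 - (norm (H x))\<^sup>2)\<^sup>2 - lam * 1)
       = \<mu> / 4 * (LINT x|leb. (1 - (norm (H x))\<^sup>2)\<^sup>2) - lam * V"
      unfolding V_def
      by (simp only: integral_mult_right_zero
          Bochner_Integration.integral_diff[OF integrable_mult_right[OF i2] finite_measure.integrable_const[OF finite_measure_B1]])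
    ultimately have "\<mu> / 4 * (LINT x|leb. (1 - (norm (H x))\<^sup>2)\<^sup>2) \<le> E + lam * V" using le by linarith
    then show ?thesis using \<mu> by (simp add: field_simps)
  qed
  then show ?thesis by blast
qed

text \<open>By monotonicity the defect at radius \<open>a\<close> is a lower bound for the defect on the whole ball of radius
  \<open>a\<close>, which is small in mean square.\<close>

lemma hedgehog_profile_defect:
  assumes lam: "lam > 0" and a: "0 < a" "a < 1"
  shows "\<exists>C. \<forall>\<mu> H u. \<mu> > 0 \<longrightarrow> radial_hedgehog lam \<mu> H \<longrightarrow> radial_profile u H \<longrightarrow> 1 - u a \<le> sqrt (C / \<mu>)"
proof -
  obtain C where C: "\<And>\<mu> H. \<mu> > 0 \<Longrightarrow> radial_hedgehog lam \<mu> H \<Longrightarrow> (LINT x|leb. (1 - (norm (H x))\<^sup>2)\<^sup>2) \<le> C / \<mu>"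
    using hedgehog_norm_defect[OF lam] by blast
  define m where "m = measure lebesgue (ball (0 :: real^3) a)"
  have m: "m > 0" unfolding m_def using a by (simp add: content_ball_pos)
  have "1 - u a \<le> sqrt ((C / m) / \<mu>)"
    if \<mu>: "\<mu> > 0" and H: "radial_hedgehog lam \<mu> H" and prof: "radial_profile u H" for \<mu> H u
  proof -
    note u = radial_profileD[OF prof]
    have i2: "integrable (leb) (\<lambda>x. (1 - (norm (H x))\<^sup>2)\<^sup>2)"
      using integrable_densities(14)[OF hedgehog_W12[OF H] hedgehog_norm_le_1[OF H] zero_Cc_infty] .
    have ua: "0 \<le> u a" "u a \<le> 1" using u(1)[of a] a by auto
    have ib: "integrable (leb) (indicator (ball 0 a) :: real^3 \<Rightarrow> real)"
      proof (rule bounded_imp_integrable_B1[where B=1, OF measurable_restrict_space1 AE_I2])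
      show "(indicator (ball 0 a) :: real^3 \<Rightarrow> real) \<in> borel_measurable lebesgue"
        by (rule borel_measurable_indicator) simp
    qed (simp add: indicator_def)
    have "(LINT x|leb. indicator (ball 0 a) x) = (LINT x|lebesgue. indicator (ball (0 :: real^3) a) x :: real)"
    proof -
      have "indicator B1 x *\<^sub>R indicator (ball 0 a) x = (indicator (ball 0 a) x :: real)" for x :: "real^3"
        using a by (auto simp: indicator_def)
      moreover have "B1 \<inter> space lebesgue \<in> sets lebesgue" by simp
      ultimately show ?thesis by (simp only: integral_restrict_space)
    qed
    also have "\<dots> = m" by (simp add: m_def)
    finally have im: "(LINT x|leb. indicator (ball 0 a) x) = m" .
    have "(LINT x|leb. (1 - u a)\<^sup>2 * indicator (ball 0 a) x) \<le> (LINT x|leb. (1 - (norm (H x))\<^sup>2)\<^sup>2)"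
    proof (rule integral_mono_AE)
      show "AE x in leb. (1 - u a)\<^sup>2 * indicator (ball 0 a) x \<le> (1 - (norm (H x))\<^sup>2)\<^sup>2"
      proof (rule AE_hedgehog)
        fix x :: "real^3" assume x: "x \<noteq> 0" "norm x < 1"
        show "(1 - u a)\<^sup>2 * indicator (ball 0 a) x \<le> (1 - (norm (H x))\<^sup>2)\<^sup>2"
        proof (cases "norm x < a")
          case True
          have ux: "0 \<le> u (norm x)" "u (norm x) \<le> u a" using u(1)[of "norm x"] u(2)[of "norm x" a] True a by auto
          have "(u (norm x))\<^sup>2 \<le> u (norm x) * 1" unfolding power2_eq_square using ux ua by (intro mult_left_mono) auto
          then have "1 - u a \<le> 1 - (norm (H x))\<^sup>2" using ux by (simp add: u(3)[OF x] norm_Hbar[OF x(1)])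
          then have "(1 - u a)\<^sup>2 \<le> (1 - (norm (H x))\<^sup>2)\<^sup>2" using ua by (intro power_mono) auto
          then show ?thesis using True by simp
        qed simp
      qed
    qed (use ib i2 in simp_all)
    then have "(1 - u a)\<^sup>2 * m \<le> C / \<mu>" using C[OF \<mu> H] by (simp only: integral_mult_right_zero im)
    then have "(1 - u a)\<^sup>2 \<le> (C / m) / \<mu>" using m \<mu> by (simp add: field_simps)
    then show ?thesis by (rule real_le_rsqrt)
  qed
  then show ?thesis by blast
qed

section \<open>Passing to the limit in the second variation\<close>

text \<open>The delicate term is \<open>- \<mu> \<integral> (1 - |H|\<^sup>2) |\<Psi>|\<^sup>2\<close>, in which a large factor meets a small one. It is at most
  \<open>- \<mu> \<integral> (1 - u\<^sup>2) u \<eta>\<close> with \<open>\<eta> = |\<Psi>|\<^sup>2\<close>, and this is exactly the term that appears when the equation of \<open>H\<close>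
  is tested with \<open>T = \<eta> Hbar\<close>. There it equals, up to \<open>lam \<eta>\<close>, minus the integral of \<open>\<nabla>H : \<nabla>T\<close>, that is the
  integral of \<open>u w\<close> with \<open>w = \<Delta>\<eta> - 6 \<eta> / |x|\<^sup>2\<close>. On the support of \<open>\<Psi>\<close> the factor \<open>u\<close> differs from 1 by at
  most \<open>1 - u a\<close>, and the integral of \<open>w\<close> itself is the multiplier term of the limit density.\<close>

lemma second_variation_upper_bound:
  assumes lam: "lam > 0" and \<mu>: "\<mu> > 0" and H: "radial_hedgehog lam \<mu> H"
    and \<Psi>: "\<Psi> \<in> Cc_infty (B1 - {0}) S0" and tang: "\<And>x. x \<noteq> 0 \<Longrightarrow> Hbar x \<bullet> \<Psi> x = 0"
    and a: "0 < a" "a < 1" "\<And>x. norm x < a \<Longrightarrow> \<Psi> x = 0"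
    and prof: "radial_profile u H"
  defines "w \<equiv> (\<lambda>x. laplacian (\<lambda>y. (norm (\<Psi> y))\<^sup>2) x - 6 * (norm (\<Psi> x))\<^sup>2 / (x \<bullet> x))"
  shows "second_variation lam \<mu> \<Psi> H \<le> (LINT x|leb. limit_density lam \<Psi> x) + (1 - u a) * (LINT x|leb. \<bar>w x\<bar>)"
proof -
  note u = radial_profileD[OF prof]
  define \<eta> where "\<eta> x = (norm (\<Psi> x))\<^sup>2" for x
  define T where "T x = \<eta> x *\<^sub>R Hbar x" for x
  have \<eta>: "\<eta> \<in> Cc_infty (B1 - {0}) UNIV"
    unfolding \<eta>_def[abs_def] power2_norm_eq_inner
    by (rule Cc_infty_transfer[OF \<Psi> open_UNIV]) (auto intro!: smooth_intros Cc_infty_smooth_on[OF \<Psi>])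
  have T: "T \<in> Cc_infty (B1 - {0}) S0" unfolding T_def[abs_def] by (rule scaleR_Hbar_Cc[OF \<eta>])
  have \<Psi>B: "\<Psi> \<in> Cc_infty B1 S0" and TB: "T \<in> Cc_infty B1 S0" and \<eta>B: "\<eta> \<in> Cc_infty B1 UNIV"
    using Cc_infty_mono[OF \<Psi>, of B1 S0] Cc_infty_mono[OF T, of B1 S0] Cc_infty_mono[OF \<eta>, of B1 UNIV] by auto
  note HW = hedgehog_W12[OF H] and H1 = hedgehog_norm_le_1[OF H]
  have crit: "critical_point lam \<mu> H" using H by (simp add: radial_hedgehog_def)
  have \<eta>0: "0 \<le> \<eta> x" for x by (simp add: \<eta>_def)
  define Y where "Y x = (1 - (norm (H x))\<^sup>2) * (H x \<bullet> T x)" for x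
  define A where "A x = (\<Sum>i\<in>UNIV. weak_partial i H x \<bullet> partial i T x)" for x
  define N where "N x = (\<Sum>i\<in>UNIV. (norm (partial i \<Psi> x))\<^sup>2)" for x
  have iY: "integrable (leb) Y" unfolding Y_def[abs_def] by (rule integrable_densities(6)[OF HW H1 TB])
  have iA: "integrable (leb) A" unfolding A_def[abs_def] by (rule integrable_gradient_product[OF HW H1 TB])
  have iN: "integrable (leb) N" unfolding N_def[abs_def]
    by (rule Bochner_Integration.integrable_sum) (rule integrable_densities(7)[OF HW H1 \<Psi>B])
  have i\<eta>: "integrable (leb) \<eta>" by (rule integral_B1_Cc(1)[OF \<eta>B])
  have form: "H x \<bullet> \<Psi> x = 0" "H x \<bullet> T x = u (norm x) * \<eta> x" "norm (H x) = u (norm x)" "0 \<le> u (norm x)" "u (norm x) \<le> 1"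
    "H x = u (norm x) *\<^sub>R Hbar x"
    if x: "x \<noteq> 0" "norm x < 1" for x
    using u(1)[of "norm x"] x tang[OF x(1)] inner_Hbar_Hbar[OF x(1)] norm_Hbar[OF x(1)]
    by (simp_all add: u(3)[OF x] T_def)
  \<comment> \<open>Y is the multiplier density tested with T; replacing 1 - u^2 by (1 - u^2) u only decreases it.\<close>
  have "second_variation lam \<mu> \<Psi> H = (LINT x|leb. 2 * second_density lam \<mu> H \<Psi> x)"
    unfolding second_variation_eq[OF HW H1 \<Psi>B] by simp
  also have "\<dots> \<le> (LINT x|leb. N x + 3 * lam * \<eta> x - \<mu> * Y x)"
  proof (rule integral_mono_AE)
    show "integrable (leb) (\<lambda>x. 2 * second_density lam \<mu> H \<Psi> x)"
      using integrable_second_density[OF HW H1 \<Psi>B] by simp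
    show "integrable (leb) (\<lambda>x. N x + 3 * lam * \<eta> x - \<mu> * Y x)" using iN i\<eta> iY by simp
    show "AE x in leb. 2 * second_density lam \<mu> H \<Psi> x \<le> N x + 3 * lam * \<eta> x - \<mu> * Y x"
    proof (rule AE_hedgehog)
      fix x :: "real^3" assume x: "x \<noteq> 0" "norm x < 1"
      note f = form[OF x]
      define U where "U = u (norm x)"
      have U: "0 \<le> U" "U \<le> 1" using f by (simp_all add: U_def)
      have U2: "U\<^sup>2 \<le> 1" using U by (simp add: power_le_one)
      have "norm (H x) * norm (\<Psi> x) * norm (\<Psi> x) \<le> 1 * norm (\<Psi> x) * norm (\<Psi> x)"
        using U f(3) by (intro mult_right_mono) (auto simp: U_def)
      then have tr: "- trace (H x ** \<Psi> x ** \<Psi> x) \<le> \<eta> x"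
        using trace_mult3_le[of "H x" "\<Psi> x" "\<Psi> x"] by (simp add: \<eta>_def power2_eq_square)
      have s6: "U\<^sup>2 * \<eta> x / (2 * sqrt 6) \<le> \<eta> x / 2"
      proof -
        have "1 \<le> sqrt 6" by simp
        then have "U\<^sup>2 * \<eta> x / (2 * sqrt 6) \<le> \<eta> x / (2 * 1)"
          using U2 \<eta>0[of x] by (intro frac_le) (auto simp: mult_left_le_one_le)
        then show ?thesis by simp
      qed
      have "lam * (U\<^sup>2 * \<eta> x / (2 * sqrt 6) - trace (H x ** \<Psi> x ** \<Psi> x)) \<le> lam * (3 / 2 * \<eta> x)"
        using s6 tr lam by (intro mult_left_mono) auto
      moreover have "\<mu> * ((1 - U\<^sup>2) * (U * \<eta> x)) \<le> \<mu> * ((1 - U\<^sup>2) * \<eta> x)"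
        using U U2 \<mu> \<eta>0[of x] by (intro mult_left_mono) (auto simp: mult_left_le_one_le)
      moreover have gen: "2 * (n / 2 + l + m * (0\<^sup>2 - y / 2)) = n + 2 * l - m * y" for n l m y :: real
        by (simp add: algebra_simps)
      have "2 * second_density lam \<mu> H \<Psi> x = N x + 2 * (lam * (U\<^sup>2 * \<eta> x / (2 * sqrt 6) - trace (H x ** \<Psi> x ** \<Psi> x)))
          - \<mu> * ((1 - U\<^sup>2) * \<eta> x)"
        unfolding second_density_def f(1) f(3) U_def[symmetric] \<eta>_def[symmetric] N_def[symmetric] gen by simp
      moreover have "Y x = (1 - U\<^sup>2) * (U * \<eta> x)" by (simp add: Y_def f(2,3) U_def)
      ultimately show "2 * second_density lam \<mu> H \<Psi> x \<le> N x + 3 * lam * \<eta> x - \<mu> * Y x" by simp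
    qed
  qed
  also have "\<dots> = (LINT x|leb. N x) + 3 * lam * (LINT x|leb. \<eta> x) - \<mu> * (LINT x|leb. Y x)"
    using iN i\<eta> iY by simp
  also have "\<dots> \<le> (LINT x|leb. N x) + 4 * lam * (LINT x|leb. \<eta> x) - (LINT x|leb. A x)"
  proof -
    \<comment> \<open>The equation of H tested with T; the derivative of the bulk potential along T is at least - \<eta>.\<close>
    have "(LINT x|leb. A x - lam * \<eta> x - \<mu> * Y x) \<le> (LINT x|leb. first_density lam \<mu> H T x)"
    proof (rule integral_mono_AE)
      show "integrable (leb) (\<lambda>x. A x - lam * \<eta> x - \<mu> * Y x)" using iA i\<eta> iY by simp
      show "integrable (leb) (first_density lam \<mu> H T)" by (rule integrable_first_density[OF HW H1 TB])
      show "AE x in leb. A x - lam * \<eta> x - \<mu> * Y x \<le> first_density lam \<mu> H T x"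
      proof (rule AE_hedgehog)
        fix x :: "real^3" assume x: "x \<noteq> 0" "norm x < 1"
        note f = form[OF x]
        have "norm (H x) * norm (H x) * norm (T x) \<le> 1 * 1 * \<eta> x"
          using f(3,4,5) \<eta>0[of x] norm_Hbar[OF x(1)] by (intro mult_mono) (auto simp: T_def)
        then have tr: "trace (H x ** H x ** T x) \<le> \<eta> x" using trace_mult3_le[of "H x" "H x" "T x"] by simp
        have p: "0 \<le> (norm (H x))\<^sup>2 * (H x \<bullet> T x) / sqrt 6" using f(2,4) \<eta>0[of x] by simp
        have "lam * (- \<eta> x) \<le> lam * ((norm (H x))\<^sup>2 * (H x \<bullet> T x) / sqrt 6 - trace (H x ** H x ** T x))"
          using tr p lam by (intro mult_left_mono) auto
        then show "A x - lam * \<eta> x - \<mu> * Y x \<le> first_density lam \<mu> H T x"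
          unfolding first_density_def A_def Y_def by linarith
      qed
    qed
    also have "\<dots> = 0" by (rule critical_point_first_density[OF HW H1 TB refl crit])
    finally have "(LINT x|leb. A x) - lam * (LINT x|leb. \<eta> x) - \<mu> * (LINT x|leb. Y x) \<le> 0"
      using iA i\<eta> iY by simp
    then show ?thesis by simp
  qed
  finally have bound: "second_variation lam \<mu> \<Psi> H \<le> (LINT x|leb. N x) + 4 * lam * (LINT x|leb. \<eta> x)
    - (LINT x|leb. A x)" .
  define D where "D x = laplacian \<eta> x" for x
  define R where "R x = \<eta> x * (1 / (x \<bullet> x))" for x
  have w: "w x = D x - 6 * R x" for x unfolding w_def D_def R_def \<eta>_def[abs_def] by simp
  have iD: "integrable (leb) D" and D0: "(LINT x|leb. D x) = 0"
  proof -
    have p: "integrable (leb) (partial i (partial i \<eta>))" "(LINT x|leb. partial i (partial i \<eta>) x) = 0" for i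
      by (rule integral_B1_Cc(1)[OF partial_Cc_infty[OF partial_Cc_infty[OF \<eta>B]]],
          rule integral_partial_eq_0[OF partial_Cc_infty[OF \<eta>B]])
    show "integrable (leb) D" unfolding D_def[abs_def] by (rule Bochner_Integration.integrable_sum) (rule p)
    show "(LINT x|leb. D x) = 0" unfolding D_def by (subst Bochner_Integration.integral_sum) (rule p, simp add: p)
  qed
  have iR: "integrable (leb) R" unfolding R_def[abs_def]
    by (rule Cc_punctured_integrable[OF Cc_mult_smooth[OF \<eta>]]) (intro smooth_intros open_punctured, auto)
  have iw: "integrable (leb) w" unfolding w[abs_def] using iD iR by simp
  have w_int: "(LINT x|leb. w x) = - 6 * (LINT x|leb. R x)"
    unfolding w using iD iR D0 by simp
  have l_int: "(LINT x|leb. limit_density lam \<Psi> x) = (LINT x|leb. N x) + 4 * lam * (LINT x|leb. \<eta> x)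
     - 6 * (LINT x|leb. R x)"
  proof -
    have "limit_density lam \<Psi> x = N x + 4 * lam * \<eta> x - 6 * R x" for x
      by (simp add: limit_density_def N_def \<eta>_def R_def)
    then show ?thesis using iN i\<eta> iR by simp
  qed
  have w_zero: "w x = 0" if x: "norm x < a" for x
  proof -
    have e: "x \<in> ball 0 a" "\<eta> y = 0" if "y \<in> ball 0 a" for y using a(3)[of y] that x by (auto simp: \<eta>_def)
    then have "partial i (partial i \<eta>) x = 0" for i
      using x by (intro partial_eq_0_open[of "ball 0 a"]) auto
    then show ?thesis using e(2)[of x] x by (simp add: w D_def R_def)
  qed
  have "- (LINT x|leb. A x) \<le> (LINT x|leb. w x) + (1 - u a) * (LINT x|leb. \<bar>w x\<bar>)"
  proof -
    have iH: "integrable (leb) H" by (rule bounded_imp_integrable_B1[OF W12_measurable[OF HW] H1])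
    have iHT: "integrable (leb) (\<lambda>x. H x \<bullet> partial i (partial i T) x)" for i
    proof -
      note c = partial_Cc_infty[OF partial_Cc_infty[OF TB], of i i]
      obtain B where B: "\<And>x. norm (partial i (partial i T) x) \<le> B" using Cc_infty_bounded[OF c] by blast
      show ?thesis
      proof (rule bounded_imp_integrable_B1[where B = B])
        show "(\<lambda>x. H x \<bullet> partial i (partial i T) x) \<in> borel_measurable (leb)"
          by (intro borel_measurable_inner W12_measurable[OF HW] Cc_infty_measurable[OF c])
        show "AE x in leb. norm (H x \<bullet> partial i (partial i T) x) \<le> B"
          using H1
        proof eventually_elim
          case (elim x)
          have "norm (H x) * norm (partial i (partial i T) x) \<le> 1 * B" using elim B by (intro mult_mono) auto
          then show ?case using Cauchy_Schwarz_ineq2[of "H x" "partial i (partial i T) x"] by simp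
        qed
      qed
    qed
    \<comment> \<open>Only the smooth field T is differentiated twice.\<close>
    have each: "(LINT x|leb. weak_partial i H x \<bullet> partial i T x) = - (LINT x|leb. H x \<bullet> partial i (partial i T) x)" for i
      by (rule weak_partial_inner[OF W12_weak_partial(1)[OF HW] partial_Cc_infty[OF TB] W12_weak_partial(4)[OF HW] iH])
    have "(LINT x|leb. A x) = (\<Sum>i\<in>UNIV. (LINT x|leb. weak_partial i H x \<bullet> partial i T x))"
      unfolding A_def by (rule Bochner_Integration.integral_sum) (rule integrable_gradient_component[OF HW H1 TB])
    also have "\<dots> = - (\<Sum>i\<in>UNIV. (LINT x|leb. H x \<bullet> partial i (partial i T) x))"
      by (simp only: each sum_negf)
    also have "(\<Sum>i\<in>UNIV. (LINT x|leb. H x \<bullet> partial i (partial i T) x))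
        = (LINT x|leb. (\<Sum>i\<in>UNIV. H x \<bullet> partial i (partial i T) x))"
      by (rule Bochner_Integration.integral_sum[symmetric]) (rule iHT)
    finally have "- (LINT x|leb. A x) = (LINT x|leb. (\<Sum>i\<in>UNIV. H x \<bullet> partial i (partial i T) x))" by simp
    also have "\<dots> \<le> (LINT x|leb. w x + (1 - u a) * \<bar>w x\<bar>)"
    proof (rule integral_mono_AE)
      show "integrable (leb) (\<lambda>x. \<Sum>i\<in>UNIV. H x \<bullet> partial i (partial i T) x)"
        by (rule Bochner_Integration.integrable_sum) (rule iHT)
      show "integrable (leb) (\<lambda>x. w x + (1 - u a) * \<bar>w x\<bar>)" using iw by simp
      show "AE x in leb. (\<Sum>i\<in>UNIV. H x \<bullet> partial i (partial i T) x) \<le> w x + (1 - u a) * \<bar>w x\<bar>"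
      proof (rule AE_hedgehog)
        fix x :: "real^3" assume x: "x \<noteq> 0" "norm x < 1"
        have "(\<Sum>i\<in>UNIV. H x \<bullet> partial i (partial i T) x) = u (norm x) * (Hbar x \<bullet> laplacian T x)"
          unfolding form(6)[OF x] by (simp add: inner_sum_right sum_distrib_left)
        also have "Hbar x \<bullet> laplacian T x = w x"
          unfolding T_def[abs_def] Hbar_inner_second_partial_product[OF \<eta> x(1)] by (simp add: w D_def R_def)
        finally have e: "(\<Sum>i\<in>UNIV. H x \<bullet> partial i (partial i T) x) = u (norm x) * w x" .
        show "(\<Sum>i\<in>UNIV. H x \<bullet> partial i (partial i T) x) \<le> w x + (1 - u a) * \<bar>w x\<bar>"
        proof (cases "norm x < a")
          case True
          then show ?thesis unfolding e by (simp add: w_zero)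
        next
          case False
          have uu: "u a \<le> u (norm x)" "u (norm x) \<le> 1" using u(2)[of a "norm x"] form(5)[OF x] False a x by auto
          have "(1 - u (norm x)) * (- w x) \<le> (1 - u (norm x)) * \<bar>w x\<bar>" using uu by (intro mult_left_mono) auto
          also have "\<dots> \<le> (1 - u a) * \<bar>w x\<bar>" using uu by (intro mult_right_mono) auto
          finally show ?thesis unfolding e by (simp add: algebra_simps)
        qed
      qed
    qed
    also have "\<dots> = (LINT x|leb. w x) + (1 - u a) * (LINT x|leb. \<bar>w x\<bar>)"
      using iw by simp
    finally show ?thesis .
  qed
  with bound show ?thesis unfolding l_int w_int by simp
qed

text \<open>For fixed \<open>\<Psi>\<close> the error in the upper bound is of order \<open>1 / sqrt \<mu>\<close>.\<close>

lemma second_variation_eventually_negative: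
  assumes lam: "lam > 0" and H: "\<And>\<mu>. \<mu> > 0 \<Longrightarrow> radial_hedgehog lam \<mu> (H \<mu>)"
    and \<Psi>: "\<Psi> \<in> Cc_infty (B1 - {0}) S0" and tang: "\<And>x. x \<noteq> 0 \<Longrightarrow> Hbar x \<bullet> \<Psi> x = 0"
    and neg: "(LINT x|leb. limit_density lam \<Psi> x) < 0"
  shows "\<forall>\<^sub>F \<mu> in at_top. second_variation lam \<mu> \<Psi> (H \<mu>) < 0"
proof -
  define w where "w = (\<lambda>x. laplacian (\<lambda>y. (norm (\<Psi> y))\<^sup>2) x - 6 * (norm (\<Psi> x))\<^sup>2 / (x \<bullet> x))"
  define L where "L = (LINT x|leb. limit_density lam \<Psi> x)"
  define w1 where "w1 = (LINT x|leb. \<bar>w x\<bar>)"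
  have w1: "0 \<le> w1" by (simp add: w1_def)
  obtain a where a: "0 < a" "a < 1" "\<And>x. norm x < a \<Longrightarrow> \<Psi> x = 0"
  proof -
    have "open (- closure {x. \<Psi> x \<noteq> 0})" "0 \<in> - closure {x. \<Psi> x \<noteq> 0}"
      using Cc_inftyD(5)[OF \<Psi>] by (auto simp: open_Compl)
    then obtain e where e: "e > 0" "ball 0 e \<subseteq> - closure {x. \<Psi> x \<noteq> 0}" using openE by blast
    show ?thesis
    proof (rule that[of "min e (1 / 2)"])
      fix x :: "real^3" assume "norm x < min e (1 / 2)"
      then have "x \<in> ball 0 e" by simp
      then have "x \<notin> closure {x. \<Psi> x \<noteq> 0}" using e(2) by blast
      then show "\<Psi> x = 0" using closure_subset[of "{x. \<Psi> x \<noteq> 0}"] by blast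
    qed (use e in auto)
  qed
  obtain C where C: "\<And>\<mu> h u. \<mu> > 0 \<Longrightarrow> radial_hedgehog lam \<mu> h \<Longrightarrow> radial_profile u h \<Longrightarrow> 1 - u a \<le> sqrt (C / \<mu>)"
    using hedgehog_profile_defect[OF lam a(1,2)] by blast
  have bound: "second_variation lam \<mu> \<Psi> (H \<mu>) \<le> L + sqrt (C / \<mu>) * w1" if \<mu>: "\<mu> > 0" for \<mu>
  proof -
    obtain u where u: "radial_profile u (H \<mu>)" by (rule radial_hedgehog_profile[OF H[OF \<mu>]])
    have "(1 - u a) * w1 \<le> sqrt (C / \<mu>) * w1"
      using C[OF \<mu> H[OF \<mu>] u] w1 by (rule mult_right_mono)
    moreover have "second_variation lam \<mu> \<Psi> (H \<mu>) \<le> L + (1 - u a) * w1"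
      unfolding L_def w1_def w_def
      by (rule second_variation_upper_bound[OF lam \<mu> H[OF \<mu>] \<Psi> tang a u])
    ultimately show ?thesis by linarith
  qed
  have "((\<lambda>\<mu>. C / \<mu>) \<longlongrightarrow> 0) at_top"
    by (rule tendsto_divide_0[OF tendsto_const filterlim_at_top_imp_at_infinity[OF filterlim_ident]])
  from tendsto_mult_right[OF tendsto_real_sqrt[OF this], of w1]
  have "((\<lambda>\<mu>. sqrt (C / \<mu>) * w1) \<longlongrightarrow> 0) at_top" by simp
  then have "\<forall>\<^sub>F \<mu> in at_top. sqrt (C / \<mu>) * w1 < - L"
    by (rule order_tendstoD(2)) (use neg in \<open>simp add: L_def\<close>)
  then show ?thesis
    using eventually_gt_at_top[of 0]
  proof eventually_elim
    case (elim \<mu>)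
    then show ?case using bound[of \<mu>] by linarith
  qed
qed

theorem theorem4p8:
  fixes lam :: real and H :: "real \<Rightarrow> real^3 \<Rightarrow> real^3^3"
  assumes "lam > 0"
    and "\<And>\<mu>. \<mu> > 0 \<Longrightarrow> radial_hedgehog lam \<mu> (H \<mu>)"
  shows "(\<exists>\<xi> \<in> Cc_infty (B1 - {0}) UNIV. radial \<xi> \<and>
            (\<forall>v \<in> S4. let \<Phi> = (\<lambda>x. \<xi> x *\<^sub>R v) in
               \<Phi> \<in> Cc_infty (B1 - {0}) S0 \<and>
               tangential_part \<Phi> \<in> Cc_infty (B1 - {0}) S0 \<and>
               (\<forall>\<^sub>F \<mu> in at_top. second_variation lam \<mu> (tangential_part \<Phi>) (H \<mu>) < 0)))
       \<and> (\<forall>\<^sub>F \<mu> in at_top. unstable_critical_point lam \<mu> (H \<mu>))"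
proof -
  \<comment> \<open>Dilation: the support is moved towards the origin until 4 lam |x|^2 is at most 1/2 on it.\<close>
  define M where "M = 21 + \<bar>ln (8 * lam)\<bar>"
  have M: "M > 20" "4 * lam * exp (- M + 20) \<le> 1 / 2"
  proof -
    show "M > 20" by (simp add: M_def)
    have "exp (- M + 20) \<le> exp (- ln (8 * lam))" by (simp add: M_def)
    also have "\<dots> = 1 / (8 * lam)" using assms(1) by (simp add: exp_minus inverse_eq_divide)
    finally show "4 * lam * exp (- M + 20) \<le> 1 / 2" using assms(1) by (simp add: field_simps)
  qed
  note C = cutoff_Cc[OF M(1)]
  have S: "v \<in> S0" if "v \<in> S4" for v using that by (simp add: S4_def)
  have neg: "\<forall>\<^sub>F \<mu> in at_top. second_variation lam \<mu> (tangential_part (\<lambda>x. cutoff M x *\<^sub>R v)) (H \<mu>) < 0" if v: "v \<in> S4" for v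
    by (rule second_variation_eventually_negative[OF assms tangential_part_Cc[OF C S[OF v]] Hbar_inner_tangential
        limit_density_negative[OF assms(1) M v]])
  have nz: "axis 1 1 \<noteq> (0 :: real^3)" by (simp add: axis_eq_0_iff)
  \<comment> \<open>Any direction will do for the instability.\<close>
  define v where "v = Hbar (axis 1 1)"
  have v: "v \<in> S4" using Hbar_in_S0[OF nz] norm_Hbar[OF nz] by (simp add: S4_def v_def)
  have t: "tangential_part (\<lambda>x. cutoff M x *\<^sub>R v) \<in> Cc_infty B1 S0"
    by (rule Cc_infty_mono[OF tangential_part_Cc[OF C S[OF v]]]) auto
  have "\<forall>\<^sub>F \<mu> in at_top. unstable_critical_point lam \<mu> (H \<mu>)"
    using neg[OF v] eventually_gt_at_top[of 0]
  proof eventually_elim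
    case (elim \<mu>)
    have "critical_point lam \<mu> (H \<mu>)" using assms(2)[OF elim(2)] by (simp add: radial_hedgehog_def)
    then show ?case unfolding unstable_critical_point_def using t elim(1) by blast
  qed
  then show ?thesis
    unfolding Let_def using neg radial_cutoff scaleR_const_Cc[OF C S] tangential_part_Cc[OF C S]
    by (intro conjI bexI[OF _ C] ballI) auto
qed

end
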